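(* $\mathcal{L}(C_2^4) = \mathcal{L}_1 \cup \mathcal{L}_2 \cup \mathcal{L}_3 \cup \mathcal{L}_4 \cup \mathcal{L}_5 \cup \mathcal{L}_6 \cup \mathcal{L}_7 \cup \mathcal{L}_8$, where \begin{align*} \mathcal{L}_1 &= \{ \{y\} \mid y \in \mathbb{N}_0 \},\\ \mathcal{L}_2 &= \{ y + 2k + 3 \cdot [0,k] \mid y, k \in \mathbb{N}_0 \},\\ \mathcal{L}_3 &= \{ y+[2,3],\ y+[2,4],\ y+[3,6],\ y+[3,7],\ y+[4,9] \mid y \in \mathbb{N}_0 \}\\ &\quad \cup \{ y + [m, m+k] \mid y \in \mathbb{N}_0,\ k \ge 6,\ m \text{ minimal with } m + k \le 5m/2 \}\\ &= \{ y + \lceil 2k/3 \rceil + [0,k] \mid y \in \mathbb{N}_0,\ k \in \mathbb{N} \setminus \{1,3\} \} \cup \{ y + 3 + [0,3],\ y + 2 + [0,1] \mid y \in \mathbb{N}_0 \},\\ \mathcal{L}_4 &= \{ y + 2k + 2 \cdot [0,k] \mid y, k \in \mathbb{N}_0 \},\\ \mathcal{L}_5 &= \{ y + k + 2 + ([0,k] \cup \{k+2\}) \mid y \in \mathbb{N}_0,\ k \in \mathbb{N} \},\\ \mathcal{L}_6 &= \{ y + 2\lceil k/3 \rceil + 2 + (\{0\} \cup [2,k+2]) \mid y \in \mathbb{N}_0,\ k \ge 5 \text{ or } k = 3 \},\\ \mathcal{L}_7 &= \{ y + 2k + 3 + \{0,1,3\} + 3 \cdot [0,k] \mid y, k \in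 \mathbb{N}_0 \}\\ &\quad \cup \{ (y + 2k + 4 + \{0,1,3\} + 3 \cdot [0,k]) \cup \{y + 5k + 8\} \mid y, k \in \mathbb{N}_0 \},\\ \mathcal{L}_8 &= \{ y + 2k + 3 + \{0,2,3\} + 3 \cdot [0,k] \mid y, k \in \mathbb{N}_0 \}\\ &\quad \cup \{ (y + 2k + 4 + \{0,2,3\} + 3 \cdot [0,k]) \cup \{y + 5k + 9\} \mid y, k \in \mathbb{N}_0 \}. \end{align*}
   Context: $\mathbb{N}$ is the set of positive integers and $\mathbb{N}_0 = \mathbb{N} \cup \{0\}$; in the descriptions of $\mathcal{L}_3$ and $\mathcal{L}_6$, $k$ and $m$ are positive integers. For integers $a \le b$, $[a,b] = \{x \in \mathbb{Z} \mid a \le x \le b\}$. For $A, B \subset \mathbb{Z}$ and $m \in \mathbb{Z}$: $A + B = \{a+b \mid a \in A, b \in B\}$, $m + A = \{m\} + A$, and $m \cdot A = \{ma \mid a \in A\}$ (dilation; it binds more tightly than $+$). $C_2^4$ is the elementary abelian $2$-group of rank $4$. For an additive abelian group $G$, let $\mathcal{F}(G)$ be the free abelian monoid (written multiplicatively) with basis $G$; its elements are called sequences over $G$: $S = g_1 \cdots g_\ell$, i.e. finite multisets of elements of $G$, with sum $\sigma(S) = g_1 + \dots + g_\ell$. $\mathcal{B}(G) = \{S \in \mathcal{F}(G) \mid \sigma(S) = 0\}$ is the monoid of zero-sum sequences over $G$; its identity is the empty sequence. An atom (irreducible element) of $\mathcal{B}(G)$ is a nonempty zero-sum sequence which is not a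 product of two nonempty zero-sum sequences; note the sequence consisting of the single term $0$ is an atom. For a nonempty $A \in \mathcal{B}(G)$, its set of lengths $\mathsf{L}(A)$ is the set of all $k \in \mathbb{N}$ such that $A$ is a product of $k$ atoms; for the empty sequence, $\mathsf{L} = \{0\}$. $\mathcal{L}(G) = \{ \mathsf{L}(A) \mid A \in \mathcal{B}(G) \}$ is the system of sets of lengths. *)

theory Defs
  imports
    Complex_Main
    "HOL-Library.Multiset"
    "HOL-Library.Set_Algebras"
    "HOL-Library.Z2"
    "HOL-Analysis.Finite_Cartesian_Product"
begin

text \<open>
  Sequences over an additive abelian group are finite multisets; the product of sequences is the
  multiset sum and the empty sequence is the empty multiset.
\<close>

definition zero_sum_sequences :: "'a::ab_group_add multiset set" where
  "zero_sum_sequences = {S. \<Sum>\<^sub># S = 0}"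

definition zero_sum_atom :: "'a::ab_group_add multiset \<Rightarrow> bool" where
  "zero_sum_atom U \<longleftrightarrow>
     U \<in> zero_sum_sequences \<and> U \<noteq> {#} \<and>
     \<not> (\<exists>S \<in> zero_sum_sequences. \<exists>T \<in> zero_sum_sequences. S \<noteq> {#} \<and> T \<noteq> {#} \<and> U = S + T)"

text \<open>A factorization is a multiset \<open>F\<close> of atoms, and its product is the multiset union \<open>\<Sum>\<^sub># F\<close>.\<close>

definition set_of_lengths :: "'a::ab_group_add multiset \<Rightarrow> nat set" where
  "set_of_lengths A =
     (if A = {#} then {0}
      else {k. k \<ge> 1 \<and> (\<exists>F. size F = k \<and> (\<forall>U \<in># F. zero_sum_atom U) \<and> A = \<Sum>\<^sub># F)})"

definition system_of_sets_of_lengths :: "'a::ab_group_add itself \<Rightarrow> nat set set" where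
  "system_of_sets_of_lengths _ = set_of_lengths ` (zero_sum_sequences :: 'a multiset set)"

text \<open>The elementary abelian 2-group of rank 4; \<open>bit\<close> is the field with two elements.\<close>

type_synonym c2_4 = "bit ^ 4"

text \<open>
  All the sets below consist of nonnegative integers and are formed without subtraction, hence they
  are sets of naturals. \<open>A + B\<close> is the sumset, \<open>m +o A\<close> the translate \<open>m + A\<close>, and \<open>m *o A\<close> the
  dilation of \<open>A\<close> by \<open>m\<close>. \<open>L3\<close> and \<open>L3_alt\<close> are two descriptions of the same system.
\<close>

definition L1 :: "nat set set" where
  "L1 = {{y} | y. True}"

definition L2 :: "nat set set" where
  "L2 = {(y + 2 * k) +o (3 *o {0..k}) | y k. True}"

definition L3 :: "nat set set" where
  "L3 = (\<Union>y. {y +o {2..3}, y +o {2..4}, y +o {3..6}, y +o {3..7}, y +o {4..9}})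
     \<union> {y +o {m..m + k} | y k m.
          k \<ge> 6 \<and> m = (LEAST m'. m' \<ge> 1 \<and> real (m' + k) \<le> 5 * real m' / 2)}"

definition L3_alt :: "nat set set" where
  "L3_alt = {(y + nat \<lceil>2 * real k / 3\<rceil>) +o {0..k} | y k. k \<ge> 1 \<and> k \<notin> {1, 3}}
     \<union> (\<Union>y. {(y + 3) +o {0..3}, (y + 2) +o {0..1}})"

definition L4 :: "nat set set" where
  "L4 = {(y + 2 * k) +o (2 *o {0..k}) | y k. True}"

definition L5 :: "nat set set" where
  "L5 = {(y + k + 2) +o ({0..k} \<union> {k + 2}) | y k. k \<ge> 1}"

definition L6 :: "nat set set" where
  "L6 = {(y + 2 * nat \<lceil>real k / 3\<rceil> + 2) +o ({0} \<union> {2..k + 2}) | y k. k \<ge> 5 \<or> k = 3}"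

definition L7 :: "nat set set" where
  "L7 = {(y + 2 * k + 3) +o ({0, 1, 3} + 3 *o {0..k}) | y k. True}
     \<union> {((y + 2 * k + 4) +o ({0, 1, 3} + 3 *o {0..k})) \<union> {y + 5 * k + 8} | y k. True}"

definition L8 :: "nat set set" where
  "L8 = {(y + 2 * k + 3) +o ({0, 2, 3} + 3 *o {0..k}) | y k. True}
     \<union> {((y + 2 * k + 4) +o ({0, 2, 3} + 3 *o {0..k})) \<union> {y + 5 * k + 9} | y k. True}"

end

(* The atoms of length at least three over C_2^4 are the zero-sum sets C of nonzero elements with
   3 <= |C| <= 5 ("circuits"). If two circuits occur in a factorization F, then exchanging elements
   between them gives a factorization that is longer by exactly one, except for a few shapes: two
   equal circuits of cardinality 4 or 5, a 4-circuit and a 5-circuit sharing three elements, and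
   some pairs of small or disjoint circuits, which can be traded for squares without changing the
   length. Hence, if n is a length of A, n + 1 is not, and n is not the maximal length, one of the
   exceptional shapes occurs, and playing the remaining atoms off against it shows that either

   - the support of A lies in the union of a 4-circuit and a 5-circuit sharing three elements.
     Such a union carries just three circuits, so the set of lengths is given by an explicit linear
     system in their three multiplicities, whence L2, L4, L6, L7 and L8; or

   - A = D + D, n = |D| - 2, and the support of A avoids a subgroup of index two, so all atoms have
     even length. Then n + 1 is the only missing length, whence L5 (or L4).

   In all other cases the set of lengths is an interval, bounded by 2 max L <= |A| <= 5 min L. *)
theory Submission imports Defs begin

section \<open>Atoms\<close>

text \<open>Not being extendable by one passes from a factorization to its subproducts and survives
  length-preserving swaps. So mostly pairs of atoms are examined, and a third atom is excluded by
  swapping it with one member of a pair and testing the outcome against the other member. What pairs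
  cannot settle is a family of circuits without common elements; these are handled by counting.
  Among the factorizations in question of one length, take one with the most squares. Unless one of
  the two outcomes holds, its circuits are pairwise disjoint, so their union is the set of elements
  of odd multiplicity in \<open>A\<close>, and the number of squares depends on \<open>A\<close>
  alone. Doing this for the length n and for the maximal length, the second factorization has at
  least two circuits more on the same set of at most 15 nonzero elements. As circuits have 3 to 5
  elements, the only numbers that fit are three 5-circuits against five 3-circuits, and two distinct
  5-circuits always have a product of length 3.\<close>

instance bit :: finite
proof
  have "(UNIV :: bit set) = {0, 1}" by (auto intro: bit.exhaust)
  then show "finite (UNIV :: bit set)" by (metis finite.emptyI finite.insertI)
qed

lemma card_c2_4: "card (UNIV :: c2_4 set) = 16"
proof -
  have "(UNIV :: bit set) = {0, 1}" by (auto intro: bit.exhaust)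
  then have "CARD(bit) = 2" by (metis card_2_iff zero_neq_one)
  then show ?thesis by (simp add: CARD_vec)
qed

lemma add_self [simp]: "(x::c2_4) + x = 0"
  by (simp add: vec_eq_iff)

lemma add_self_left [simp]: "(x::c2_4) + (x + y) = y"
  by (simp flip: add.assoc)

lemma eq_iff_add_zero: "(x::c2_4) = y \<longleftrightarrow> x + y = 0"
  by (metis add_self add.right_neutral add_self_left)

lemma add_eq_iff: "(x::c2_4) + y = z \<longleftrightarrow> x = y + z"
  by (metis add.commute add_self_left)

lemma sum_symdiff: "\<Sum>(A - B \<union> (B - A)) = \<Sum>A + (\<Sum>B :: c2_4)"
proof -
  have split: "\<Sum>A = \<Sum>(A - B) + \<Sum>(A \<inter> B)" for A B :: "c2_4 set"
    using sum.Int_Diff[of A "\<lambda>x. x" B] by (simp add: add.commute)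
  have "\<Sum>A = \<Sum>(A - B) + \<Sum>(A \<inter> B)" "\<Sum>B = \<Sum>(B - A) + \<Sum>(A \<inter> B)"
    using split[of A B] split[of B A] by (simp_all only: Int_commute)
  moreover have "\<Sum>(A - B \<union> (B - A)) = \<Sum>(A - B) + \<Sum>(B - A)"
    by (intro sum.union_disjoint) auto
  ultimately show ?thesis by (simp add: ac_simps)
qed

lemma sum_Diff_c2_4: "B \<subseteq> A \<Longrightarrow> \<Sum>(A - B) = \<Sum>A + (\<Sum>B :: c2_4)"
  using sum_symdiff[of A B] by (simp add: Diff_eq_empty_iff[THEN iffD2])

text \<open>Five elements have 32 subsets while the group has order 16, so two subsets have the same
  sum and their symmetric difference is zero-sum. Besides bounding atoms, this yields every
  representation of an element as a sum of elements of a circuit.\<close>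

lemma zero_sum_subset_exists:
  fixes C :: "c2_4 set"
  assumes "5 \<le> card C"
  shows "\<exists>Z\<subseteq>C. Z \<noteq> {} \<and> \<Sum>Z = 0"
proof -
  have "\<not> inj_on Sum (Pow C)"
  proof
    assume "inj_on Sum (Pow C)"
    then have "card (Pow C) \<le> card (UNIV :: c2_4 set)"
      by (intro card_inj_on_le) auto
    moreover have "(2::nat) ^ 5 \<le> 2 ^ card C" using assms by (intro power_increasing) auto
    moreover have "card (Pow C) = 2 ^ card C" by (simp add: card_Pow)
    ultimately show False unfolding card_c2_4 by simp
  qed
  then obtain A B where AB: "A \<subseteq> C" "B \<subseteq> C" "A \<noteq> B" "\<Sum>A = \<Sum>B"
    by (auto simp: inj_on_def)
  then show ?thesis
    by (intro exI[of _ "A - B \<union> (B - A)"]) (use sum_symdiff[of A B] in auto)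
qed

text \<open>A zero-sum set without \<open>0\<close> is identified with the squarefree sequence \<open>mset_set C\<close>.\<close>

definition zset :: "c2_4 set \<Rightarrow> bool" where
  "zset C \<longleftrightarrow> 0 \<notin> C \<and> \<Sum>C = 0"

lemma zset_symdiff: "zset A \<Longrightarrow> zset B \<Longrightarrow> zset (A - B \<union> (B - A))"
  by (auto simp: zset_def sum_symdiff)

lemma zset_Diff: "zset A \<Longrightarrow> zset B \<Longrightarrow> B \<subseteq> A \<Longrightarrow> zset (A - B)"
  by (auto simp: zset_def sum_Diff_c2_4)

lemma zset_card_ge: 
  assumes "zset C" "C \<noteq> {}" shows "3 \<le> card C"
proof -
  have "card C \<noteq> 0" using assms by simp
  moreover have "card C \<noteq> 1" using assms by (auto simp: zset_def card_1_singleton_iff)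
  moreover have "card C \<noteq> 2" using assms by (auto simp: zset_def card_2_iff eq_iff_add_zero[symmetric])
  ultimately show ?thesis by linarith
qed

text \<open>A proper nonempty zero-sum part and its complement would each have at least three
  elements, six together. Hence small zero-sum sets are automatically minimal.\<close>

lemma zset_subset_cases:
  assumes "zset C" "card C \<le> 5" "Z \<subseteq> C" "\<Sum>Z = 0"
  shows "Z = {} \<or> Z = C"
proof (rule ccontr)
  assume *: "\<not> ?thesis"
  have "zset Z" using assms by (auto simp: zset_def)
  then have "3 \<le> card Z" "3 \<le> card (C - Z)"
    using * assms zset_Diff by (auto intro!: zset_card_ge)
  then show False using assms card_Diff_subset[of Z C] card_mono[of C Z] by simp
qed

lemma zero_sum_atom_iff:
  "zero_sum_atom U \<longleftrightarrow> U \<noteq> {#} \<and> \<Sum>\<^sub># U = 0 \<and> (\<forall>V. V \<subseteq># U \<and> \<Sum>\<^sub># V = 0 \<longrightarrow> V = {#} \<or> V = U)"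
    (is "_ \<longleftrightarrow> ?R")
proof
  assume U: "zero_sum_atom U"
  have "V = {#} \<or> V = U" if "V \<subseteq># U" "\<Sum>\<^sub># V = 0" for V
  proof -
    define W where "W = U - V"
    then have W: "U = V + W" using that(1) by simp
    then have "\<Sum>\<^sub># W = 0" using U that by (auto simp: zero_sum_atom_def zero_sum_sequences_def)
    then show ?thesis using U W that
      by (auto simp: zero_sum_atom_def zero_sum_sequences_def)
  qed
  then show ?R using U by (auto simp: zero_sum_atom_def zero_sum_sequences_def)
next
  assume R: ?R
  have "S = {#} \<or> T = {#}" if "U = S + T" "\<Sum>\<^sub># S = 0" for S T
    using R that mset_subset_eq_add_left[of S T] by fastforce
  then show "zero_sum_atom U" using R
    by (auto simp: zero_sum_atom_def zero_sum_sequences_def)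
qed

lemma atom_zero: "zero_sum_atom {#0::c2_4#}"
proof -
  have "V = {#} \<or> V = {#0#}" if "V \<subseteq># {#0::c2_4#}" for V
    using that by (cases V) (auto simp: insert_subset_eq_iff)
  then show ?thesis by (auto simp: zero_sum_atom_iff)
qed

lemma atom_square: "g \<noteq> 0 \<Longrightarrow> zero_sum_atom {#g::c2_4, g#}"
proof -
  assume g: "g \<noteq> 0"
  have "V = {#} \<or> V = {#g,g#}" if "V \<subseteq># {#g, g#}" "\<Sum>\<^sub># V = 0" for V
  proof -
    have "set_mset V \<subseteq> {g}" using that(1) set_mset_mono by fastforce
    then have V: "V = replicate_mset (size V) g"
      by (rule set_mset_subset_singletonD)
    have "size V \<le> 2" using that(1) size_mset_mono by fastforce
    then consider "size V = 0" | "size V = 1" | "size V = 2" by linarith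
    then show ?thesis
    proof cases
      case 2
      then have "V = {#g#}" using V by simp
      then show ?thesis using that g by simp
    next
      case 3
      then show ?thesis using V by (simp add: numeral_2_eq_2)
    qed simp
  qed
  then show ?thesis by (auto simp: zero_sum_atom_iff)
qed

abbreviation "MS \<equiv> (mset_set :: c2_4 set \<Rightarrow> c2_4 multiset)"

lemma sum_mset_MS [simp]: "\<Sum>\<^sub># (MS C) = \<Sum>C"
  by (simp add: sum_unfold_sum_mset)

lemma mset_eq_MS:
  assumes "\<And>x. count V x \<le> 1" shows "V = MS (set_mset V)"
proof (rule multiset_eqI)
  fix x show "count V x = count (MS (set_mset V)) x"
    using assms[of x] by (cases "x \<in># V") (auto simp: not_in_iff intro: le_antisym)
qed

lemma atom_MS: 
  assumes "zset C" "C \<noteq> {}" "card C \<le> 5"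
  shows "zero_sum_atom (MS C)"
proof -
  have "V = {#} \<or> V = MS C" if "V \<subseteq># MS C" "\<Sum>\<^sub># V = 0" for V
  proof -
    have sub: "set_mset V \<subseteq> C" using set_mset_mono[OF that(1)] by simp
    have "count V x \<le> 1" for x using mset_subset_eq_count[OF that(1), of x]
      by (simp add: count_mset_set' split: if_splits)
    then have V: "V = MS (set_mset V)" by (rule mset_eq_MS)
    then have "\<Sum>(set_mset V) = 0" using that(2) by (metis sum_mset_MS)
    then show ?thesis using zset_subset_cases[OF assms(1,3) sub] V by auto
  qed
  then show ?thesis using assms by (auto simp: zero_sum_atom_iff zset_def mset_set_empty_iff)
qed

text \<open>A repeated element already splits off a square, and five elements of a larger set
  already contain a zero-sum subset.\<close>

lemma atom_cases [consumes 1, case_names zero square set]: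
  fixes U :: "c2_4 multiset"
  assumes "zero_sum_atom U"
  obtains "U = {#0#}" | g where "g \<noteq> 0" "U = {#g, g#}"
    | C where "zset C" "3 \<le> card C" "card C \<le> 5" "U = MS C"
proof -
  note U = assms[unfolded zero_sum_atom_iff]
  show thesis
  proof (cases "0 \<in># U")
    case True
    then have "{#0#} \<subseteq># U" by simp
    then have "{#0#} = U" using U by (metis sum_mset.singleton add_mset_not_empty)
    then show ?thesis using that by blast
  next
    case no0: False
    show ?thesis
    proof (cases "\<exists>g. count U g \<ge> 2")
      case True
      then obtain g where g: "count U g \<ge> 2" by blast
      then have "{#g, g#} \<subseteq># U" by (auto simp: subseteq_mset_def)
      then have "{#g, g#} = U" using U[THEN conjunct2, THEN conjunct2, rule_format, of "{#g, g#}"] by simp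
      moreover have "g \<noteq> 0" using no0 g by (auto simp: not_in_iff)
      ultimately show ?thesis using that by blast
    next
      case False
      have le: "count U g \<le> 1" for g
      proof -
        have "\<not> 2 \<le> count U g" using False by blast
        then show ?thesis by linarith
      qed
      define C where "C = set_mset U"
      have UC: "U = MS C" unfolding C_def using le by (rule mset_eq_MS)
      have "\<Sum>C = 0" using U UC by (metis sum_mset_MS)
      then have C: "zset C" "C \<noteq> {}" using U no0 by (auto simp: zset_def C_def)
      have "card C \<le> 5"
      proof (rule ccontr)
        assume "\<not> card C \<le> 5"
        then obtain D where D: "D \<subseteq> C" "card D = 5" by (meson nat_le_linear obtain_subset_with_card_n)
        then obtain Z where Z: "Z \<subseteq> D" "Z \<noteq> {}" "\<Sum>Z = 0" using zero_sum_subset_exists[of D] by auto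
        then have "MS Z \<subseteq># U" unfolding UC using D by (intro subset_imp_msubset_mset_set) auto
        then have "MS Z = {#} \<or> MS Z = U" using U Z(3) by simp
        then have "Z = C" using Z(2) by (simp add: UC mset_set_empty_iff)
        then show False using Z D \<open>\<not> card C \<le> 5\<close> card_mono[of D Z] by simp
      qed
      then show ?thesis using that C zset_card_ge UC by blast
    qed
  qed
qed


section \<open>Factorizations and lengths\<close>

definition factorizes :: "c2_4 multiset \<Rightarrow> c2_4 multiset multiset \<Rightarrow> bool" where
  "factorizes A F \<longleftrightarrow> (\<forall>U\<in>#F. zero_sum_atom U) \<and> \<Sum>\<^sub># F = A"

definition lens :: "c2_4 multiset \<Rightarrow> nat set" where
  "lens A = {size F | F. factorizes A F}"

lemma factorizes_add: "factorizes A F \<Longrightarrow> factorizes B G \<Longrightarrow> factorizes (A + B) (F + G)"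
  by (auto simp: factorizes_def)

lemma factorizes_single: "zero_sum_atom U \<Longrightarrow> factorizes U {#U#}"
  by (auto simp: factorizes_def)

lemma factorizes_empty_iff [simp]: "factorizes A {#} \<longleftrightarrow> A = {#}"
  by (auto simp: factorizes_def)

lemma lensI: "factorizes A F \<Longrightarrow> size F = n \<Longrightarrow> n \<in> lens A"
  by (auto simp: lens_def)

lemma lens_plus: "k \<in> lens A \<Longrightarrow> l \<in> lens B \<Longrightarrow> k + l \<in> lens (A + B)"
  unfolding lens_def by (smt (verit) factorizes_add mem_Collect_eq size_union)

lemma lens_atom: "zero_sum_atom U \<Longrightarrow> 1 \<in> lens U"
  using factorizes_single lensI by fastforce

text \<open>The case distinction in \<open>set_of_lengths\<close> dissolves because the empty
  sequence has the empty factorization only, and no other sequence has it.\<close>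

lemma set_of_lengths_eq_lens: "set_of_lengths A = lens A"
proof (cases "A = {#}")
  case True
  have "F = {#}" if "factorizes {#} F" for F
  proof (rule ccontr)
    assume "F \<noteq> {#}"
    then obtain U where "U \<in># F" by blast
    then show False using that
      by (auto simp: factorizes_def zero_sum_atom_def)
  qed
  then show ?thesis using True by (auto simp: set_of_lengths_def lens_def)
next
  case False
  then show ?thesis by (auto simp: set_of_lengths_def lens_def factorizes_def Suc_le_eq nonempty_has_size[symmetric])
qed

lemma ex_factorizes: "\<Sum>\<^sub># A = (0::c2_4) \<Longrightarrow> \<exists>F. factorizes A F"
proof (induction "size A" arbitrary: A rule: less_induct)
  case less
  show ?case
  proof (cases "A = {#} \<or> zero_sum_atom A")
    case True
    then show ?thesis using factorizes_single factorizes_empty_iff by blast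
  next
    case False
    then obtain S T where "S \<noteq> {#}" "T \<noteq> {#}" "A = S + T" "\<Sum>\<^sub># S = 0" "\<Sum>\<^sub># T = 0"
      using less.prems by (auto simp: zero_sum_atom_def zero_sum_sequences_def)
    moreover from this have "size S < size A" "size T < size A"
      by (auto simp: nonempty_has_size)
    ultimately show ?thesis using less.hyps factorizes_add by metis
  qed
qed

lemma atom_size:
  assumes "zero_sum_atom U" "0 \<notin># (U :: c2_4 multiset)"
  shows "2 \<le> size U" "size U \<le> 5"
  using assms by (cases U rule: atom_cases; auto)+

lemma factorizes_size:
  assumes "factorizes A F" "0 \<notin># A"
  shows "2 * size F \<le> size A" "size A \<le> 5 * size F"
proof -
  have "\<forall>U\<in>#F. zero_sum_atom U \<and> 0 \<notin># U" using assms
    by (auto simp: factorizes_def)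
  then have "2 * size F \<le> size (\<Sum>\<^sub># F) \<and> size (\<Sum>\<^sub># F) \<le> 5 * size F"
  proof (induction F)
    case (add U F)
    then show ?case using atom_size[of U] by auto
  qed simp
  then show "2 * size F \<le> size A" "size A \<le> 5 * size F"
    using assms by (auto simp: factorizes_def)
qed

lemma factorizes_zero:
  assumes "factorizes A F" "0 \<in># A"
  shows "{#0#} \<in># F"
proof -
  obtain U where U: "U \<in># F" "0 \<in># U" using assms by (auto simp: factorizes_def)
  then have "zero_sum_atom U" using assms by (auto simp: factorizes_def)
  then have "U = {#0#}" using U(2) by (cases U rule: atom_cases) (auto simp: zset_def)
  then show ?thesis using U by simp
qed

text \<open>The only atom containing 0 is the single term 0, so it occurs in every factorization.
  Zeros therefore merely translate sets of lengths: they can be removed at the start, and they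
  realize translates at the end.\<close>

lemma lens_add_zero: "lens (add_mset 0 A) = Suc ` lens A"
proof
  show "lens (add_mset 0 A) \<subseteq> Suc ` lens A"
  proof
    fix n assume "n \<in> lens (add_mset 0 A)"
    then obtain F where F: "factorizes (add_mset 0 A) F" "n = size F" by (auto simp: lens_def)
    then obtain G where G: "F = add_mset {#0#} G" using factorizes_zero[OF F(1)] by (metis mset_add union_single_eq_member)
    then have "factorizes A G" using F by (auto simp: factorizes_def)
    then show "n \<in> Suc ` lens A" using F G by (auto simp: lens_def)
  qed
  show "Suc ` lens A \<subseteq> lens (add_mset 0 A)"
    using lens_plus[OF lens_atom[OF atom_zero]] by fastforce
qed

lemma lens_replicate_zero: "lens (replicate_mset y 0 + A) = (+) y ` lens A"
  by (induction y) (auto simp: lens_add_zero image_image)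

lemma zset_notin [simp]: "zset C \<Longrightarrow> 0 \<notin> C" by (simp add: zset_def)

text \<open>Five of the elements contain a zero-sum subset of three to five elements. Its complement
  is zero-sum and nonempty, with at most 8 - 3 = 5 elements, so both parts are circuits.\<close>

lemma lens_MS_pair:
  assumes "zset C" "6 \<le> card C" "card C \<le> 8"
  shows "2 \<in> lens (MS C)"
proof -
  obtain D where "D \<subseteq> C" "card D = 5" using assms obtain_subset_with_card_n[of 5 C] by auto
  then obtain Z where "Z \<subseteq> D" "Z \<noteq> {}" "\<Sum>Z = 0" using zero_sum_subset_exists[of D] by auto
  then have Z: "Z \<subseteq> C" "Z \<noteq> {}" "\<Sum>Z = 0" "card Z \<le> 5"
    using \<open>D \<subseteq> C\<close> \<open>card D = 5\<close> card_mono[of D Z] by auto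
  then have zZ: "zset Z" "zset (C - Z)" using assms zset_Diff by (auto simp: zset_def sum_Diff_c2_4)
  have ne: "C - Z \<noteq> {}" using Z assms by auto
  have "card (C - Z) \<le> 5"
    using zset_card_ge[OF zZ(1) Z(2)] assms Z by (simp add: card_Diff_subset)
  then have "1 + 1 \<in> lens (MS Z + MS (C - Z))"
    using zZ Z ne by (intro lens_plus lens_atom atom_MS)
  also have "MS Z + MS (C - Z) = MS C"
    using Z by (subst mset_set_Union[symmetric]) (auto intro!: arg_cong[of _ _ MS])
  finally show ?thesis by (simp add: numeral_2_eq_2)
qed

lemma lens_squares: "0 \<notin> D \<Longrightarrow> card D \<in> lens (MS D + MS D)"
proof (induction D rule: infinite_finite_induct)
  case (insert x D)
  have "1 + card D \<in> lens ({#x, x#} + (MS D + MS D))"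
    using insert by (intro lens_plus lens_atom atom_square) auto
  then show ?case using insert by (simp add: ac_simps)
qed (auto simp: lens_def intro: exI[of _ "{#}"])

text \<open>Attached to the factorization rather than to its length, the property passes to
  subproducts (\<open>bad_sub\<close>) and survives swaps (\<open>bad_replace\<close>).\<close>

definition bad :: "c2_4 multiset \<Rightarrow> c2_4 multiset multiset \<Rightarrow> bool" where
  "bad A F \<longleftrightarrow> factorizes A F \<and> Suc (size F) \<notin> lens A"

lemma bad_sub:
  assumes "bad A (K + R)" shows "Suc (size K) \<notin> lens (\<Sum>\<^sub># K)"
proof
  assume "Suc (size K) \<in> lens (\<Sum>\<^sub># K)"
  moreover have "size R \<in> lens (\<Sum>\<^sub># R)" using assms
    by (auto simp: lens_def bad_def factorizes_def)
  ultimately have "Suc (size K) + size R \<in> lens (\<Sum>\<^sub># K + \<Sum>\<^sub># R)" by (rule lens_plus)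
  then show False using assms by (auto simp: bad_def factorizes_def)
qed

lemma bad_replace:
  assumes "bad A (K + R)" "factorizes (\<Sum>\<^sub># K) K'" "size K' = size K"
  shows "bad A (K' + R)"
  using assms by (auto simp: bad_def factorizes_def)


section \<open>Products of two circuits\<close>

lemma card_symdiff: "card (A - B \<union> (B - A)) + 2 * card (A \<inter> B) = card A + card (B :: c2_4 set)"
proof -
  have "card A = card (A - B) + card (A \<inter> B)" "card B = card (B - A) + card (A \<inter> B)"
    by (simp_all add: card_Diff_subset_Int Int_commute card_mono)
  moreover have "card (A - B \<union> (B - A)) = card (A - B) + card (B - A)"
    by (intro card_Un_disjoint) auto
  ultimately show ?thesis by simp
qed

lemma MS_add: "MS A + MS B = MS (A \<inter> B) + MS (A \<inter> B) + MS (A - B \<union> (B - A))"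
  by (rule multiset_eqI) (auto simp: count_mset_set')

lemma lens_MS_add:
  assumes "0 \<notin> A" "0 \<notin> B" "\<Sum>A = \<Sum>B" "A \<noteq> B"
  shows "card A + card B \<le> 5 + 2 * card (A \<inter> B) \<Longrightarrow> n = card (A \<inter> B) + 1 \<Longrightarrow> n \<in> lens (MS A + MS B)"
    and "6 + 2 * card (A \<inter> B) \<le> card A + card B \<Longrightarrow> card A + card B \<le> 8 + 2 * card (A \<inter> B)
      \<Longrightarrow> n = card (A \<inter> B) + 2 \<Longrightarrow> n \<in> lens (MS A + MS B)"
proof -
  let ?S = "A - B \<union> (B - A)"
  have S: "zset ?S" "?S \<noteq> {}" using assms by (auto simp: zset_def sum_symdiff)
  have sq: "card (A \<inter> B) \<in> lens (MS (A \<inter> B) + MS (A \<inter> B))"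
    using assms by (intro lens_squares) auto
  note c = card_symdiff[of A B]
  show "n \<in> lens (MS A + MS B)" if "card A + card B \<le> 5 + 2 * card (A \<inter> B)" "n = card (A \<inter> B) + 1"
    unfolding MS_add[of A B] that(2) using that(1) c S by (intro lens_plus[OF sq] lens_atom atom_MS) auto
  show "n \<in> lens (MS A + MS B)"
    if "6 + 2 * card (A \<inter> B) \<le> card A + card B" "card A + card B \<le> 8 + 2 * card (A \<inter> B)"
      "n = card (A \<inter> B) + 2"
    unfolding MS_add[of A B] that(3) using that(1,2) c S by (intro lens_plus[OF sq] lens_MS_pair) auto
qed

lemma MS_exchange:
  assumes "I \<subseteq> A" "J \<subseteq> B" "I \<inter> J = {}"
  shows "MS A + MS B = MS (I \<union> J) + (MS (A - I) + MS (B - J))"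
  using assms by (intro multiset_eqI) (auto simp: count_mset_set')

text \<open>Parts of equal sum taken from both circuits form a circuit of their own; the remainders
  keep equal sums and are factored separately.\<close>

lemma lens_exchange:
  assumes "I \<subseteq> A" "J \<subseteq> B" "I \<inter> J = {}" "\<Sum>I = \<Sum>J" "zset A" "zset B" "I \<union> J \<noteq> {}"
    and "card I + card J \<le> 5" "k \<in> lens (MS (A - I) + MS (B - J))"
  shows "Suc k \<in> lens (MS A + MS B)"
proof -
  have "zset (I \<union> J)" using assms by (auto simp: zset_def sum.union_disjoint)
  moreover have "card (I \<union> J) \<le> 5" using assms by (simp add: card_Un_disjoint)
  ultimately have "1 + k \<in> lens (MS (I \<union> J) + (MS (A - I) + MS (B - J)))"
    using assms by (intro lens_plus lens_atom atom_MS)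
  then show ?thesis using MS_exchange[of I A J B] assms by simp
qed

text \<open>Four elements of \<open>U\<close> form a basis, so \<open>g\<close> is the sum of some
  subset of \<open>U\<close>. A subset and its complement in \<open>U\<close> have the same sum,
  which turns a triple into a pair. In total the 15 nonzero elements are the 5 elements of
  \<open>U\<close> and its 10 sums of pairs.\<close>

lemma rep_pair:
  assumes "zset U" "card U = 5" "g \<notin> U" "g \<noteq> 0"
  obtains i j where "i \<in> U" "j \<in> U" "i \<noteq> j" "g = i + j"
proof -
  obtain m where m: "m \<in> U" using assms by fastforce
  have "card (insert g (U - {m})) = 5" using assms m by simp
  then obtain Z where Z: "Z \<subseteq> insert g (U - {m})" "Z \<noteq> {}" "\<Sum>Z = 0"
    using zero_sum_subset_exists[of "insert g (U - {m})"] by auto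
  have gZ: "g \<in> Z"
  proof (rule ccontr)
    assume "g \<notin> Z"
    then have "Z \<subseteq> U" "m \<notin> Z" using Z by auto
    then show False using zset_subset_cases[of U Z] assms Z m by auto
  qed
  define Y where "Y = Z - {g}"
  have Y: "Y \<subseteq> U - {m}" "\<Sum>Y = g" using Z gZ by (auto simp: Y_def sum_Diff_c2_4)
  have "card Y \<le> 4" using card_mono[OF _ Y(1)] assms m by simp
  then consider "card Y = 0" | "card Y = 1" | "card Y = 2" | "card Y = 3" | "card Y = 4" by linarith
  then show thesis
  proof cases
    case 1 then show thesis using Y assms by simp
  next
    case 2 then show thesis using Y assms by (auto simp: card_1_singleton_iff)
  next
    case 3 then obtain i j where "Y = {i, j}" "i \<noteq> j" by (auto simp: card_2_iff)
    then show thesis using Y by (intro that[of i j]) auto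
  next
    case 4
    have "card (U - Y) = 2" using 4 Y assms by (subst card_Diff_subset) auto
    then obtain i j where ij: "U - Y = {i, j}" "i \<noteq> j" by (auto simp: card_2_iff)
    have "\<Sum>(U - Y) = g" using Y assms by (subst sum_Diff_c2_4) (auto simp: zset_def)
    then show thesis using ij by (intro that[of i j]) auto
  next
    case 5
    then have "Y = U - {m}" using assms m Y by (intro card_subset_eq) auto
    then show thesis using Y assms m by (auto simp: zset_def sum_Diff_c2_4)
  qed
qed

lemma zset_no_triple:
  assumes "zset V" "4 \<le> card V" "card V \<le> 5" "i \<in> V" "j \<in> V" "i \<noteq> j"
  shows "i + j \<notin> V"
proof
  assume ij: "i + j \<in> V"
  have "i \<noteq> 0" "j \<noteq> 0" using assms by auto
  then have "\<Sum>{i + j, i, j} = 0" using assms by (simp add: ac_simps)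
  then have "{i + j, i, j} = V" using zset_subset_cases[of V "{i + j, i, j}"] assms ij by auto
  moreover have "card {i + j, i, j} \<le> 3" by (simp add: card_insert_if)
  ultimately show False using assms by simp
qed

lemma rep_pair_set:
  assumes "zset U" "card U = 5" "g \<notin> U" "g \<noteq> 0"
  obtains P where "P \<subseteq> U" "card P = 2" "card (U - P) = 3" "\<Sum>P = g" "\<Sum>(U - P) = g"
proof -
  obtain i j where "i \<in> U" "j \<in> U" "i \<noteq> j" "g = i + j"
    using rep_pair[OF assms] by blast
  then show thesis using assms
    by (intro that[of "{i, j}"]) (simp_all add: sum_Diff_c2_4 zset_def)
qed

lemma lens_exchange_point:
  assumes "zset A" "zset B" "d \<in> B" "d \<notin> A" "P \<subseteq> A" "\<Sum>P = d" "card P \<le> 4"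
    and "k \<in> lens (MS (A - P) + MS (B - {d}))" "n = Suc k"
  shows "n \<in> lens (MS A + MS B)"
  using lens_exchange[of P A "{d}" B k] assms by auto

text \<open>An element \<open>d\<close> of \<open>V\<close> outside \<open>U\<close> is the sum of a
  pair \<open>P\<close> of \<open>U\<close> and also of the complementary triple. Splitting off
  \<open>P\<close> or \<open>U - P\<close> together with \<open>d\<close> leaves two sets of sum
  \<open>d\<close>; it remains to choose so that these have a product of length 2.\<close>

lemma pair_55:
  assumes U: "zset U" "card U = 5" and V: "zset V" "card V = 5" and "U \<noteq> V"
  shows "3 \<in> lens (MS U + MS V)"
proof -
  have eq: "\<Sum>U = \<Sum>V" "0 \<notin> U" "0 \<notin> V" using U V by (simp_all add: zset_def)
  have c5: "card (U \<inter> V) \<noteq> 5" using U V \<open>U \<noteq> V\<close>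
    by (metis card_subset_eq finite inf_le1 inf_le2)
  have c4: "card (U \<inter> V) \<noteq> 4"
    using zset_card_ge[OF zset_symdiff[OF U(1) V(1)]] card_symdiff[of U V] U V \<open>U \<noteq> V\<close> by auto
  have cle: "card (U \<inter> V) \<le> 5" using U by (metis card_mono finite inf_le1)
  have "\<not> V \<subseteq> U" using U V \<open>U \<noteq> V\<close> by (metis card_subset_eq finite)
  then obtain d where d: "d \<in> V" "d \<notin> U" by blast
  have "d \<noteq> 0" using d V by auto
  then obtain P where P: "P \<subseteq> U" "card P = 2" "card (U - P) = 3" "\<Sum>P = d" "\<Sum>(U - P) = d"
    using rep_pair_set[of U d] U d by blast
  have W: "card (V - {d}) = 4" "\<Sum>(V - {d}) = d" using d V by (simp_all add: sum_Diff_c2_4 zset_def)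
  have ne: "P \<noteq> V - {d}" "U - P \<noteq> V - {d}" using P W
    by (metis numeral_eq_iff semiring_norm(85,86,87,88,89))+
  have "d \<notin> P" using d P by auto
  have triple: False if "insert d Q \<subseteq> V" "\<Sum>Q = d" "card Q \<le> 3" "d \<notin> Q" for Q
  proof -
    have "insert d Q = V" using zset_subset_cases[of V "insert d Q"] V that by auto
    moreover have "card (insert d Q) \<le> 4" using that by simp
    ultimately show False using V by simp
  qed
  have 0: "0 \<notin> P" "0 \<notin> U - P" "0 \<notin> V - {d}" using P eq by auto
  have "card (P \<inter> V) \<noteq> 2"
  proof
    assume "card (P \<inter> V) = 2"
    then have "P \<inter> V = P" using P by (intro card_subset_eq) auto
    then show False using triple[of P] P d \<open>d \<notin> P\<close> by auto
  qed
  moreover have "card (P \<inter> V) \<le> 2" using P by (metis card_mono finite inf_le1)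
  ultimately consider (none) "card (P \<inter> V) = 0" | (one) "card (P \<inter> V) = 1" by linarith
  then have "2 \<in> lens (MS (U - P) + MS (V - {d})) \<or> 2 \<in> lens (MS P + MS (V - {d})) \<or> 3 \<in> lens (MS U + MS V)"
  proof cases
    case none
    \<comment> \<open>The two sets are disjoint with 2 + 4 elements, and their union splits into two
      circuits.\<close>
    then have "P \<inter> (V - {d}) = {}" by auto
    then have "2 \<in> lens (MS P + MS (V - {d}))"
      by (intro lens_MS_add(2)) (use eq in \<open>simp_all add: 0 P(2,4) W ne\<close>)
    then show ?thesis by simp
  next
    case one
    have int: "P \<inter> (V - {d}) = P \<inter> V" using \<open>d \<notin> P\<close> by auto
    have int2: "(U - P) \<inter> (V - {d}) = U \<inter> V - P \<inter> V" using d by auto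
    have cI: "card (U \<inter> V - P \<inter> V) = card (U \<inter> V) - 1"
      using one P by (subst card_Diff_subset) auto
    consider "card (U \<inter> V) = 1" | "card (U \<inter> V) = 2" | "card (U \<inter> V) = 3"
    proof -
      have "card (P \<inter> V) \<le> card (U \<inter> V)" using P by (intro card_mono) auto
      then show thesis using that one c5 c4 cle by linarith
    qed
    then show ?thesis
    proof cases
      case 1
      \<comment> \<open>No exchange here: one square, and eight further elements that split into two
        circuits.\<close>
      then have "3 \<in> lens (MS U + MS V)"
        by (intro lens_MS_add(2)) (simp_all add: U V eq \<open>U \<noteq> V\<close>)
      then show ?thesis by simp
    next
      case 2
      then have "2 \<in> lens (MS (U - P) + MS (V - {d}))" using cI
        by (intro lens_MS_add(1)) (use eq in \<open>simp_all add: 0 P(3,5) W ne int2\<close>)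
      then show ?thesis by simp
    next
      case 3
      \<comment> \<open>One common element and a symmetric difference of four: a square and a
        circuit.\<close>
      have "2 \<in> lens (MS P + MS (V - {d}))"
        by (intro lens_MS_add(1)) (use eq in \<open>simp_all add: 0 P(2,4) W ne int one\<close>)
      then show ?thesis by simp
    qed
  qed
  then show ?thesis
  proof (elim disjE)
    assume "2 \<in> lens (MS (U - P) + MS (V - {d}))"
    then show ?thesis using P d U V by (intro lens_exchange_point[of U V d P 2]) auto
  next
    assume "2 \<in> lens (MS P + MS (V - {d}))"
    moreover have "U - (U - P) = P" using P by auto
    ultimately show ?thesis using P d U V by (intro lens_exchange_point[of U V d "U - P" 2]) auto
  qed
qed

text \<open>One or two common elements leave a symmetric difference of seven or five, which
  suffices. Disjoint circuits need an exchange of one element of \<open>X\<close> against a pair of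
  \<open>U\<close>. Three common elements give three squares and a 3-circuit: the lengths are then 2
  and 4 only.\<close>

lemma pair_45:
  assumes X: "zset X" "card X = 4" and U: "zset U" "card U = 5" and "card (X \<inter> U) \<noteq> 3"
  shows "3 \<in> lens (MS X + MS U)"
proof -
  have eq: "\<Sum>X = \<Sum>U" "X \<noteq> U" "0 \<notin> X" "0 \<notin> U" using U X by (auto simp: zset_def)
  have "card (X \<inter> U) \<noteq> 4"
  proof
    assume "card (X \<inter> U) = 4"
    then have "X \<subseteq> U" using X by (metis card_subset_eq finite inf_le1 inf.order_iff)
    then show False using zset_subset_cases[of U X] U X by (auto simp: zset_def)
  qed
  moreover have "card (X \<inter> U) \<le> 4" using X by (metis card_mono finite inf_le1)
  ultimately consider "card (X \<inter> U) = 0" | "card (X \<inter> U) = 1" | "card (X \<inter> U) = 2"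
    using assms(5) by linarith
  then show ?thesis
  proof cases
    case 1
    then have disj: "U \<inter> X = {}" by auto
    obtain d where d: "d \<in> X" using X by fastforce
    then have "d \<notin> U" "d \<noteq> 0" using disj eq by auto
    then obtain P where P: "P \<subseteq> U" "card P = 2" "card (U - P) = 3" "\<Sum>P = d" "\<Sum>(U - P) = d"
      using rep_pair_set[of U d] U d by blast
    have W: "card (X - {d}) = 3" "\<Sum>(X - {d}) = d" using d X by (simp_all add: sum_Diff_c2_4 zset_def)
    have int: "(U - P) \<inter> (X - {d}) = {}" using disj by auto
    have ne: "U - P \<noteq> X - {d}"
    proof
      assume "U - P = X - {d}"
      then show False using int W(1) by (metis Int_absorb card.empty zero_neq_numeral)
    qed
    have "2 \<in> lens (MS (U - P) + MS (X - {d}))"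
      by (intro lens_MS_add(2)) (use eq in \<open>simp_all add: P(3,5) W ne int\<close>)
    then show ?thesis using P d U X \<open>d \<notin> U\<close>
      by (subst add.commute) (intro lens_exchange_point[of U X d P 2]; simp)
  next
    case 2 then show ?thesis by (intro lens_MS_add(2)) (simp_all add: eq X U)
  next
    case 3 then show ?thesis by (intro lens_MS_add(1)) (simp_all add: eq X U)
  qed
qed

text \<open>One common element leaves six others, two leave four, and three are impossible because
  two elements cannot be zero-sum. Disjoint 4-circuits really fail: no square divides their product,
  so three factors would need nine elements.\<close>

lemma pair_44:
  assumes X: "zset X" "card X = 4" and Y: "zset Y" "card Y = 4" and "X \<noteq> Y" "X \<inter> Y \<noteq> {}"
  shows "3 \<in> lens (MS X + MS Y)"
proof -
  have eq: "\<Sum>X = \<Sum>Y" "0 \<notin> X" "0 \<notin> Y" using X Y by (auto simp: zset_def)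
  have "card (X \<inter> Y) \<noteq> 4" using X Y \<open>X \<noteq> Y\<close> by (metis card_subset_eq finite inf_le1 inf_le2)
  moreover have "card (X \<inter> Y) \<noteq> 3"
    using zset_card_ge[OF zset_symdiff[OF X(1) Y(1)]] card_symdiff[of X Y] X Y \<open>X \<noteq> Y\<close> by auto
  moreover have "card (X \<inter> Y) \<le> 4" using X by (metis card_mono finite inf_le1)
  moreover have "card (X \<inter> Y) \<noteq> 0" using assms by simp
  ultimately consider "card (X \<inter> Y) = 1" | "card (X \<inter> Y) = 2" by linarith
  then show ?thesis
  proof cases
    case 1 then show ?thesis by (intro lens_MS_add(2)) (simp_all add: eq X Y \<open>X \<noteq> Y\<close>)
  next
    case 2 then show ?thesis by (intro lens_MS_add(1)) (simp_all add: eq X Y \<open>X \<noteq> Y\<close>)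
  qed
qed

lemma pair_35:
  assumes X: "zset X" "card X = 3" and U: "zset U" "card U = 5" and "X \<inter> U \<noteq> {}"
  shows "3 \<in> lens (MS X + MS U)"
proof -
  have eq: "\<Sum>X = \<Sum>U" "X \<noteq> U" "0 \<notin> X" "0 \<notin> U" using X U by (auto simp: zset_def)
  have "card (X \<inter> U) \<noteq> 3"
  proof
    assume "card (X \<inter> U) = 3"
    then have "X \<subseteq> U" using X by (metis card_subset_eq finite inf_le1 inf.order_iff)
    then show False using zset_subset_cases[of U X] U X by (auto simp: zset_def)
  qed
  moreover have "card (X \<inter> U) \<le> 3" using X by (metis card_mono finite inf_le1)
  moreover have "card (X \<inter> U) \<noteq> 0" using assms by simp
  ultimately consider "card (X \<inter> U) = 1" | "card (X \<inter> U) = 2" by linarith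
  then show ?thesis
  proof cases
    case 1 then show ?thesis by (intro lens_MS_add(2)) (simp_all add: eq X U)
  next
    case 2 then show ?thesis by (intro lens_MS_add(1)) (simp_all add: eq X U)
  qed
qed

text \<open>Two squares and a 3-circuit. With a single common element one gets a square and a
  5-circuit instead, which is again of length 2; see \<open>quad_line_swap\<close>.\<close>

lemma pair_34:
  assumes X: "zset X" "card X = 3" and U: "zset U" "card U = 4" and "card (X \<inter> U) = 2"
  shows "3 \<in> lens (MS X + MS U)"
proof (rule lens_MS_add(1))
  show "X \<noteq> U"
  proof
    assume "X = U"
    then have "card X = card U" by (rule arg_cong)
    then show False unfolding X U by simp
  qed
  show "0 \<notin> X" "0 \<notin> U" "\<Sum>X = \<Sum>U" using X(1) U(1) by (simp_all add: zset_def)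
  show "card X + card U \<le> 5 + 2 * card (X \<inter> U)" "3 = card (X \<inter> U) + 1"
    unfolding X U assms(5) by simp_all
qed


section \<open>Gaps in sets of lengths\<close>

lemma card_Int_split: "P \<subseteq> U \<Longrightarrow> card (P \<inter> X) + card ((U - P) \<inter> X) = card (X \<inter> (U :: c2_4 set))"
  by (subst card_Un_disjoint[symmetric]) (auto intro!: arg_cong[of _ _ card])

lemma bad_atom: "bad A F \<Longrightarrow> Y \<in># F \<Longrightarrow> zero_sum_atom Y"
  by (auto simp: bad_def factorizes_def)

lemma bad_pairD: "bad A F \<Longrightarrow> F = {#Y, Z#} + R \<Longrightarrow> 3 \<in> lens (Y + Z) \<Longrightarrow> False"
  using bad_sub[of A "{#Y, Z#}" R] by (simp add: numeral_3_eq_3)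

lemma bad_swap:
  assumes "bad A F" "F = {#Y, Z#} + R" "Y + Z = Y' + Z'" "zero_sum_atom Y'" "zero_sum_atom Z'"
  shows "bad A ({#Y', Z'#} + R)"
proof -
  have "factorizes (\<Sum>\<^sub># {#Y, Z#}) {#Y', Z'#}" using assms by (simp add: factorizes_def)
  then show ?thesis using bad_replace[of A "{#Y, Z#}" R "{#Y', Z'#}"] assms by simp
qed

text \<open>Both \<open>P\<close> and its complement in \<open>C\<close> have sum \<open>g\<close>,
  and each takes one copy of \<open>g\<close>. The length stays the same, so a square outside a
  configuration can be turned into circuits that interact with it.\<close>

lemma square_split:
  assumes "zset C" "P \<subseteq> C" "\<Sum>P = g" "g \<notin> C" "g \<noteq> 0"
  shows "MS C + {#g, g#} = MS (insert g P) + MS (insert g (C - P))"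
    and "zset (insert g P)" "zset (insert g (C - P))"
    and "card (insert g P) = Suc (card P)" "card (insert g (C - P)) = Suc (card (C - P))"
proof -
  have g: "g \<notin> P" "g \<notin> C - P" using assms by auto
  have "MS C = MS P + MS (C - P)" using assms
    by (subst mset_set_Union[symmetric]) (auto intro!: arg_cong[of _ _ MS])
  then show "MS C + {#g, g#} = MS (insert g P) + MS (insert g (C - P))"
    using g by simp
  have s: "\<Sum>(C - P) = g" using assms by (simp add: sum_Diff_c2_4 zset_def)
  show "card (insert g P) = Suc (card P)" "card (insert g (C - P)) = Suc (card (C - P))"
    using g by simp_all
  have "0 \<notin> C" using assms by simp
  then show "zset (insert g P)" "zset (insert g (C - P))"
    using g s assms(2,3,5) unfolding zset_def by (auto simp: subset_iff)
qed

text \<open>The length-preserving form of the exchange: for disjoint circuits the remainders are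
  disjoint and make up a single zero-sum set.\<close>

lemma exchange_split:
  assumes "zset A" "zset B" "I \<subseteq> A" "J \<subseteq> B" "\<Sum>I = \<Sum>J" "A \<inter> B = {}"
  shows "MS A + MS B = MS (I \<union> J) + MS ((A - I) \<union> (B - J))"
    and "zset (I \<union> J)" "zset ((A - I) \<union> (B - J))"
    and "card (I \<union> J) = card I + card J"
    and "card ((A - I) \<union> (B - J)) = (card A - card I) + (card B - card J)"
proof -
  have d: "I \<inter> J = {}" "(A - I) \<inter> (B - J) = {}" using assms by auto
  show "MS A + MS B = MS (I \<union> J) + MS ((A - I) \<union> (B - J))"
    using MS_exchange[OF assms(3,4) d(1)] d by (simp add: mset_set_Union)
  show "card (I \<union> J) = card I + card J" using d by (simp add: card_Un_disjoint)
  show "card ((A - I) \<union> (B - J)) = (card A - card I) + (card B - card J)"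
    using d assms by (simp add: card_Un_disjoint card_Diff_subset)
  show "zset (I \<union> J)" "zset ((A - I) \<union> (B - J))"
    using assms d by (auto simp: zset_def sum.union_disjoint sum_Diff_c2_4)
qed

text \<open>The symmetric difference of \<open>X\<close> and \<open>U\<close> is a third circuit, of cardinality 3: the three form a
  theta graph.\<close>

definition theta :: "c2_4 set \<Rightarrow> c2_4 set \<Rightarrow> bool" where
  "theta X U \<longleftrightarrow> zset X \<and> card X = 4 \<and> zset U \<and> card U = 5 \<and> card (X \<inter> U) = 3"

text \<open>Here \<open>P\<close> is all of \<open>U - X\<close>, so \<open>U - P\<close> is the
  common part of both circuits. Subtracting that part from \<open>U\<close> and from
  \<open>X\<close> shows that \<open>P\<close> has the same sum as the single element of
  \<open>X - U\<close>.\<close>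

lemma theta_private:
  assumes "theta X U" "P \<subseteq> U" "card P = 2" "P \<inter> X = {}"
  shows "\<Sum>P \<in> X"
proof -
  note t = assms(1)[unfolded theta_def]
  have "card ((U - P) \<inter> X) = 3" using card_Int_split[OF assms(2), of X] t assms by simp
  moreover have "card (U - P) = 3" using assms t by (simp add: card_Diff_subset)
  ultimately have "(U - P) \<inter> X = U - P" by (intro card_subset_eq) auto
  then have sub: "U - P \<subseteq> X" by auto
  have "card (X - (U - P)) = 1" using t sub \<open>card (U - P) = 3\<close> by (simp add: card_Diff_subset)
  then obtain s where s: "X - (U - P) = {s}" by (auto simp: card_1_singleton_iff)
  have "\<Sum>P = \<Sum>(U - P)" using t assms by (simp add: sum_Diff_c2_4 zset_def)
  also have "\<dots> = \<Sum>(X - (U - P))" using t sub sum_Diff_c2_4[OF sub] by (simp add: zset_def)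
  finally show ?thesis using s by auto
qed

text \<open>For g = \<open>\<Sum>P\<close>, this decides which of the circuits arising from
  \<open>P\<close> and \<open>U - P\<close> by adding g is to be played off against
  \<open>X\<close>.\<close>

lemma theta_pair_cases:
  assumes "theta X U" "P \<subseteq> U" "card P = 2" "\<Sum>P \<notin> X"
  obtains "card (P \<inter> X) = 2" | "card (P \<inter> X) = 1" "card ((U - P) \<inter> X) = 2"
proof -
  have "card (P \<inter> X) \<noteq> 0" using theta_private[OF assms(1-3)] assms(4) by auto
  moreover have "card (P \<inter> X) \<le> 2" using assms(3) by (metis card_mono finite inf_le1)
  ultimately show thesis
    using that card_Int_split[OF assms(2), of X] assms(1) by (force simp: theta_def)
qed

text \<open>A square of an outside element would break \<open>U\<close> into a 3-circuit and a
  4-circuit. Either the former shares two elements with \<open>X\<close>, or the latter meets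
  \<open>X\<close> without being equal to it; both give length 3.\<close>

lemma theta_square:
  assumes "theta X U" "bad A F" "F = {#MS X, MS U, {#g, g#}#} + R" "g \<noteq> 0"
  shows "g \<in> X \<union> U"
proof (rule ccontr)
  assume g: "g \<notin> X \<union> U"
  note t = assms(1)[unfolded theta_def]
  obtain P where P: "P \<subseteq> U" "card P = 2" "card (U - P) = 3" "\<Sum>P = g" "\<Sum>(U - P) = g"
    using rep_pair_set[of U g] t g assms(4) by blast
  have gU: "g \<notin> U" using g by simp
  note sp = square_split[OF _ P(1,4) gU assms(4)]
  have zU: "zset U" using t by simp
  have b: "bad A ({#MS (insert g P), MS (insert g (U - P))#} + ({#MS X#} + R))"
    by (rule bad_swap[OF assms(2) _ sp(1)[OF zU]])
      (use sp[OF zU] P in \<open>simp_all add: assms(3) atom_MS\<close>)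
  have "\<Sum>P \<notin> X" using P g by simp
  with assms(1) P(1,2) show False
  proof (cases rule: theta_pair_cases)
    case 1
    have "insert g P \<inter> X = P \<inter> X" using g by auto
    then have "3 \<in> lens (MS (insert g P) + MS X)"
      using sp[OF zU] P t 1 by (intro pair_34) auto
    then show False using bad_pairD[OF b, of "MS (insert g P)" "MS X" "{#MS (insert g (U - P))#} + R"]
      by (simp add: ac_simps)
  next
    case 2
    have "insert g (U - P) \<inter> X \<noteq> {}" "insert g (U - P) \<noteq> X" using 2 g by (auto simp: Int_insert_left)
    then have "3 \<in> lens (MS (insert g (U - P)) + MS X)"
      using sp[OF zU] P t by (intro pair_44) auto
    then show False using bad_pairD[OF b, of "MS (insert g (U - P))" "MS X" "{#MS (insert g P)#} + R"]
      by (simp add: ac_simps)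
  qed
qed

text \<open>Exchanging \<open>x\<close> for the pair of \<open>U\<close> with sum \<open>x\<close>
  again produces circuits of cardinality 3 and 5, but a different 5-circuit.\<close>

lemma line_swap:
  assumes "zset U" "card U = 5" "zset C" "card C = 3" "x \<in> C" "C \<inter> U = {}"
    and "bad A F" "F = {#MS U, MS C#} + R"
  obtains P where "P \<subseteq> U" "card P = 2" "card (U - P) = 3" "\<Sum>P = x"
    "zset (insert x P)" "card (insert x P) = 3"
    "zset ((U - P) \<union> (C - {x}))" "card ((U - P) \<union> (C - {x})) = 5" "(U - P) \<union> (C - {x}) \<noteq> U"
    "bad A ({#MS (insert x P), MS ((U - P) \<union> (C - {x}))#} + R)"
proof -
  have x: "x \<notin> U" "x \<noteq> 0" using assms(3,5,6) by auto
  obtain P where P: "P \<subseteq> U" "card P = 2" "card (U - P) = 3" "\<Sum>P = x"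
    using rep_pair_set[OF assms(1,2) x] by blast
  have sub: "{x} \<subseteq> C" and sum: "\<Sum>P = \<Sum>{x}" and disj: "U \<inter> C = {}" using assms P by auto
  note sp = exchange_split[OF assms(1,3) P(1) sub sum disj]
  have ins: "P \<union> {x} = insert x P" by simp
  have c: "card (insert x P) = 3" "card ((U - P) \<union> (C - {x})) = 5"
    using sp(4,5) P assms by simp_all
  have "card (C - {x}) = 2" using assms by simp
  then obtain y where "y \<in> C - {x}" by (metis card.empty ex_in_conv zero_neq_numeral)
  then have ne: "(U - P) \<union> (C - {x}) \<noteq> U" using disj by auto
  have "bad A ({#MS (insert x P), MS ((U - P) \<union> (C - {x}))#} + R)"
    by (rule bad_swap[OF assms(7,8)]) (use sp c in \<open>auto intro!: atom_MS\<close>)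
  then show thesis using that[OF P _ c(1) _ c(2) ne] sp by simp
qed

text \<open>The common element becomes a square, and the symmetric difference is a 5-circuit
  containing the other three elements of \<open>X\<close>. The number of squares goes up and a theta
  pair appears.\<close>

lemma quad_line_swap:
  assumes "zset X" "card X = 4" "zset C" "card C = 3" "card (X \<inter> C) = 1"
    and "bad A F" "F = {#MS X, MS C#} + R"
  obtains s V where "V = (X - {s}) \<union> (C - {s})" "X \<inter> C = {s}" "s \<noteq> 0" "theta X V"
    "bad A ({#{#s, s#}, MS V#} + R)"
proof -
  obtain s where s: "X \<inter> C = {s}" using assms by (auto simp: card_1_singleton_iff)
  define V where "V = (X - {s}) \<union> (C - {s})"
  have V: "X - C \<union> (C - X) = V" using s by (auto simp: V_def)
  have cV: "card V = 5" using card_symdiff[of X C] V assms by simp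
  then have "V \<noteq> {}" by auto
  have zV: "zset V" using zset_symdiff[OF assms(1,3)] V by simp
  have "s \<in> X" using s by auto
  then have s0: "s \<noteq> 0" using assms(1) by auto
  have "X \<inter> V = X - {s}" using s by (auto simp: V_def)
  then have th: "theta X V" using assms zV cV \<open>s \<in> X\<close> by (simp add: theta_def)
  have "MS X + MS C = {#s, s#} + MS V" using MS_add[of X C] s V by simp
  then have "bad A ({#{#s, s#}, MS V#} + R)"
    using atom_square[OF s0] atom_MS[OF zV] cV \<open>V \<noteq> {}\<close> by (intro bad_swap[OF assms(6,7)]) auto
  then show thesis using that V_def s s0 th by blast
qed

text \<open>By \<open>pair_35\<close> the 3-circuit avoids \<open>U\<close>. If it also avoids
  \<open>X\<close>, then \<open>line_swap\<close> with \<open>U\<close> creates a circuit that makes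
  length 3 with \<open>X\<close>. Otherwise it meets \<open>X\<close> exactly in the one element
  outside \<open>U\<close>, and \<open>quad_line_swap\<close> creates a second 5-circuit next to
  \<open>U\<close>.\<close>

lemma theta_line:
  assumes "theta X U" "bad A F" "F = {#MS X, MS U, MS C#} + R" "zset C" "card C = 3"
  shows False
proof -
  note t = assms(1)[unfolded theta_def]
  have CU: "C \<inter> U = {}"
  proof (rule ccontr)
    assume "C \<inter> U \<noteq> {}"
    then have "3 \<in> lens (MS C + MS U)" using t assms by (intro pair_35) auto
    then show False using bad_pairD[OF assms(2), of "MS C" "MS U" "{#MS X#} + R"] assms(3) by (simp add: ac_simps)
  qed
  show False
  proof (cases "C \<inter> X = {}")
    case True
    have "C \<noteq> {}" using assms(5) by auto
    then obtain x where x: "x \<in> C" by blast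
    have F: "F = {#MS U, MS C#} + ({#MS X#} + R)" by (simp add: assms(3) ac_simps)
    obtain P where P: "P \<subseteq> U" "card P = 2" "card (U - P) = 3" "\<Sum>P = x"
      "zset (insert x P)" "card (insert x P) = 3"
      "zset ((U - P) \<union> (C - {x}))" "card ((U - P) \<union> (C - {x})) = 5"
      and b: "bad A ({#MS (insert x P), MS ((U - P) \<union> (C - {x}))#} + ({#MS X#} + R))"
      using line_swap[of U C x A F] t assms(2,4,5) x CU F by metis
    have xX: "x \<notin> X" using True x by auto
    then have "\<Sum>P \<notin> X" using P by simp
    with assms(1) P(1,2) show False
    proof (cases rule: theta_pair_cases)
      case 1
      have "insert x P \<inter> X = P \<inter> X" using xX by auto
      then have "3 \<in> lens (MS (insert x P) + MS X)"
        using P t 1 by (intro pair_34) auto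
      then show False
        using bad_pairD[OF b, of "MS (insert x P)" "MS X" "{#MS ((U - P) \<union> (C - {x}))#} + R"]
        by (simp add: ac_simps)
    next
      case 2
      have "X \<inter> ((U - P) \<union> (C - {x})) = (U - P) \<inter> X" using True by auto
      then have "3 \<in> lens (MS X + MS ((U - P) \<union> (C - {x})))"
        using P t 2 by (intro pair_45) auto
      then show False
        using bad_pairD[OF b, of "MS X" "MS ((U - P) \<union> (C - {x}))" "{#MS (insert x P)#} + R"]
        by (simp add: ac_simps)
    qed
  next
    case False
    have "card (C \<inter> (X - U)) \<le> card (X - U)" by (intro card_mono) auto
    also have "card (X - U) = 1" using t by (simp add: card_Diff_subset_Int)
    also have "C \<inter> (X - U) = X \<inter> C" using CU by auto
    finally have "card (X \<inter> C) \<le> 1" .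
    moreover have "card (X \<inter> C) \<noteq> 0" using False by auto
    ultimately have c1: "card (X \<inter> C) = 1" by linarith
    have F: "F = {#MS X, MS C#} + ({#MS U#} + R)" by (simp add: assms(3) ac_simps)
    obtain s V where V: "V = (X - {s}) \<union> (C - {s})" "X \<inter> C = {s}" "theta X V"
      and b: "bad A ({#{#s, s#}, MS V#} + ({#MS U#} + R))"
      using quad_line_swap[of X C A F] t assms(2,4,5) c1 F by metis
    have "card (C - {s}) = 2" using V(2) assms(5) by (metis IntD2 card_Diff_singleton insertI1 diff_Suc_1 numeral_2_eq_2 numeral_3_eq_3)
    then obtain y where "y \<in> C - {s}" by (metis card.empty ex_in_conv zero_neq_numeral)
    then have "V \<noteq> U" using CU V by auto
    then have "3 \<in> lens (MS V + MS U)" using V t by (intro pair_55) (auto simp: theta_def)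
    then show False using bad_pairD[OF b, of "MS V" "MS U" "{#{#s, s#}#} + R"] by (simp add: ac_simps)
  qed
qed

lemma supp_factorizes: "factorizes A F \<Longrightarrow> set_mset A = (\<Union>Y\<in>set_mset F. set_mset Y)"
  by (auto simp: factorizes_def)

text \<open>Squares stay inside by \<open>theta_square\<close>, 3-circuits are impossible by
  \<open>theta_line\<close>, and the pair lemmas leave only \<open>X\<close> and \<open>U\<close>
  themselves among the larger circuits.\<close>

lemma theta_support:
  assumes "theta X U" "bad A F" "F = {#MS X, MS U#} + R" "0 \<notin># A"
  shows "set_mset A \<subseteq> X \<union> U"
proof -
  note t = assms(1)[unfolded theta_def]
  have "set_mset Y \<subseteq> X \<union> U" if Y: "Y \<in># R" for Y
  proof -
    obtain R' where R': "R = add_mset Y R'" using Y by (meson multi_member_split)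
    have F: "F = {#MS X, MS U, Y#} + R'" by (simp add: assms(3) R' ac_simps)
    have at: "zero_sum_atom Y" using assms(2) F by (auto intro: bad_atom)
    have "0 \<notin># Y" using assms(2,4) F by (auto simp: bad_def factorizes_def)
    from at show ?thesis
    proof (cases rule: atom_cases)
      case zero then show ?thesis using \<open>0 \<notin># Y\<close> by simp
    next
      case (square g) then show ?thesis using theta_square[OF assms(1,2), of g R'] F by simp
    next
      case (set C)
      then consider "card C = 3" | "card C = 4" | "card C = 5" by linarith
      then show ?thesis
      proof cases
        case 1 then show ?thesis using theta_line[OF assms(1,2), of C R'] F set by simp
      next
        case 2
        have "C = X"
        proof (rule ccontr)
          assume "C \<noteq> X"
          have "C \<inter> X = {}"
          proof (rule ccontr)
            assume "C \<inter> X \<noteq> {}"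
            then have "3 \<in> lens (MS C + MS X)" using 2 set t \<open>C \<noteq> X\<close> by (intro pair_44) auto
            then show False using bad_pairD[OF assms(2), of "MS C" "MS X" "{#MS U#} + R'"] F set by (simp add: ac_simps)
          qed
          moreover have "card (C \<inter> U) = 3"
          proof (rule ccontr)
            assume "card (C \<inter> U) \<noteq> 3"
            then have "3 \<in> lens (MS C + MS U)" using 2 set t by (intro pair_45) auto
            then show False using bad_pairD[OF assms(2), of "MS C" "MS U" "{#MS X#} + R'"] F set by (simp add: ac_simps)
          qed
          \<comment> \<open>The disjoint sets \<open>C\<close> and \<open>X\<close> would each
            occupy three of the five elements of \<open>U\<close>.\<close>
          moreover have "card ((C \<inter> U) \<union> (X \<inter> U)) \<le> card U" by (intro card_mono) auto
          moreover have "card ((C \<inter> U) \<union> (X \<inter> U)) = card (C \<inter> U) + card (X \<inter> U)"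
            using \<open>C \<inter> X = {}\<close> by (intro card_Un_disjoint) auto
          ultimately show False using t by simp
        qed
        then show ?thesis using set by simp
      next
        case 3
        have "C = U"
        proof (rule ccontr)
          assume "C \<noteq> U"
          then have "3 \<in> lens (MS C + MS U)" using 3 set t by (intro pair_55) auto
          then show False using bad_pairD[OF assms(2), of "MS C" "MS U" "{#MS X#} + R'"] F set by (simp add: ac_simps)
        qed
        then show ?thesis using set by simp
      qed
    qed
  qed
  then show ?thesis using supp_factorizes[of A F] assms(2,3) by (auto simp: bad_def)
qed


section \<open>Factorizations containing a circuit twice\<close>

text \<open>Replacing two elements of \<open>U\<close> by their sum gives a 4-circuit that keeps the
  other three.\<close>

lemma theta_exists:
  assumes "zset U" "card U = 5"
  obtains X where "theta X U"
proof -
  obtain P where P: "P \<subseteq> U" "card P = 2" using assms by (metis obtain_subset_with_card_n numeral_le_iff semiring_norm(68,71,72,73))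
  then obtain i j where ij: "P = {i, j}" "i \<noteq> j" by (auto simp: card_2_iff)
  define g where "g = i + j"
  have gU: "g \<notin> U" using zset_no_triple[of U i j] assms ij P by (auto simp: g_def)
  have g0: "g \<noteq> 0" using ij by (auto simp: g_def eq_iff_add_zero[symmetric])
  have "\<Sum>P = g" using ij by (simp add: g_def)
  note sp = square_split[OF assms(1) P(1) this gU g0]
  have "card (U - P) = 3" using assms P by (simp add: card_Diff_subset)
  moreover have "insert g (U - P) \<inter> U = U - P" using gU by auto
  ultimately have "theta (insert g (U - P)) U" using sp assms by (simp add: theta_def)
  then show thesis by (rule that)
qed

text \<open>If a 4-circuit among the other atoms forms a theta with \<open>U\<close>, then
  \<open>theta_support\<close> applies. Otherwise each atom not contained in \<open>U\<close>
  contradicts badness, if necessary after a swap with one copy of \<open>U\<close>, because the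
  second copy is still there. The support then lies in \<open>U\<close>, and any theta through
  \<open>U\<close> will do.\<close>

lemma double_quint_support:
  assumes "zset U" "card U = 5" "bad A F" "F = {#MS U, MS U#} + R" "0 \<notin># A"
  shows "\<exists>X V. theta X V \<and> set_mset A \<subseteq> X \<union> V"
proof (cases "\<exists>X. MS X \<in># R \<and> theta X U")
  case True
  then obtain X R' where X: "theta X U" "R = add_mset (MS X) R'" by (meson multi_member_split)
  have "F = {#MS X, MS U#} + ({#MS U#} + R')" by (simp add: assms(4) X ac_simps)
  then show ?thesis using theta_support[OF X(1) assms(3)] X(1) assms(5) by blast
next
  case False
  obtain X where X: "theta X U" using theta_exists assms(1,2) by blast
  have "set_mset Y \<subseteq> U" if Y: "Y \<in># R" for Y
  proof -
    obtain R' where R': "R = add_mset Y R'" using Y by (meson multi_member_split)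
    have F: "F = {#Y, MS U#} + ({#MS U#} + R')" "F = {#MS U, Y#} + ({#MS U#} + R')"
      by (simp_all add: assms(4) R' ac_simps)
    have at: "zero_sum_atom Y" using assms(3) F by (auto intro: bad_atom)
    have "0 \<notin># Y" using assms(3,5) F by (auto simp: bad_def factorizes_def)
    from at show ?thesis
    proof (cases rule: atom_cases)
      case zero then show ?thesis using \<open>0 \<notin># Y\<close> by simp
    next
      case (square g)
      have "g \<in> U"
      proof (rule ccontr)
        assume g: "g \<notin> U"
        obtain P where P: "P \<subseteq> U" "card P = 2" "card (U - P) = 3" "\<Sum>P = g"
          using rep_pair_set[of U g] assms(1,2) g square(1) by blast
        note sp = square_split[OF assms(1) P(1,4) g square(1)]
        have b: "bad A ({#MS (insert g P), MS (insert g (U - P))#} + ({#MS U#} + R'))"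
          by (rule bad_swap[OF assms(3) F(2)]) (use sp P square(2) in \<open>simp_all add: atom_MS\<close>)
        have "insert g P \<inter> U \<noteq> {}"
        proof
          assume "insert g P \<inter> U = {}"
          then have "P = {}" using P(1) by auto
          then show False using P(2) by simp
        qed
        then have "3 \<in> lens (MS (insert g P) + MS U)" using sp P assms(1,2) by (intro pair_35) auto
        then show False using bad_pairD[OF b, of "MS (insert g P)" "MS U" "{#MS (insert g (U - P))#} + R'"]
          by (simp add: ac_simps)
      qed
      then show ?thesis using square by simp
    next
      case (set C)
      then consider "card C = 3" | "card C = 4" | "card C = 5" by linarith
      then show ?thesis
      proof cases
        case 1
        have CU: "C \<inter> U = {}"
        proof (rule ccontr)
          assume "C \<inter> U \<noteq> {}"
          then have "3 \<in> lens (MS C + MS U)" using 1 set assms by (intro pair_35) auto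
          then show False using bad_pairD[OF assms(3) F(1)] set by simp
        qed
        have "C \<noteq> {}" using 1 by auto
        then obtain x where x: "x \<in> C" by blast
        obtain P where P: "zset ((U - P) \<union> (C - {x}))" "card ((U - P) \<union> (C - {x})) = 5" "(U - P) \<union> (C - {x}) \<noteq> U"
          and b: "bad A ({#MS (insert x P), MS ((U - P) \<union> (C - {x}))#} + ({#MS U#} + R'))"
          using line_swap[OF assms(1,2) set(1) 1 x CU assms(3)] F(2) set by metis
        have "3 \<in> lens (MS ((U - P) \<union> (C - {x})) + MS U)" using P assms(1,2) by (intro pair_55)
        then show ?thesis using bad_pairD[OF b, of "MS ((U - P) \<union> (C - {x}))" "MS U" "{#MS (insert x P)#} + R'"]
          by (simp add: ac_simps)
      next
        case 2
        have "card (C \<inter> U) \<noteq> 3" using False Y set 2 assms(1,2) by (auto simp: theta_def)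
        then have "3 \<in> lens (MS C + MS U)" using 2 set assms by (intro pair_45)
        then show ?thesis using bad_pairD[OF assms(3) F(1)] set by simp
      next
        case 3
        have "C = U"
        proof (rule ccontr)
          assume "C \<noteq> U"
          then have "3 \<in> lens (MS C + MS U)" using 3 set assms by (intro pair_55)
          then show False using bad_pairD[OF assms(3) F(1)] set by simp
        qed
        then show ?thesis using set by simp
      qed
    qed
  qed
  then have "set_mset A \<subseteq> U" using supp_factorizes[of A F] assms(1-4) by (auto simp: bad_def)
  then show ?thesis using X by blast
qed

text \<open>\<open>X\<close> spans a subgroup of index two, consisting of 0, the four elements of
  \<open>X\<close> and the three sums of its pairs. One of \<open>x\<close>, \<open>y\<close>,
  \<open>x + y\<close> must lie in it.\<close>

lemma span_quad:
  assumes X: "zset X" "card X = 4" and xy: "x \<notin> X" "y \<notin> X" "x \<noteq> y" "x \<noteq> 0" "y \<noteq> 0"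
  obtains (fst) Q where "Q \<subseteq> X" "card Q = 2" "\<Sum>Q = x"
    | (snd) Q where "Q \<subseteq> X" "card Q = 2" "\<Sum>Q = y"
    | (both) Q where "Q \<subseteq> X" "card Q = 2" "\<Sum>Q = x + y"
    | (one) "x + y \<in> X"
proof -
  obtain m where m: "m \<in> X" using X by fastforce
  have "card ({x, y} \<union> (X - {m})) = 5" using X xy m by (subst card_Un_disjoint) auto
  then obtain Z where Z: "Z \<subseteq> {x, y} \<union> (X - {m})" "Z \<noteq> {}" "\<Sum>Z = 0"
    using zero_sum_subset_exists[of "{x, y} \<union> (X - {m})"] by auto
  define Q where "Q = Z \<inter> X"
  define E where "E = Z \<inter> {x, y}"
  have ZE: "Z = Q \<union> E" "Q \<inter> E = {}" using Z(1) xy by (auto simp: Q_def E_def)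
  have "\<Sum>Q + \<Sum>E = 0" using Z(3) ZE by (simp add: sum.union_disjoint)
  then have QE: "\<Sum>Q = \<Sum>E" by (rule eq_iff_add_zero[THEN iffD2])
  have Qm: "Q \<subseteq> X - {m}" using Z(1) xy by (auto simp: Q_def)
  then have QX: "Q \<subseteq> X" "Q \<noteq> X" using m by auto
  have "E \<noteq> {}"
  proof
    assume "E = {}"
    then have "\<Sum>Q = 0" "Q \<noteq> {}" using QE ZE Z by auto
    then show False using zset_subset_cases[of X Q] QX X by auto
  qed
  then consider "E = {x}" | "E = {y}" | "E = {x, y}" by (auto simp: E_def)
  then have E: "\<Sum>E = x \<or> \<Sum>E = y \<or> \<Sum>E = x + y" using xy by cases auto
  have E0: "\<Sum>E \<noteq> 0" using E xy by (auto simp: eq_iff_add_zero[symmetric])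
  have *: "\<Sum>E \<in> X \<or> (\<exists>Q'. Q' \<subseteq> X \<and> card Q' = 2 \<and> \<Sum>Q' = \<Sum>E)"
  proof -
    have "card (X - {m}) = 3" using X m by simp
    then have "card Q \<le> 3" using card_mono[OF _ Qm] by simp
    then consider "card Q = 0" | "card Q = 1" | "card Q = 2" | "card Q = 3" by linarith
    then show ?thesis
    proof cases
      case 1 then show ?thesis using QE E0 by simp
    next
      case 2 then show ?thesis using QE QX by (auto simp: card_1_singleton_iff)
    next
      case 3 then show ?thesis using QE QX by auto
    next
      case 4
      have "Q = X - {m}" using 4 \<open>card (X - {m}) = 3\<close> Qm by (intro card_subset_eq) auto
      then have "\<Sum>Q = m" using X m by (simp add: sum_Diff_c2_4 zset_def)
      then show ?thesis using QE m by auto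
    qed
  qed
  then show thesis using E xy that by metis
qed

text \<open>The hypotheses say that \<open>g\<close> lies outside the span of \<open>X\<close>.
  Replacing one \<open>a\<close> in \<open>X\<close> by \<open>g\<close> and \<open>g + a\<close>
  then gives a 5-circuit.\<close>

lemma quad_extends_to_theta:
  assumes "zset X" "card X = 4" "g \<notin> X" "g \<noteq> 0" "\<And>Q. Q \<subseteq> X \<Longrightarrow> card Q = 2 \<Longrightarrow> \<Sum>Q \<noteq> g"
  shows "\<exists>U. theta X U \<and> g \<in> U"
proof -
  have "X \<noteq> {}" using assms(2) by auto
  then obtain a where a: "a \<in> X" by blast
  define U where "U = insert g (insert (g + a) (X - {a}))"
  have a0: "a \<noteq> 0" using a assms(1) by auto
  have ga: "g + a \<notin> X"
  proof
    assume b: "g + a \<in> X"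
    have "a \<noteq> g + a" using assms(4) by (metis add_eq_iff add.commute add_self)
    then have "card {a, g + a} = 2" by simp
    moreover have "\<Sum>{a, g + a} = g" using \<open>a \<noteq> g + a\<close> by (simp add: ac_simps)
    ultimately show False using assms(5)[of "{a, g + a}"] a b by blast
  qed
  have "g \<noteq> g + a" using a0 by simp
  have "card U = 5" using ga \<open>g \<noteq> g + a\<close> assms a by (simp add: U_def)
  moreover have "g + a \<noteq> 0" using a assms(3) by (auto simp: eq_iff_add_zero[symmetric])
  moreover have "\<Sum>(X - {a}) = a" using a assms(1) by (simp add: sum_Diff_c2_4 zset_def)
  ultimately have "zset U" using ga \<open>g \<noteq> g + a\<close> assms by (auto simp: zset_def U_def ac_simps)
  moreover have "X \<inter> U = X - {a}" using ga assms(3) by (auto simp: U_def)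
  ultimately have "theta X U" using assms \<open>card U = 5\<close> a by (simp add: theta_def)
  then show ?thesis by (auto simp: U_def)
qed

text \<open>Two things cannot occur: a theta pair in any bad factorization of \<open>A\<close>
  (\<open>noth\<close>), and a 3-circuit sharing two elements with \<open>X\<close> next to a copy
  of \<open>X\<close> (\<open>line\<close>). Every other atom either makes length 3 with
  \<open>X\<close> or can be swapped with one copy of \<open>X\<close> so that an impossible pair
  arises with the other copy.\<close>

lemma double_quad_atoms:
  assumes X: "zset X" "card X = 4" and b: "bad A F" "F = {#MS X, MS X#} + R" "0 \<notin># A"
    and nt: "\<not> (\<exists>X V. theta X V \<and> set_mset A \<subseteq> X \<union> V)"
    and Y: "Y \<in># R"
  shows "Y = MS X \<or> (\<exists>g. g \<noteq> 0 \<and> Y = {#g, g#} \<and> (\<forall>Q. Q \<subseteq> X \<longrightarrow> card Q = 2 \<longrightarrow> \<Sum>Q \<noteq> g))"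
proof -
  obtain R' where R': "R = add_mset Y R'" using Y by (meson multi_member_split)
  have F: "F = {#MS X, Y#} + ({#MS X#} + R')" "F = {#Y, MS X#} + ({#MS X#} + R')"
    by (simp_all add: b(2) R' ac_simps)
  have at: "zero_sum_atom Y" using b F by (auto intro: bad_atom)
  have "0 \<notin># Y" using b F by (auto simp: bad_def factorizes_def)
  have noth: False if "theta X V" "bad A G" "G = {#MS X, MS V#} + S" for G V S
    using theta_support[OF that b(3)] that nt by blast
  have line: False if "card Q = 2" "Q \<subseteq> X" "w \<notin> X" "zset (insert w Q)" "bad A G"
     "G = {#MS (insert w Q), MS X#} + S" for Q w G S
  proof -
    have "insert w Q \<inter> X = Q" "w \<notin> Q" using that by auto
    then have "3 \<in> lens (MS (insert w Q) + MS X)" using that X by (intro pair_34) auto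
    then show False using bad_pairD that(5,6) by blast
  qed
  have cdiff: "card (X - Q) = 2" "\<Sum>(X - Q) = \<Sum>Q" if "Q \<subseteq> X" "card Q = 2" for Q
    using that X by (simp_all add: card_Diff_subset sum_Diff_c2_4 zset_def)
  from at show ?thesis
  proof (cases rule: atom_cases)
    case zero then show ?thesis using \<open>0 \<notin># Y\<close> by simp
  next
    case (square g)
    have "\<Sum>Q \<noteq> g" if Q: "Q \<subseteq> X" "card Q = 2" for Q
    proof
      assume s: "\<Sum>Q = g"
      have "g \<notin> X"
      proof
        assume "g \<in> X"
        obtain i j where ij: "Q = {i, j}" "i \<noteq> j" using Q by (auto simp: card_2_iff)
        then show False using zset_no_triple[of X i j] X Q s \<open>g \<in> X\<close> by auto
      qed
      note sp = square_split[OF X(1) Q(1) s this square(1)]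
      have b': "bad A ({#MS (insert g Q), MS (insert g (X - Q))#} + ({#MS X#} + R'))"
        by (rule bad_swap[OF b(1) F(1)]) (use sp Q cdiff[OF Q] square(2) in \<open>simp_all add: atom_MS\<close>)
      show False
        by (rule line[OF Q(2,1) \<open>g \<notin> X\<close> sp(2) b', of "{#MS (insert g (X - Q))#} + R'"]) (simp add: ac_simps)
    qed
    then show ?thesis using square by blast
  next
    case (set C)
    show ?thesis
    proof (rule ccontr)
      assume "\<not> ?thesis"
      then have "C \<noteq> X" using set by auto
      have disj: "X \<inter> C = {}" if "card C \<in> {3, 4}"
      proof (rule ccontr)
        assume ne: "X \<inter> C \<noteq> {}"
        show False
        proof (cases "card C = 4")
          case True
          then have "3 \<in> lens (MS X + MS C)" using X set \<open>C \<noteq> X\<close> ne by (intro pair_44) auto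
          then show False using bad_pairD[OF b(1) F(1)] set by simp
        next
          case False
          then have c3: "card C = 3" using that by simp
          have "card (X \<inter> C) \<le> 3" using c3 by (metis card_mono finite inf_le2)
          moreover have "card (X \<inter> C) \<noteq> 3"
          proof
            assume "card (X \<inter> C) = 3"
            then have "X \<inter> C = C" using c3 by (intro card_subset_eq) auto
            then have "C \<subseteq> X" by auto
            then show False using zset_subset_cases[of X C] set X c3 by (auto simp: zset_def)
          qed
          moreover have "card (X \<inter> C) \<noteq> 2"
          proof
            assume "card (X \<inter> C) = 2"
            then have "3 \<in> lens (MS C + MS X)" using c3 set X by (intro pair_34) (auto simp: Int_commute)
            then show False using bad_pairD[OF b(1) F(2)] set by simp
          qed
          moreover have "card (X \<inter> C) \<noteq> 0" using ne by simp
          ultimately have "card (X \<inter> C) = 1" by linarith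
          then obtain s V where V: "theta X V" and b': "bad A ({#{#s, s#}, MS V#} + ({#MS X#} + R'))"
            using quad_line_swap[OF X set(1) c3 _ b(1)] F(1) set by metis
          show False by (rule noth[OF V b', of "{#{#s, s#}#} + R'"]) (simp add: ac_simps)
        qed
      qed
      consider "card C = 3" | "card C = 4" | "card C = 5" using set by linarith
      then show False
      proof cases
        case 1
        have d: "X \<inter> C = {}" using disj 1 by simp
        obtain x y z where xyz: "C = {x, y, z}" "x \<noteq> y" "x \<noteq> z" "y \<noteq> z" using 1 by (auto simp: card_3_iff)
        have "x + y + z = 0" using set(1) xyz by (simp add: zset_def ac_simps)
        then have xyz2: "x + y = z" by (rule eq_iff_add_zero[THEN iffD2])
        have n: "x \<notin> X" "y \<notin> X" "z \<notin> X" "x \<noteq> 0" "y \<noteq> 0" using d xyz set(1) by (auto simp: zset_def)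
        have key: False if w: "w \<in> C" and Q: "Q \<subseteq> X" "card Q = 2" "\<Sum>Q = w" for w Q
        proof -
          have wX: "w \<notin> X" using w d by auto
          have 2: "card (X - Q) = 2" "\<Sum>(X - Q) = \<Sum>{w}" using cdiff[OF Q(1,2)] Q by auto
          have sub: "X - Q \<subseteq> X" "{w} \<subseteq> C" using w by auto
          note sp = exchange_split[OF X(1) set(1) sub 2(2) d]
          have e: "(X - Q) \<union> {w} = insert w (X - Q)" by simp
          have b': "bad A ({#MS (insert w (X - Q)), MS ((X - (X - Q)) \<union> (C - {w}))#} + ({#MS X#} + R'))"
            by (rule bad_swap[OF b(1) F(1)]) (use sp e 1 2 X set w in \<open>auto intro!: atom_MS\<close>)
          show False
            by (rule line[OF 2(1) sub(1) wX _ b', of "{#MS ((X - (X - Q)) \<union> (C - {w}))#} + R'"])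
              (use sp(2) in \<open>simp_all add: ac_simps\<close>)
        qed
        \<comment> \<open>As \<open>x + y = z\<close>, some element of \<open>C\<close> is the sum
          of a pair of \<open>X\<close>, and \<open>key\<close> applies to it.\<close>
        show False using X(1) X(2) n(1,2) xyz(2) n(4,5)
        proof (cases rule: span_quad)
          case (fst Q) then show False using key[of x Q] xyz by simp
        next
          case (snd Q) then show False using key[of y Q] xyz by simp
        next
          case (both Q) then show False using key[of z Q] xyz xyz2 by simp
        next
          case one then show False using xyz2 n by simp
        qed
      next
        case 2
        have d: "X \<inter> C = {}" using disj 2 by simp
        have "C \<noteq> {}" using 2 by auto
        then obtain e where e: "e \<in> C" by blast
        have "card (C - {e}) = 3" using 2 e by simp
        then obtain f where f: "f \<in> C" "f \<noteq> e" by (metis Diff_iff card.empty ex_in_conv singletonI zero_neq_numeral)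
        have n: "e \<notin> X" "f \<notin> X" "e \<noteq> f" "e \<noteq> 0" "f \<noteq> 0" using d e f set(1) by auto
        have key: False if w: "w \<in> C" and Q: "Q \<subseteq> X" "card Q = 2" "\<Sum>Q = w" for w Q
        proof -
          have wX: "w \<notin> X" using w d by auto
          have 22: "card (X - Q) = 2" "\<Sum>(X - Q) = \<Sum>{w}" using cdiff[OF Q(1,2)] Q by auto
          have sub: "X - Q \<subseteq> X" "{w} \<subseteq> C" using w by auto
          note sp = exchange_split[OF X(1) set(1) sub 22(2) d]
          have e: "(X - Q) \<union> {w} = insert w (X - Q)" by simp
          have b': "bad A ({#MS (insert w (X - Q)), MS ((X - (X - Q)) \<union> (C - {w}))#} + ({#MS X#} + R'))"
            by (rule bad_swap[OF b(1) F(1)]) (use sp e 2 22 X set w in \<open>auto intro!: atom_MS\<close>)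
          show False
            by (rule line[OF 22(1) sub(1) wX _ b', of "{#MS ((X - (X - Q)) \<union> (C - {w}))#} + R'"])
              (use sp(2) in \<open>simp_all add: ac_simps\<close>)
        qed
        have sub2: "{e, f} \<subseteq> C" and sumef: "\<Sum>{e, f} = e + f" and cef: "card {e, f} = 2" using e f by auto
        show False using X(1) X(2) n
        proof (cases rule: span_quad)
          case (fst Q) then show False using key[of e Q] e by simp
        next
          case (snd Q) then show False using key[of f Q] f by simp
        next
          case (both Q)
          \<comment> \<open>Exchanging halves makes two 4-circuits, of which
            \<open>Q \<union> {e, f}\<close> meets the second copy of \<open>X\<close>.\<close>
          have sQ: "\<Sum>Q = \<Sum>{e, f}" using both sumef by simp
          note sp = exchange_split[OF X(1) set(1) both(1) sub2 sQ d]
          have b': "bad A ({#MS (Q \<union> {e, f}), MS ((X - Q) \<union> (C - {e, f}))#} + ({#MS X#} + R'))"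
            by (rule bad_swap[OF b(1) F(1)]) (use sp both cef 2 X set in \<open>auto intro!: atom_MS\<close>)
          have "Q \<noteq> {}" using both(2) by auto
          then have "(Q \<union> {e, f}) \<inter> X \<noteq> {}" "Q \<union> {e, f} \<noteq> X" using both(1) n(1) by auto
          then have "3 \<in> lens (MS (Q \<union> {e, f}) + MS X)" using sp both cef X by (intro pair_44) auto
          then show False
            using bad_pairD[OF b', of "MS (Q \<union> {e, f})" "MS X" "{#MS ((X - Q) \<union> (C - {e, f}))#} + R'"]
            by (simp add: ac_simps)
        next
          case one
          \<comment> \<open>Exchanging one element of \<open>X\<close> for two of \<open>C\<close>
            makes a 3-circuit and a 5-circuit with three elements of \<open>X\<close>, hence a theta
            pair.\<close>
          have sQ: "\<Sum>{e + f} = \<Sum>{e, f}" and s1: "{e + f} \<subseteq> X" using one sumef by simp_all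
          note sp = exchange_split[OF X(1) set(1) s1 sub2 sQ d]
          let ?V = "(X - {e + f}) \<union> (C - {e, f})"
          have "X \<inter> ?V = X - {e + f}" using d by auto
          moreover have "card ?V = 5" using sp(5) X 2 cef by simp
          ultimately have th: "theta X ?V" using X sp(3) one by (simp add: theta_def)
          have b': "bad A ({#MS ({e + f} \<union> {e, f}), MS ?V#} + ({#MS X#} + R'))"
            by (rule bad_swap[OF b(1) F(1)]) (use sp cef \<open>card ?V = 5\<close> set in \<open>auto intro!: atom_MS\<close>)
          show False by (rule noth[OF th b', of "{#MS ({e + f} \<union> {e, f})#} + R'"]) (simp add: ac_simps)
        qed
      next
        case 3
        show False
        proof (cases "card (X \<inter> C) = 3")
          case True
          then have "theta X C" using X set 3 by (simp add: theta_def)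
          then show False by (rule noth[OF _ b(1), of C "{#MS X#} + R'"]) (use F set in simp)
        next
          case False
          then have "3 \<in> lens (MS X + MS C)" using X set 3 by (intro pair_45)
          then show False using bad_pairD[OF b(1) F(1)] set by simp
        qed
      qed
    qed
  qed
qed


definition theta_supp :: "c2_4 multiset \<Rightarrow> bool" where
  "theta_supp A \<longleftrightarrow> (\<exists>X U. theta X U \<and> set_mset A \<subseteq> X \<union> U)"

text \<open>The support lies in a nontrivial coset of a subgroup \<open>N\<close>, so it contains no zero-sum set of
  odd cardinality.\<close>

definition affine_supp :: "c2_4 multiset \<Rightarrow> bool" where
  "affine_supp A \<longleftrightarrow> (\<exists>N a. 0 \<in> N \<and> (\<forall>x\<in>N. \<forall>y\<in>N. x + y \<in> N) \<and> a \<notin> N \<and> (\<forall>x\<in>#A. a + x \<in> N))"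

lemma square_eq_iff [simp]: "{#g, g#} = {#h, h#} \<longleftrightarrow> g = h"
  by (metis insert_absorb2 set_mset_add_mset_insert set_mset_empty singleton_insert_inj_eq)

lemma double_of_squares:
  "(\<And>Y. Y \<in># R \<Longrightarrow> \<exists>g. Y = {#g, g#}) \<Longrightarrow> \<exists>E. \<Sum>\<^sub># R = E + E \<and> size E = size R"
proof (induction R)
  case (add Y R)
  then obtain E where E: "\<Sum>\<^sub># R = E + E" "size E = size R" by auto
  obtain g where g: "Y = {#g, g#}" using add.prems by auto
  have "\<Sum>\<^sub># (add_mset Y R) = add_mset g E + add_mset g E" using E g by simp
  then show ?case using E by (intro exI[of _ "add_mset g E"]) simp
qed simp

lemma quad_elements:
  assumes "zset X" "card X = 4"
  obtains a b c where "X = {a, b, c, a + b + c}" "a \<noteq> b" "a \<noteq> c" "b \<noteq> c" 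
    "a + b + c \<notin> {a, b, c}"
proof -
  obtain a Y where a: "X = insert a Y" "a \<notin> Y" "card Y = 3" using assms by (metis card_Suc_eq numeral_eq_Suc pred_numeral_simps(2) semiring_norm(26) semiring_norm(27) numeral_3_eq_3 eval_nat_numeral(2))
  then obtain b c d where Y: "Y = {b, c, d}" "b \<noteq> c" "b \<noteq> d" "c \<noteq> d" by (auto simp: card_3_iff)
  have "d + (a + b + c) = 0" using assms a Y by (simp add: zset_def ac_simps)
  then have d: "d = a + b + c" by (rule eq_iff_add_zero[THEN iffD2])
  show thesis by (rule that[of a b c]) (use a Y d in auto)
qed

lemma pair_sums:
  assumes "X = {a, b, c, a + b + c :: c2_4}" "Q \<subseteq> X" "card Q = 2"
  shows "\<Sum>Q = a + b \<or> \<Sum>Q = a + c \<or> \<Sum>Q = b + c"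
proof -
  obtain i j where ij: "Q = {i, j}" "i \<noteq> j" using assms by (auto simp: card_2_iff)
  then have "\<Sum>Q = i + j" by simp
  moreover have "i \<in> X" "j \<in> X" using ij assms by auto
  ultimately show ?thesis using ij(2) assms(1) by (auto simp: ac_simps)
qed

lemma bad_subD: "bad A F \<Longrightarrow> F = K + R \<Longrightarrow> n \<in> lens (\<Sum>\<^sub># K) \<Longrightarrow> n = Suc (size K) \<Longrightarrow> False"
  using bad_sub by blast

text \<open>The support contains at least two elements outside \<open>X\<close>, since a single one
  could be put on a theta with \<open>X\<close>. Any two of them differ by the sum of a pair of
  \<open>X\<close>, which places the support in one coset. Moreover \<open>X\<close> occurs exactly
  twice, so all other atoms are squares; the excess 2 in \<open>size D\<close> is the gain from
  replacing two copies of \<open>X\<close> by four squares.\<close>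

lemma double_quad_conclusion:
  assumes X: "zset X" "card X = 4" and b: "bad A F" "F = {#MS X, MS X#} + R" "0 \<notin># A"
    and nt: "\<not> theta_supp A"
  shows "affine_supp A \<and> (\<exists>D. A = D + D \<and> size D = size F + 2)"
proof -
  let ?out = "\<lambda>g. \<forall>Q. Q \<subseteq> X \<longrightarrow> card Q = 2 \<longrightarrow> \<Sum>Q \<noteq> g"
  have nt': "\<not> (\<exists>X V. theta X V \<and> set_mset A \<subseteq> X \<union> V)" using nt by (simp add: theta_supp_def)
  note atoms = double_quad_atoms[OF X b nt']
  have supp: "g \<in> X \<or> ({#g, g#} \<in># R \<and> ?out g)" if g: "g \<in># A" for g
  proof -
    obtain Y where Y: "Y \<in># F" "g \<in># Y" using supp_factorizes[of A F] b(1) g unfolding bad_def by blast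
    show ?thesis
    proof (cases "Y = MS X")
      case True then show ?thesis using Y by simp
    next
      case False
      then have "Y \<in># R" using Y b(2) by auto
      then show ?thesis using atoms[of Y] False Y by auto
    qed
  qed
  have nz: "g \<noteq> 0" if "g \<in># A" for g using that b(3) by auto
  have "\<exists>g h. g \<in># A \<and> h \<in># A \<and> g \<notin> X \<and> h \<notin> X \<and> g \<noteq> h"
  proof (rule ccontr)
    assume *: "\<not> ?thesis"
    have "\<exists>g. g \<notin> X \<and> g \<noteq> 0 \<and> ?out g \<and> set_mset A \<subseteq> insert g X"
    proof (cases "set_mset A \<subseteq> X")
      case True
      \<comment> \<open>At most 5 + 6 = 11 elements are 0, in \<open>X\<close> or sums of pairs of
        \<open>X\<close>, so some element lies outside the span.\<close>
      let ?S = "Sum ` {Q. Q \<subseteq> X \<and> card Q = 2}"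
      have "card ?S \<le> card {Q. Q \<subseteq> X \<and> card Q = 2}" by (rule card_image_le) simp
      also have "\<dots> = 6" using n_subsets[of X 2] X by (simp add: choose_two)
      finally have "card ?S \<le> 6" .
      then have "card (insert 0 X \<union> ?S) \<le> 11"
        using card_Un_le[of "insert 0 X" ?S] card_insert_le_m1[of 5 X 0] X by simp
      then have "card (insert 0 X \<union> ?S) \<noteq> card (UNIV :: c2_4 set)" unfolding card_c2_4 by linarith
      then have "insert 0 X \<union> ?S \<noteq> UNIV" by metis
      then obtain g where "g \<notin> insert 0 X \<union> ?S" by blast
      then show ?thesis using True by (intro exI[of _ g]) auto
    next
      case False
      then obtain g where g: "g \<in># A" "g \<notin> X" by blast
      then show ?thesis using supp[OF g(1)] nz[OF g(1)] * by (intro exI[of _ g]) auto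
    qed
    then obtain g where g: "g \<notin> X" "g \<noteq> 0" "?out g" "set_mset A \<subseteq> insert g X" by blast
    then obtain U where "theta X U" "g \<in> U" using quad_extends_to_theta[OF X g(1,2)] by blast
    then show False using nt g(4) by (auto simp: theta_supp_def)
  qed
  then obtain g h where gh: "g \<in># A" "h \<in># A" "g \<notin> X" "h \<notin> X" "g \<noteq> h" by blast
  have pair: "\<exists>Q. Q \<subseteq> X \<and> card Q = 2 \<and> \<Sum>Q = g + h" if gh: "g \<in># A" "h \<in># A" "g \<notin> X" "h \<notin> X" "g \<noteq> h" for g h
  proof -
    have R: "{#g, g#} \<in># R" "{#h, h#} \<in># R" "?out g" "?out h" using supp gh by auto
    obtain R1 where R1: "R = add_mset {#g, g#} R1" using R(1) by (meson multi_member_split)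
    then have "{#h, h#} \<in># R1" using R(2) gh(5) by auto
    then obtain R' where "R1 = add_mset {#h, h#} R'" by (meson multi_member_split)
    then have R': "R = {#{#g, g#}, {#h, h#}#} + R'" using R1 by simp
    from X gh(3,4,5) nz[OF gh(1)] nz[OF gh(2)] show ?thesis
    proof (cases rule: span_quad)
      \<comment> \<open>If \<open>g + h\<close> is in \<open>X\<close>, the four atoms X, X, g^2,
        h^2 also factor into two copies of the 3-circuit \<open>?L\<close> and three squares, which
        is one atom more.\<close>
      case one
      let ?a = "g + h"
      let ?L = "{?a, g, h}"
      have L: "zset ?L" "card ?L = 3" using gh nz[OF gh(1)] nz[OF gh(2)] one X(1)
        by (auto simp: zset_def ac_simps)
      have e1: "MS X = {#?a#} + MS (X - {?a})" using one by (simp add: mset_set.remove)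
      have e2: "MS ?L = {#?a, g, h#}" using gh(5) nz[OF gh(1)] nz[OF gh(2)] by simp
      have "1 + (1 + card (X - {?a})) \<in> lens (MS ?L + (MS ?L + (MS (X - {?a}) + MS (X - {?a}))))"
        using L X by (intro lens_plus lens_atom atom_MS lens_squares) auto
      also have "MS ?L + (MS ?L + (MS (X - {?a}) + MS (X - {?a}))) = MS X + MS X + {#g, g#} + {#h, h#}"
        unfolding e1 e2 by simp
      finally have q5: "5 \<in> lens (\<Sum>\<^sub># {#MS X, MS X, {#g, g#}, {#h, h#}#})"
        using one X by (simp add: ac_simps add_mset_commute)
      have False by (rule bad_subD[OF b(1) _ q5]) (simp_all add: b(2) R')
      then show ?thesis ..
    qed (use R in auto)
  qed
  have "MS X \<notin># R"
  proof
    assume XR: "MS X \<in># R"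
    have R: "{#g, g#} \<in># R" "{#h, h#} \<in># R" using supp gh by auto
    have XX: "MS X \<noteq> {#y, y#}" for y
    proof
      assume "MS X = {#y, y#}"
      then have "size (MS X) = size {#y, y#}" by (rule arg_cong)
      then show False using X by simp
    qed
    obtain R1 where R1: "R = add_mset {#g, g#} R1" using R(1) by (meson multi_member_split)
    then have "{#h, h#} \<in># R1" using R(2) gh(5) by auto
    then obtain R2 where R2: "R1 = add_mset {#h, h#} R2" by (meson multi_member_split)
    then have "MS X \<in># R2" using XX XR R1 by auto
    then obtain R' where "R2 = add_mset (MS X) R'" by (meson multi_member_split)
    then have R': "R = {#MS X, {#g, g#}, {#h, h#}#} + R'" using R1 R2 by (simp add: ac_simps)
    obtain Q where Q: "Q \<subseteq> X" "card Q = 2" "\<Sum>Q = g + h" using pair[OF gh] by blast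
    have c: "card (X - Q) = 2" "\<Sum>(X - Q) = g + h"
      using Q X by (simp_all add: card_Diff_subset sum_Diff_c2_4 zset_def)
    have n: "g \<notin> Q" "h \<notin> Q" "0 \<notin> Q" "0 \<notin> X - Q" using Q gh X by auto
    have z: "zset (insert g (insert h Q))" "zset (insert g (insert h (X - Q)))"
      using n Q c gh nz[OF gh(1)] nz[OF gh(2)] by (auto simp: zset_def ac_simps)
    have cc: "card (insert g (insert h Q)) = 4" "card (insert g (insert h (X - Q))) = 4"
      using n Q c gh by simp_all
    \<comment> \<open>A third copy of \<open>X\<close> would be one too many: the five atoms X, X,
      X, g^2, h^2 also factor into two 4-circuits through \<open>g\<close> and \<open>h\<close> and
      four squares.\<close>
    have "1 + (1 + card X) \<in> lens (MS (insert g (insert h Q)) + (MS (insert g (insert h (X - Q))) + (MS X + MS X)))"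
      using z cc X by (intro lens_plus lens_atom atom_MS lens_squares) auto
    also have "MS (insert g (insert h Q)) + (MS (insert g (insert h (X - Q))) + (MS X + MS X))
        = MS X + MS X + MS X + {#g, g#} + {#h, h#}"
    proof -
      have "MS X = MS Q + MS (X - Q)" using Q
        by (subst mset_set_Union[symmetric]) (auto intro!: arg_cong[of _ _ MS])
      then show ?thesis using n gh by simp
    qed
    finally have q6: "6 \<in> lens (\<Sum>\<^sub># {#MS X, MS X, MS X, {#g, g#}, {#h, h#}#})"
      using X by (simp add: ac_simps add_mset_commute)
    show False by (rule bad_subD[OF b(1) _ q6]) (simp_all add: b(2) R')
  qed
  then have "\<exists>g. Y = {#g, g#}" if "Y \<in># R" for Y using atoms[OF that] that by auto
  then obtain E where E: "\<Sum>\<^sub># R = E + E" "size E = size R" using double_of_squares by blast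
  have "A = \<Sum>\<^sub># F" using b(1) by (simp add: bad_def factorizes_def)
  then have "A = (MS X + E) + (MS X + E)" using E b(2) by (simp add: ac_simps)
  moreover have "size (MS X + E) = size F + 2" using E X b(2) by simp
  moreover have "affine_supp A"
  proof -
    obtain a b c where abc: "X = {a, b, c, a + b + c}" "a \<noteq> b" "a \<noteq> c" "b \<noteq> c"
      "a + b + c \<notin> {a, b, c}" using quad_elements[OF X] by blast
    have "0 \<notin> X" using X(1) by simp
    then have "a + b + c \<noteq> 0" "b \<noteq> 0" "c \<noteq> 0" "a \<noteq> 0" using abc(1) by auto
    have gout: "?out g" using supp[OF gh(1)] gh(3) by blast
    have sums: "g \<noteq> a + b" "g \<noteq> a + c" "g \<noteq> b + c"
      using gout[rule_format, of "{a, b}"] gout[rule_format, of "{a, c}"] gout[rule_format, of "{b, c}"] abc by auto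
    \<comment> \<open>The sums of evenly many of the independent elements a, b, c, g. Its nontrivial
      coset consists of the sums of oddly many.\<close>
    define N where "N = {0, a + b, a + c, b + c, a + g, g + b, g + c, a + (b + (c + g))}"
    have "a \<notin> N"
    proof
      assume "a \<in> N"
      then consider "a = 0" | "b = 0" | "c = 0" | "a = b + c" | "g = 0" | "a = g + b" | "a = g + c" | "b + (c + g) = 0"
        unfolding N_def by auto
      then show False
      proof cases
        case 4 then show False using \<open>a + b + c \<noteq> 0\<close> by (simp add: ac_simps)
      next
        case 6 then show False using sums by (simp add: ac_simps)
      next
        case 7 then show False using sums by (simp add: ac_simps)
      next
        case 8
        then have "g + (b + c) = 0" by (simp add: ac_simps)
        then show False using sums eq_iff_add_zero by blast
      qed (use nz gh \<open>a \<noteq> 0\<close> \<open>b \<noteq> 0\<close> \<open>c \<noteq> 0\<close> in auto)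
    qed
    moreover have "a + x \<in> N" if x: "x \<in># A" for x
    proof (cases "x \<in> X")
      case True then show ?thesis by (auto simp: abc(1) N_def ac_simps)
    next
      case False
      show ?thesis
      proof (cases "x = g")
        case True then show ?thesis by (simp add: N_def)
      next
        case False
        then obtain Q where "Q \<subseteq> X" "card Q = 2" "\<Sum>Q = g + x"
          using pair[OF gh(1) x gh(3) \<open>x \<notin> X\<close>] by auto
        then have "g + x = a + b \<or> g + x = a + c \<or> g + x = b + c" using pair_sums[OF abc(1)] by metis
        then have "x = g + (a + b) \<or> x = g + (a + c) \<or> x = g + (b + c)"
          by (metis add_self_left)
        then show ?thesis by (auto simp: N_def ac_simps)
      qed
    qed
    moreover have "0 \<in> N" by (simp add: N_def)
    moreover have "x + y \<in> N" if "x \<in> N" "y \<in> N" for x y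
      using that unfolding N_def by (elim insertE emptyE; simp add: ac_simps)
    ultimately show ?thesis unfolding affine_supp_def by blast
  qed
  ultimately show ?thesis by blast
qed


section \<open>Factorizations with the most squares\<close>

text \<open>Over sequences without \<open>0\<close>, the atoms of length 2 are the squares.\<close>

definition nsq :: "c2_4 multiset multiset \<Rightarrow> nat" where
  "nsq F = size {#Y \<in># F. size Y = 2#}"

lemma nsq_add [simp]: "nsq (F + G) = nsq F + nsq G" by (simp add: nsq_def)
lemma nsq_add_mset [simp]: "nsq (add_mset Y F) = (if size Y = 2 then Suc (nsq F) else nsq F)" by (simp add: nsq_def)
lemma nsq_empty [simp]: "nsq {#} = 0" by (simp add: nsq_def)
lemma nsq_le: "nsq F \<le> size F" by (simp add: nsq_def size_filter_mset_lesseq)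

text \<open>The first outcome does not mention \<open>n\<close>, while the second determines it from
  the size of \<open>A\<close>. So outside the theta case there is room for only one gap, which
  \<open>affine_gap\<close> exploits.\<close>

definition gap_conclusion :: "c2_4 multiset \<Rightarrow> nat \<Rightarrow> bool" where
  "gap_conclusion A n \<longleftrightarrow> theta_supp A \<or> (affine_supp A \<and> (\<exists>D. A = D + D \<and> size D = n + 2))"

text \<open>Intersecting circuits make length 3, or have an exceptional shape treated above, or are
  a 3-circuit meeting a 3-circuit or a 4-circuit in one element. The last kind trades for a square
  and a larger circuit, against the maximality of \<open>nsq\<close>.\<close>

lemma reduced_pair:
  assumes C: "zset C" "3 \<le> card C" and C': "zset C'" "card C' \<le> 5" "card C \<le> card C'"
    and b: "bad A F" "F = {#MS C, MS C'#} + R" "0 \<notin># A"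
    and max: "\<And>G. bad A G \<Longrightarrow> size G = size F \<Longrightarrow> nsq G \<le> nsq F"
    and ne: "C \<inter> C' \<noteq> {}"
  shows "gap_conclusion A (size F)"
proof (rule ccontr)
  assume nc: "\<not> gap_conclusion A (size F)"
  have no3: "3 \<notin> lens (MS C + MS C')" using bad_pairD[OF b(1,2)] by blast
  have Csub: "C = C'" if "C \<subseteq> C'" using zset_subset_cases[OF C'(1,2) that] C by (auto simp: zset_def)
  have neC: "card (C \<inter> C') \<noteq> card C" if "C \<noteq> C'"
  proof
    assume "card (C \<inter> C') = card C"
    then have "C \<inter> C' = C" by (intro card_subset_eq) auto
    then show False using that Csub by blast
  qed
  have le: "card (C \<inter> C') \<le> card C" by (intro card_mono) auto
  have pos: "card (C \<inter> C') \<noteq> 0" using ne by simp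
  have sd: "3 + 2 * card (C \<inter> C') \<le> card C + card C'" if "C \<noteq> C'"
    using zset_card_ge[OF zset_symdiff[OF C(1) C'(1)]] card_symdiff[of C C'] that by auto
  have swap: False if "bad A ({#Y, Z#} + R)" "size Y = 2" for Y Z
    using max[OF that(1)] that(2) b(2) C C' by (simp split: if_splits)
  consider "card C = 3" "card C' = 3" | "card C = 3" "card C' = 4" | "card C = 3" "card C' = 5"
    | "card C = 4" "card C' = 4" | "card C = 4" "card C' = 5" | "card C = 5" "card C' = 5"
  proof -
    have "card C \<in> {3, 4, 5}" "card C' \<in> {3, 4, 5}" using C(2) C'(2,3) by auto
    then show thesis using that C'(3) by auto
  qed
  then show False
  proof cases
    case 1
    show False
    proof (cases "C = C'")
      case True
      have "0 \<notin> C" using C by simp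
      then show False using lens_squares[of C] no3 1 True by simp
    next
      case False
      have "card (C \<inter> C') = 1" using sd[OF False] pos 1 by linarith
      then obtain s where s: "C \<inter> C' = {s}" by (auto simp: card_1_singleton_iff)
      let ?V = "C - C' \<union> (C' - C)"
      have V: "zset ?V" "card ?V = 4" using zset_symdiff[OF C(1) C'(1)] card_symdiff[of C C'] 1 s by simp_all
      have "s \<in> C" using s by auto
      then have "s \<noteq> 0" using C(1) by auto
      have "?V \<noteq> {}" using V(2) by (metis card.empty zero_neq_numeral)
      have "MS C + MS C' = {#s, s#} + MS ?V" using MS_add[of C C'] s by simp
      from bad_swap[OF b(1,2) this atom_square[OF \<open>s \<noteq> 0\<close>] atom_MS[OF V(1) \<open>?V \<noteq> {}\<close>]] V(2)
      show False using swap[of "{#s, s#}"] by simp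
    qed
  next
    case 2
    then have "C \<noteq> C'" by auto
    from sd[OF this] have "card (C \<inter> C') \<noteq> 3" using 2 by simp
    moreover have "card (C \<inter> C') \<noteq> 2" using pair_34[OF C(1) 2(1) C'(1) 2(2)] no3 by blast
    ultimately have "card (C \<inter> C') = 1" using pos le 2(1) by linarith
    then have "card (C' \<inter> C) = 1" by (simp only: Int_commute)
    moreover have "F = {#MS C', MS C#} + R" using b(2) by (simp add: add_mset_commute)
    ultimately obtain s V where sV: "bad A ({#{#s, s#}, MS V#} + R)"
      using quad_line_swap[OF C'(1) 2(2) C(1) 2(1) _ b(1)] by metis
    show False by (rule swap[OF sV]) simp
  next
    case 3
    then show False using pair_35[OF C(1) 3(1) C'(1) 3(2) ne] no3 by blast
  next
    case 4
    show False
    proof (cases "C = C'")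
      case True
      then have "F = {#MS C, MS C#} + R" using b(2) by simp
      then show False
        using double_quad_conclusion[OF C(1) 4(1) b(1) _ b(3)] nc by (auto simp: gap_conclusion_def)
    next
      case False
      then show False using pair_44[OF C(1) 4(1) C'(1) 4(2) False ne] no3 by blast
    qed
  next
    case 5
    show False
    proof (cases "card (C \<inter> C') = 3")
      case True
      then have "theta C C'" using C C' 5 by (simp add: theta_def)
      then show False using theta_support[OF _ b] nc by (auto simp: gap_conclusion_def theta_supp_def)
    next
      case False
      then show False using pair_45[OF C(1) 5(1) C'(1) 5(2) False] no3 by blast
    qed
  next
    case 6
    show False
    proof (cases "C = C'")
      case True
      then have "F = {#MS C, MS C#} + R" using b(2) by simp
      then show False
        using double_quint_support[OF C(1) 6(1) b(1) _ b(3)] nc by (auto simp: gap_conclusion_def theta_supp_def)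
    next
      case False
      then show False using pair_55[OF C(1) 6(1) C'(1) 6(2) False] no3 by blast
    qed
  qed
qed

lemma count_sum_le_one:
  assumes "\<And>Y. Y \<in># M \<Longrightarrow> count Y x \<le> 1" "\<And>Y Z M'. M = {#Y, Z#} + M' \<Longrightarrow> x \<in># Y \<Longrightarrow> x \<notin># Z"
  shows "count (\<Sum>\<^sub># M) x \<le> 1"
  using assms
proof (induction M)
  case (add Y M)
  show ?case
  proof (cases "x \<in># Y")
    case True
    have "x \<notin># Z" if Z: "Z \<in># M" for Z
    proof -
      obtain M' where "M = add_mset Z M'" using Z by (meson multi_member_split)
      then show ?thesis using add.prems(2)[of Y Z M'] True by simp
    qed
    then have "x \<notin># \<Sum>\<^sub># M" by auto
    then have "count (\<Sum>\<^sub># M) x = 0" by (rule not_in_iff[THEN iffD1])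
    then show ?thesis using add.prems(1)[of Y] by simp
  next
    case False
    have "count (\<Sum>\<^sub># M) x \<le> 1"
    proof (rule add.IH)
      show "count Z x \<le> 1" if "Z \<in># M" for Z using add.prems(1)[of Z] that by simp
      show "x \<notin># Z" if "M = {#Y', Z#} + M'" "x \<in># Y'" for Y' Z M'
        using add.prems(2)[of Y' Z "add_mset Y M'"] that by (simp add: add_mset_commute)
    qed
    then show ?thesis using False by (simp add: not_in_iff)
  qed
qed simp

lemma atom_size_cases:
  assumes "zero_sum_atom Y" "0 \<notin># (Y :: c2_4 multiset)"
  obtains (square) g where "g \<noteq> 0" "Y = {#g, g#}" "size Y = 2"
    | (set) C where "zset C" "3 \<le> card C" "card C \<le> 5" "Y = MS C" "size Y \<noteq> 2"
  using assms(1)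
proof (cases rule: atom_cases)
  case zero then show thesis using assms(2) by simp
next
  case (square g) then show thesis using that(1)[of g] by simp
next
  case (set C) then show thesis using that(2)[of C] by simp
qed

text \<open>By \<open>reduced_pair\<close> the circuits of \<open>F\<close> are pairwise disjoint,
  so their product \<open>S\<close> is squarefree. This is what makes \<open>S\<close> recoverable
  from \<open>A\<close>.\<close>

lemma reduced_structure:
  assumes b: "bad A F" "0 \<notin># A"
    and max: "\<And>G. bad A G \<Longrightarrow> size G = size F \<Longrightarrow> nsq G \<le> nsq F"
    and nc: "\<not> gap_conclusion A (size F)"
  obtains E S where "A = E + E + S" "size E = nsq F" "\<forall>x. count S x \<le> 1"
    "S = \<Sum>\<^sub># {#Y \<in># F. size Y \<noteq> 2#}" "3 * (size F - nsq F) \<le> size S" "size S \<le> 5 * (size F - nsq F)"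
proof -
  let ?P = "{#Y \<in># F. size Y = 2#}" and ?Q = "{#Y \<in># F. size Y \<noteq> 2#}"
  have at: "zero_sum_atom Y" "0 \<notin># Y" if "Y \<in># F" for Y
    using b that by (auto simp: bad_def factorizes_def)
  have F: "F = ?P + ?Q" by simp
  have FS: "\<Sum>\<^sub># F = \<Sum>\<^sub># ?P + \<Sum>\<^sub># ?Q" by (subst F) (rule sum_mset.union)
  have Fs: "size F = size ?P + size ?Q" by (subst F) (rule size_union)
  have "\<exists>g. Y = {#g, g#}" if "Y \<in># ?P" for Y
  proof -
    have "Y \<in># F" "size Y = 2" using that by auto
    with at[OF this(1)] show ?thesis by (cases rule: atom_size_cases) auto
  qed
  then obtain E where E: "\<Sum>\<^sub># ?P = E + E" "size E = size ?P" using double_of_squares by blast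
  define S where "S = \<Sum>\<^sub># ?Q"
  have Q: "\<exists>C. zset C \<and> 3 \<le> card C \<and> card C \<le> 5 \<and> Y = MS C" if "Y \<in># ?Q" for Y
  proof -
    have "Y \<in># F" "size Y \<noteq> 2" using that by auto
    with at[OF this(1)] show ?thesis by (cases rule: atom_size_cases) auto
  qed
  have "A = \<Sum>\<^sub># F" using b by (simp add: bad_def factorizes_def)
  then have A: "A = E + E + S" using E(1) FS by (simp only: S_def)
  have count: "count S x \<le> 1" for x unfolding S_def
  proof (rule count_sum_le_one)
    show "count Y x \<le> 1" if "Y \<in># ?Q" for Y using Q[OF that] by (auto simp: count_mset_set')
    show "x \<notin># Z" if eq: "?Q = {#Y, Z#} + M'" and x: "x \<in># Y" for Y Z M'
    proof
      assume xZ: "x \<in># Z"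
      have "Y \<in># ?Q" "Z \<in># ?Q" unfolding eq by simp_all
      then obtain C C' where C: "zset C" "3 \<le> card C" "card C \<le> 5" "Y = MS C"
        and C': "zset C'" "3 \<le> card C'" "card C' \<le> 5" "Z = MS C'"
        using Q[of Y] Q[of Z] by blast
      have int: "C \<inter> C' \<noteq> {}" "C' \<inter> C \<noteq> {}" using x xZ C C' by auto
      have "F = ?Q + ?P" by (subst add.commute) (rule F)
      also have "\<dots> = {#Y, Z#} + (M' + ?P)" by (simp only: eq union_assoc)
      finally have FYZ: "F = {#Y, Z#} + (M' + ?P)" .
      have F1: "F = {#MS C, MS C'#} + (M' + ?P)" "F = {#MS C', MS C#} + (M' + ?P)"
        using FYZ C(4) C'(4) by (simp_all only: add_mset_commute)
      have "gap_conclusion A (size F)"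
      proof (cases "card C \<le> card C'")
        case True
        from reduced_pair[OF C(1,2) C'(1,3) True b(1) F1(1) b(2) max int(1)] show ?thesis .
      next
        case False
        then have "card C' \<le> card C" by simp
        from reduced_pair[OF C'(1,2) C(1,3) this b(1) F1(2) b(2) max int(2)] show ?thesis .
      qed
      then show False using nc by simp
    qed
  qed
  have "3 * size M \<le> size (\<Sum>\<^sub># M) \<and> size (\<Sum>\<^sub># M) \<le> 5 * size M"
    if "\<And>Y. Y \<in># M \<Longrightarrow> \<exists>C. zset C \<and> 3 \<le> card C \<and> card C \<le> 5 \<and> Y = MS C" for M
    using that
  proof (induction M)
    case (add Y M)
    then have "3 * size M \<le> size (\<Sum>\<^sub># M) \<and> size (\<Sum>\<^sub># M) \<le> 5 * size M" by simp
    moreover have "3 \<le> size Y" "size Y \<le> 5" using add.prems[of Y] by auto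
    ultimately show ?case by simp
  qed simp
  from this[of ?Q] Q have "3 * size ?Q \<le> size S" "size S \<le> 5 * size ?Q" by (auto simp: S_def)
  moreover have "size ?Q = size F - nsq F" using Fs by (simp add: nsq_def)
  ultimately show thesis using that[OF A _ _ S_def] count E(2) by (simp add: nsq_def)
qed

lemma ex_max_nsq:
  assumes "bad A F"
  obtains G where "bad A G" "size G = size F" "\<And>H. bad A H \<Longrightarrow> size H = size G \<Longrightarrow> nsq H \<le> nsq G"
proof -
  have "\<exists>G. (bad A G \<and> size G = size F) \<and> (\<forall>H. bad A H \<and> size H = size F \<longrightarrow> nsq H \<le> nsq G)"
  proof (rule ex_has_greatest_nat[of _ F nsq "Suc (size F)"])
    show "\<forall>G. bad A G \<and> size G = size F \<longrightarrow> nsq G < Suc (size F)" using nsq_le by (metis le_imp_less_Suc)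
  qed (use assms in auto)
  then show thesis using that by metis
qed

lemma lens_bounded: "0 \<notin># A \<Longrightarrow> n \<in> lens A \<Longrightarrow> 2 * n \<le> size A \<and> size A \<le> 5 * n"
  using factorizes_size by (auto simp: lens_def)

lemma lens_double: "0 \<notin># D \<Longrightarrow> size D \<in> lens (D + D)"
proof (induction D)
  case (add x D)
  then have "1 + size D \<in> lens ({#x, x#} + (D + D))"
    by (intro lens_plus lens_atom atom_square) auto
  then show ?case by simp
qed (auto simp: lens_def intro: exI[of _ "{#}"])

lemma gap_theorem:
  assumes A: "0 \<notin># A" and n: "n \<in> lens A" "Suc n \<notin> lens A" and k: "k \<in> lens A" "n < k"
  shows "gap_conclusion A n"
proof (rule ccontr)
  assume nc: "\<not> gap_conclusion A n"
  have "finite (lens A)"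
    by (rule finite_subset[of _ "{..size A}"]) (auto dest!: lens_bounded[OF A])
  define M where "M = Max (lens A)"
  have M: "M \<in> lens A" "\<And>l. l \<in> lens A \<Longrightarrow> l \<le> M"
    using \<open>finite (lens A)\<close> n by (auto simp: M_def intro: Max_in)
  have "Suc M \<notin> lens A" using M(2) by force
  have nM: "n + 2 \<le> M" using M(2)[OF k(1)] k(2) n(2) M(1) by (cases "M = Suc n") auto
  obtain F0 where "factorizes A F0" "size F0 = n" using n by (auto simp: lens_def)
  then have "bad A F0" using n by (simp add: bad_def)
  then obtain F where F: "bad A F" "size F = n" "\<And>H. bad A H \<Longrightarrow> size H = size F \<Longrightarrow> nsq H \<le> nsq F"
    using ex_max_nsq \<open>size F0 = n\<close> by metis
  obtain G0 where "factorizes A G0" "size G0 = M" using M by (auto simp: lens_def)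
  then have "bad A G0" using \<open>Suc M \<notin> lens A\<close> by (simp add: bad_def)
  then obtain G where G: "bad A G" "size G = M" "\<And>H. bad A H \<Longrightarrow> size H = size G \<Longrightarrow> nsq H \<le> nsq G"
    using ex_max_nsq \<open>size G0 = M\<close> by metis
  \<comment> \<open>At the maximal length \<open>M\<close> the affine outcome is absurd, as it would
    provide a factorization into \<open>M + 2\<close> squares.\<close>
  have ncG: "\<not> gap_conclusion A (size G)"
  proof
    assume "gap_conclusion A (size G)"
    then obtain D where D: "A = D + D" "size D = M + 2" using nc G(2) by (auto simp: gap_conclusion_def)
    then have "M + 2 \<in> lens A" using lens_double[of D] A by auto
    then show False using M(2) by force
  qed
  have ncF: "\<not> gap_conclusion A (size F)" using nc F(2) by simp
  obtain E S where ES: "A = E + E + S" "size E = nsq F" "\<forall>x. count S x \<le> 1"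
    "S = \<Sum>\<^sub># {#Y \<in># F. size Y \<noteq> 2#}" "3 * (size F - nsq F) \<le> size S" "size S \<le> 5 * (size F - nsq F)"
    by (rule reduced_structure[OF F(1) A F(3) ncF])
  obtain E' S' where ES': "A = E' + E' + S'" "size E' = nsq G" "\<forall>x. count S' x \<le> 1"
    "S' = \<Sum>\<^sub># {#Y \<in># G. size Y \<noteq> 2#}" "3 * (size G - nsq G) \<le> size S'" "size S' \<le> 5 * (size G - nsq G)"
    by (rule reduced_structure[OF G(1) A G(3) ncG])
  \<comment> \<open>Both are the set of elements of odd multiplicity in \<open>A\<close>.\<close>
  have SS: "S = S'"
  proof (rule multiset_eqI)
    fix x
    have "count (E + E + S) x = count (E' + E' + S') x" using ES(1) ES'(1) by simp
    then have "2 * count E x + count S x = 2 * count E' x + count S' x" by simp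
    then show "count S x = count S' x" using ES(3)[rule_format, of x] ES'(3)[rule_format, of x] by presburger
  qed
  have "size (E + E + S) = size (E' + E' + S')" using ES(1) ES'(1) by simp
  then have "nsq F = nsq G" using SS ES(2) ES'(2) by simp
  moreover have "size S \<le> 15"
  proof -
    have "S = MS (set_mset S)" using ES(3) by (intro mset_eq_MS) blast
    then have "size S = card (set_mset S)" by (metis size_mset_set)
    also have "\<dots> \<le> card (UNIV - {0 :: c2_4})" using A ES(1) by (intro card_mono) auto
    also have "\<dots> = 15" using card_c2_4 by (subst card_Diff_subset) (simp_all only: finite subset_UNIV, simp)
    finally show ?thesis .
  qed
  moreover have "size F - nsq F + 2 \<le> size G - nsq G"
    using nM F(2) G(2) \<open>nsq F = nsq G\<close> nsq_le[of F] nsq_le[of G] by linarith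
  moreover have "3 * (size G - nsq G) \<le> size S" using ES'(5) SS by simp
  \<comment> \<open>From 3(p + 2) \<le> 3r \<le> s \<le> 5p one gets p \<ge> 3, while 3r \<le> 15
    gives r \<le> 5 and so p \<le> 3.\<close>
  moreover have "p = 3 \<and> s = 15" if "s \<le> 15" "p + 2 \<le> r" "3 * r \<le> s" "s \<le> 5 * p" for p r s :: nat
    using that by linarith
  ultimately have sz: "size F - nsq F = 3" "size S = 15" using ES(6) by blast+
  define Q where "Q = {#Y \<in># F. size Y \<noteq> 2#}"
  have FQ: "F = {#Y \<in># F. size Y = 2#} + Q" by (simp add: Q_def)
  have "size F = nsq F + size Q" unfolding nsq_def by (subst FQ) (rule size_union)
  then have "size Q = 3" using sz(1) by simp
  then have "size Q = Suc 2" by simp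
  then obtain Y Q1 where Q1: "Q = add_mset Y Q1" by (blast dest: size_eq_Suc_imp_eq_union)
  then have "size Q1 = Suc 1" using \<open>size Q = 3\<close> by simp
  then obtain Z Q2 where Q2: "Q1 = add_mset Z Q2" by (blast dest: size_eq_Suc_imp_eq_union)
  then have "size Q2 = 1" using \<open>size Q1 = Suc 1\<close> by simp
  then obtain W where "Q2 = {#W#}" by (blast dest: size_1_singleton_mset)
  then have YZW: "Q = {#Y, Z, W#}" using Q1 Q2 by simp
  have mem: "\<exists>C. zset C \<and> card C \<le> 5 \<and> V = MS C" if "V \<in># Q" for V
  proof -
    have V: "V \<in># F" "size V \<noteq> 2" using that by (auto simp: Q_def)
    have "zero_sum_atom V" "0 \<notin># V" using F(1) A V(1) by (auto simp: bad_def factorizes_def)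
    then show ?thesis using V(2) by (cases rule: atom_size_cases) auto
  qed
  obtain C1 C2 C3 where C: "zset C1" "card C1 \<le> 5" "Y = MS C1" "zset C2" "card C2 \<le> 5" "Z = MS C2"
    "zset C3" "card C3 \<le> 5" "W = MS C3"
    using mem[of Y] mem[of Z] mem[of W] YZW by auto
  have S: "S = Y + Z + W" using ES(4) YZW by (simp add: Q_def[symmetric] ac_simps)
  then have "card C1 + card C2 + card C3 = 15" using sz(2) C by simp
  then have c5: "card C1 = 5" "card C2 = 5" using C by linarith+
  \<comment> \<open>Three circuits with 15 elements in total are all 5-circuits; equal ones would
    give \<open>S\<close> a repeated element, and distinct ones fall under
    \<open>pair_55\<close>.\<close>
  have "C1 \<noteq> C2"
  proof
    assume eq: "C1 = C2"
    have "C1 \<noteq> {}" using c5(1) by auto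
    then obtain x where "x \<in> C1" by blast
    then have "count S x \<ge> 2" using S C eq by simp
    then show False using ES(3)[rule_format, of x] by simp
  qed
  then have "3 \<in> lens (Y + Z)" using pair_55[OF C(1) c5(1) C(4) c5(2)] C by simp
  moreover have "F = {#Y, Z#} + ({#W#} + {#Y \<in># F. size Y = 2#})"
    by (subst FQ) (simp add: YZW ac_simps)
  ultimately show False using bad_pairD[OF F(1)] by blast
qed


section \<open>Sequences supported on a theta graph\<close>

definition mset_of_count :: "(c2_4 \<Rightarrow> nat) \<Rightarrow> c2_4 multiset" where
  "mset_of_count f = (\<Sum>x\<in>UNIV. replicate_mset (f x) x)"

lemma count_mset_of_count [simp]: "count (mset_of_count f) x = f x"
  by (simp add: mset_of_count_def count_sum if_distrib[of "\<lambda>g. g _"] cong: if_cong)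

lemma eq_plus_double: "even (m - k) \<Longrightarrow> k \<le> m \<Longrightarrow> m = k + ((m - k) div 2 + (m - k) div (2 :: nat))"
  by presburger

lemma sum_mset_repeat: "\<Sum>\<^sub># (repeat_mset n B) = (if even n then 0 else (\<Sum>\<^sub># B :: c2_4))"
proof (induction n)
  case (Suc n)
  have "repeat_mset (Suc n) B = B + repeat_mset n B" by (rule multiset_eqI) simp
  then show ?case using Suc by simp
qed simp

lemma sum_mset_parity: "\<Sum>\<^sub># A = \<Sum>{x :: c2_4. odd (count A x)}"
proof -
  let ?E = "mset_of_count (\<lambda>x. count A x div 2)"
  have "A = ?E + ?E + MS {x. odd (count A x)}"
  proof (rule multiset_eqI)
    fix x show "count A x = count (?E + ?E + MS {x. odd (count A x)}) x"
      by (simp add: count_mset_set') presburger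
  qed
  then have "\<Sum>\<^sub># A = \<Sum>\<^sub># (?E + ?E) + \<Sum>\<^sub># (MS {x. odd (count A x)})" by (metis sum_mset.union)
  then show ?thesis by simp
qed

text \<open>Taking the symmetric difference with \<open>X\<close>, if necessary, removes the only
  element outside \<open>U\<close>; within \<open>U\<close> just the empty set and \<open>U\<close>
  are zero-sum.\<close>

lemma theta_zset_subset:
  assumes "theta X U" "zset C" "C \<subseteq> X \<union> U"
  shows "C = {} \<or> C = U \<or> C = X \<or> C = X - U \<union> (U - X)"
proof -
  note t = assms(1)[unfolded theta_def]
  have "card (X - U) = 1" using t by (simp add: card_Diff_subset_Int)
  then obtain s where s: "X - U = {s}" by (auto simp: card_1_singleton_iff)
  have sub: "D = {} \<or> D = U" if "zset D" "D \<subseteq> U" for D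
    using zset_subset_cases[of U D] t that by (auto simp: zset_def)
  show ?thesis
  proof (cases "s \<in> C")
    case False
    then have "C \<subseteq> U" using assms(3) s by auto
    then show ?thesis using sub assms(2) by blast
  next
    case True
    let ?D = "C - X \<union> (X - C)"
    have "zset ?D" using zset_symdiff assms(2) t by simp
    moreover have "?D \<subseteq> U" using assms(3) s True by auto
    ultimately have "?D = {} \<or> ?D = U" by (rule sub)
    then show ?thesis
    proof
      assume "?D = {}" then show ?thesis by auto
    next
      assume D: "?D = U"
      have "x \<in> C \<longleftrightarrow> x \<in> X - U \<union> (U - X)" for x using D by blast
      then show ?thesis by blast
    qed
  qed
qed

text \<open>With \<open>a\<close>, \<open>b\<close>, \<open>c\<close> the multiplicities of the circuits of cardinality 5, 4, 3 of a theta graph,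
  and \<open>P\<close>, \<open>S\<close>, \<open>Q\<close> the least multiplicities along its three paths of 3, 1, 2 elements.\<close>

definition feas :: "nat \<Rightarrow> nat \<Rightarrow> nat \<Rightarrow> nat \<Rightarrow> nat \<Rightarrow> nat \<Rightarrow> bool" where
  "feas P S Q a b c \<longleftrightarrow> a + b \<le> P \<and> b + c \<le> S \<and> a + c \<le> Q \<and>
     even (P + a + b) \<and> even (S + b + c) \<and> even (Q + a + c)"

text \<open>The equation arises by eliminating the number n of squares from l = a + b + c + n and
  from the size 3P + 2Q + S + 2y = 5a + 4b + 3c + 2n. Thus lengths are governed by the weight 3a +
  2b + c.\<close>

definition theta_lens :: "nat \<Rightarrow> nat \<Rightarrow> nat \<Rightarrow> nat \<Rightarrow> nat set" where
  "theta_lens P S Q y = {l. \<exists>a b c. feas P S Q a b c \<and> 2 * l + (3 * a + 2 * b + c) = 3 * P + 2 * Q + S + 2 * y}"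

definition theta_mset :: "c2_4 set \<Rightarrow> c2_4 set \<Rightarrow> nat \<Rightarrow> nat \<Rightarrow> nat \<Rightarrow> c2_4 multiset" where
  "theta_mset X U P S Q = repeat_mset P (MS (X \<inter> U)) + repeat_mset S (MS (X - U)) + repeat_mset Q (MS (U - X))"

lemma theta_third:
  assumes "theta X U"
  shows "zset (X - U \<union> (U - X))" "card (X - U \<union> (U - X)) = 3"
    "card (X - U) = 1" "card (U - X) = 2" "0 \<notin> X \<union> U"
  using zset_symdiff[of X U] card_symdiff[of X U] assms
  by (auto simp: theta_def card_Diff_subset_Int Int_commute)

lemma theta_factorization_shape:
  assumes t: "theta X U" and "set_mset A \<subseteq> X \<union> U" and F: "factorizes A F"
  shows "\<exists>a b c D. size F = a + b + c + size D \<and> 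
    A = repeat_mset a (MS U) + repeat_mset b (MS X) + repeat_mset c (MS (X - U \<union> (U - X))) + (D + D)"
proof -
  let ?W = "X - U \<union> (U - X)"
  have "\<exists>a b c D. size F = a + b + c + size D \<and> 
    \<Sum>\<^sub># F = repeat_mset a (MS U) + repeat_mset b (MS X) + repeat_mset c (MS ?W) + (D + D)"
    if "\<forall>Y\<in>#F. Y = MS U \<or> Y = MS X \<or> Y = MS ?W \<or> (\<exists>g. Y = {#g, g#})" for F
    using that
  proof (induction F)
    case empty
    show ?case by (intro exI[of _ 0] exI[of _ "{#}"]) simp
  next
    case (add Y F)
    then obtain a b c D where IH: "size F = a + b + c + size D"
      "\<Sum>\<^sub># F = repeat_mset a (MS U) + repeat_mset b (MS X) + repeat_mset c (MS ?W) + (D + D)" by auto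
    have R: "repeat_mset (Suc n) B = B + repeat_mset n B" for n and B :: "c2_4 multiset"
      by (rule multiset_eqI) simp
    from add.prems consider "Y = MS U" | "Y = MS X" | "Y = MS ?W" | g where "Y = {#g, g#}" by auto
    then show ?case
    proof cases
      case 1
      show ?thesis by (rule exI[of _ "Suc a"], rule exI[of _ b], rule exI[of _ c], rule exI[of _ D])
          (simp add: IH 1 R ac_simps)
    next
      case 2
      show ?thesis by (rule exI[of _ a], rule exI[of _ "Suc b"], rule exI[of _ c], rule exI[of _ D])
          (simp add: IH 2 R ac_simps)
    next
      case 3
      show ?thesis by (rule exI[of _ a], rule exI[of _ b], rule exI[of _ "Suc c"], rule exI[of _ D])
          (simp add: IH 3 R ac_simps)
    next
      case 4
      show ?thesis by (rule exI[of _ a], rule exI[of _ b], rule exI[of _ c], rule exI[of _ "add_mset g D"])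
          (simp add: IH 4 ac_simps)
    qed
  qed
  moreover have "\<forall>Y\<in>#F. Y = MS U \<or> Y = MS X \<or> Y = MS ?W \<or> (\<exists>g. Y = {#g, g#})"
  proof
    fix Y assume Y: "Y \<in># F"
    have sub: "set_mset Y \<subseteq> X \<union> U" using supp_factorizes[OF F] Y assms(2) by blast
    then have "0 \<notin># Y" using theta_third(5)[OF t] by blast
    have "zero_sum_atom Y" using F Y by (simp add: factorizes_def)
    from this \<open>0 \<notin># Y\<close> show "Y = MS U \<or> Y = MS X \<or> Y = MS ?W \<or> (\<exists>g. Y = {#g, g#})"
    proof (cases rule: atom_size_cases)
      case (set C)
      have "C \<noteq> {}" using set(2) by auto
      then show ?thesis using theta_zset_subset[OF t set(1)] sub set(4) by auto
    qed auto
  qed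
  ultimately show ?thesis using F by (auto simp: factorizes_def)
qed

lemma lens_repeat: "k \<in> lens B \<Longrightarrow> n * k \<in> lens (repeat_mset n B)"
proof (induction n)
  case 0
  show ?case by (auto simp: lens_def intro: exI[of _ "{#}"])
next
  case (Suc n)
  have "repeat_mset (Suc n) B = B + repeat_mset n B" by (rule multiset_eqI) simp
  then show ?case using lens_plus[OF Suc.prems Suc.IH[OF Suc.prems]] by simp
qed

text \<open>\<open>E\<close> holds the pairs in excess of the constant multiplicities. Since
  \<open>p\<close>, \<open>s\<close>, \<open>q\<close> carry no excess, counting them yields exactly
  the conditions in \<open>feas\<close>. Conversely, what the circuits leave over has even
  multiplicities and is filled with squares.\<close>

lemma theta_lens_formula:
  assumes t: "theta X U" and p: "p \<in> X \<inter> U" "p \<notin># E" and s: "s \<in> X - U" "s \<notin># E"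
    and q: "q \<in> U - X" "q \<notin># E" and E: "set_mset E \<subseteq> X \<union> U"
  shows "lens (theta_mset X U P S Q + (E + E)) = theta_lens P S Q (size E)"
proof -
  let ?A = "theta_mset X U P S Q + (E + E)"
  let ?W = "X - U \<union> (U - X)"
  let ?R = "\<lambda>a b c. repeat_mset a (MS U) + repeat_mset b (MS X) + repeat_mset c (MS ?W)"
  note t' = t[unfolded theta_def] and tt = theta_third[OF t]
  have XU: "X - U = {s}" using tt(3) s(1) by (metis card_1_singletonE singletonD)
  have size: "size ?A = 3 * P + 2 * Q + S + 2 * size E"
    using t' tt by (simp add: theta_mset_def)
  have cA: "count ?A x = (if x \<in> X \<inter> U then P else if x \<in> X - U then S else if x \<in> U - X then Q else 0) + 2 * count E x" for x
    by (auto simp: theta_mset_def count_mset_set')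
  have supp: "set_mset ?A \<subseteq> X \<union> U"
  proof
    fix x assume "x \<in># ?A"
    then have "count ?A x \<noteq> 0" by simp
    then show "x \<in> X \<union> U" using E unfolding cA by (auto simp: not_in_iff split: if_splits)
  qed
  have cR: "count (?R a b c) x = (if x \<in> X \<inter> U then a + b else if x \<in> X - U then b + c else if x \<in> U - X then a + c else 0)" for a b c x
    by (auto simp: count_mset_set')
  have sR: "size (?R a b c) = 5 * a + 4 * b + 3 * c" for a b c using t' tt by simp
  show ?thesis
  proof (intro set_eqI iffI)
    fix l assume "l \<in> lens ?A"
    then obtain F where F: "factorizes ?A F" "size F = l" by (auto simp: lens_def)
    obtain a b c D where D: "size F = a + b + c + size D" "?A = ?R a b c + (D + D)"
      using theta_factorization_shape[OF t supp F(1)] by blast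
    have c: "count ?A x = count (?R a b c) x + 2 * count D x" for x
      using arg_cong[OF D(2), of "\<lambda>M. count M x"] by simp
    have "P = a + b + 2 * count D p" using c[of p] p unfolding cA cR by (auto simp: not_in_iff)
    moreover have "S = b + c + 2 * count D s" using c[of s] s unfolding cA cR by (auto simp: not_in_iff)
    moreover have "Q = a + c + 2 * count D q" using c[of q] q unfolding cA cR by (auto simp: not_in_iff)
    ultimately have "feas P S Q a b c" by (auto simp: feas_def)
    moreover have "2 * l + (3 * a + 2 * b + c) = 3 * P + 2 * Q + S + 2 * size E"
      using arg_cong[OF D(2), of size] unfolding size size_union[of "?R a b c"] sR using D(1) F(2) by simp
    ultimately show "l \<in> theta_lens P S Q (size E)" by (auto simp: theta_lens_def)
  next
    fix l assume "l \<in> theta_lens P S Q (size E)"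
    then obtain a b c where f: "feas P S Q a b c" "2 * l + (3 * a + 2 * b + c) = 3 * P + 2 * Q + S + 2 * size E"
      by (auto simp: theta_lens_def)
    define D where "D = mset_of_count (\<lambda>x. (count ?A x - count (?R a b c) x) div 2)"
    have A: "?A = ?R a b c + (D + D)"
    proof (rule multiset_eqI)
      fix x
      have "even (count ?A x - count (?R a b c) x)" "count (?R a b c) x \<le> count ?A x"
        using f(1) unfolding cA cR feas_def by auto
      then have "count ?A x = count (?R a b c) x + (count D x + count D x)"
        unfolding D_def count_mset_of_count by (rule eq_plus_double)
      then show "count ?A x = count (?R a b c + (D + D)) x" by (simp only: count_union)
    qed
    have "0 \<notin># ?A" using supp tt(5) by blast
    then have "0 \<notin># D" using A by (metis Un_iff set_mset_union)
    have ne: "U \<noteq> {}" "X \<noteq> {}" "?W \<noteq> {}" using t' tt by auto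
    have "1 \<in> lens (MS U)" "1 \<in> lens (MS X)" "1 \<in> lens (MS ?W)"
      using t' tt ne by (auto intro!: lens_atom[unfolded One_nat_def] atom_MS)
    then have "a * 1 + b * 1 + c * 1 + size D \<in> lens (?R a b c + (D + D))"
      by (intro lens_plus lens_repeat lens_double \<open>0 \<notin># D\<close>)
    moreover have "a + b + c + size D = l"
      using arg_cong[OF A, of size] f(2) unfolding size size_union[of "?R a b c"] sR by simp
    ultimately show "l \<in> lens ?A" using A by simp
  qed
qed

text \<open>The elements of odd multiplicity form a zero-sum set, hence a union of whole paths. So
  the parity is constant along each path, and subtracting the least multiplicity on it leaves an
  even rest.\<close>

lemma theta_representation:
  assumes t: "theta X U" and A: "set_mset A \<subseteq> X \<union> U" "\<Sum>\<^sub># A = 0"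
  shows "\<exists>P S Q y. lens A = theta_lens P S Q y"
proof -
  note t' = t[unfolded theta_def] and tt = theta_third[OF t]
  obtain s where s: "X - U = {s}" using tt(3) by (auto simp: card_1_singleton_iff)
  have min: "\<exists>x\<in>Y. \<forall>z\<in>Y. count A x \<le> count A z" if "Y \<noteq> {}" for Y :: "c2_4 set"
  proof -
    have "Min (count A ` Y) \<in> count A ` Y" using that by (intro Min_in) auto
    then obtain x where x: "x \<in> Y" "count A x = Min (count A ` Y)" by auto
    show ?thesis using x(1) by (intro bexI[of _ x]) (simp_all add: x(2))
  qed
  have "X \<inter> U \<noteq> {}" "U - X \<noteq> {}" using t' tt(4) by (metis card.empty zero_neq_numeral)+
  then obtain p q where p: "p \<in> X \<inter> U" "\<And>z. z \<in> X \<inter> U \<Longrightarrow> count A p \<le> count A z"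
    and q: "q \<in> U - X" "\<And>z. z \<in> U - X \<Longrightarrow> count A q \<le> count A z"
    using min[of "X \<inter> U"] min[of "U - X"] by blast
  let ?T = "{x. odd (count A x)}"
  have "?T \<subseteq> X \<union> U"
  proof
    fix x assume "x \<in> ?T"
    then have "count A x \<noteq> 0" by (cases "count A x = 0") auto
    then show "x \<in> X \<union> U" using A(1) by (auto simp: not_in_iff[symmetric])
  qed
  moreover have "zset ?T" unfolding zset_def
    using sum_mset_parity[of A] A(2) calculation tt(5) by auto
  ultimately have T: "?T = {} \<or> ?T = U \<or> ?T = X \<or> ?T = X - U \<union> (U - X)"
    using theta_zset_subset[OF t] by blast
  have odd: "odd (count A x) \<longleftrightarrow> odd (count A y)" if "x \<in> Z" "y \<in> Z" "Z = X \<inter> U \<or> Z = U - X" for x y Z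
    using T that by blast
  let ?M = "theta_mset X U (count A p) (count A s) (count A q)"
  define E where "E = mset_of_count (\<lambda>x. (count A x - count ?M x) div 2)"
  have cM: "count ?M x = (if x \<in> X \<inter> U then count A p else if x \<in> X - U then count A s else if x \<in> U - X then count A q else 0)" for x
    by (auto simp: theta_mset_def count_mset_set')
  have AE: "A = ?M + (E + E)"
  proof (rule multiset_eqI)
    fix x
    consider "x \<in> X \<inter> U" | "x = s" | "x \<in> U - X" | "x \<notin> X \<union> U" using s by auto
    then have "even (count A x - count ?M x) \<and> count ?M x \<le> count A x"
    proof cases
      case 1 then show ?thesis unfolding cM using p odd[of x "X \<inter> U" p] by simp
    next
      case 2 then show ?thesis unfolding cM using s by auto
    next
      case 3 then show ?thesis unfolding cM using q odd[of x "U - X" q] by simp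
    next
      case 4
      then have "x \<notin># A" using A(1) by auto
      then show ?thesis unfolding cM using 4 by (auto simp: not_in_iff)
    qed
    then have "even (count A x - count ?M x)" "count ?M x \<le> count A x" by blast+
    then have "count A x = count ?M x + (count E x + count E x)"
      unfolding E_def count_mset_of_count by (rule eq_plus_double)
    then show "count A x = count (?M + (E + E)) x" by (simp only: count_union)
  qed
  have "set_mset E \<subseteq> X \<union> U" using A(1) AE by (metis le_sup_iff set_mset_union)
  moreover have "p \<notin># E" "s \<notin># E" "q \<notin># E"
    using p(1) q(1) s by (auto simp: E_def not_in_iff cM)
  moreover have "s \<in> X - U" using s by simp
  ultimately have "lens A = theta_lens (count A p) (count A s) (count A q) (size E)"
    using theta_lens_formula[OF t p(1) _ _ _ q(1)] AE by metis
  then show ?thesis by blast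
qed


section \<open>Closed forms for short paths, and steps of one in general\<close>

lemma theta_lensI:
  "feas P S Q a b c \<Longrightarrow> 2 * l + (3 * a + 2 * b + c) = 3 * P + 2 * Q + S + 2 * y \<Longrightarrow> l \<in> theta_lens P S Q y"
  by (auto simp: theta_lens_def)

lemma one_cases: "a + c \<le> 1 \<Longrightarrow> even (1 + a + c) \<Longrightarrow> a = 1 \<and> c = 0 \<or> a = 0 \<and> c = (1 :: nat)"
  by presburger

lemma even_diffE:
  assumes "a \<le> p" "even (p + a)" obtains i where "p = a + 2 * (i :: nat)"
  using assms by (metis dvdE even_diff_nat le_add_diff_inverse add.commute)

text \<open>Only the 5-circuit is available. Replacing two copies of it by five squares adds 3 to
  the length, starting from \<open>r\<close> copies at the minimum.\<close>

lemma theta_lens_S0: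
  assumes "r = min P Q" "even (P + Q)" "2 * m + 3 * r = 3 * P + 2 * Q + 2 * y"
  shows "theta_lens P 0 Q y = (\<lambda>i. m + 3 * i) ` {..r div 2}"
proof (intro set_eqI iffI)
  fix l assume "l \<in> theta_lens P 0 Q y"
  then obtain a where a: "a \<le> P" "a \<le> Q" "even (P + a)" "even (Q + a)" "2 * l + 3 * a = 3 * P + 2 * Q + 2 * y"
    by (auto simp: theta_lens_def feas_def)
  have "even (r + a)" "a \<le> r" using a assms(1) by (auto simp: min_def)
  then obtain i where i: "r = a + 2 * i" using even_diffE by metis
  then have "l = m + 3 * i" using a(5) assms(3) by simp
  then show "l \<in> (\<lambda>i. m + 3 * i) ` {..r div 2}" using i by auto
next
  fix l assume "l \<in> (\<lambda>i. m + 3 * i) ` {..r div 2}"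
  then obtain i where i: "l = m + 3 * i" "2 * i \<le> r" by auto
  have "feas P 0 Q (r - 2 * i) 0 0" using assms(1,2) i(2) by (auto simp: feas_def min_def)
  moreover have "2 * l + (3 * (r - 2 * i) + 2 * 0 + 0) = 3 * P + 2 * Q + 0 + 2 * y" using i assms(3) by simp
  ultimately show "l \<in> theta_lens P 0 Q y" by (rule theta_lensI)
qed

text \<open>Only the 4-circuit is available, and two copies of it trade for four squares.\<close>

lemma theta_lens_Q0:
  assumes "r = min P S" "even (P + S)" "2 * m + 2 * r = 3 * P + S + 2 * y"
  shows "theta_lens P S 0 y = (\<lambda>i. m + 2 * i) ` {..r div 2}"
proof (intro set_eqI iffI)
  fix l assume "l \<in> theta_lens P S 0 y"
  then obtain b where b: "b \<le> P" "b \<le> S" "even (P + b)" "even (S + b)" "2 * l + 2 * b = 3 * P + S + 2 * y"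
    by (auto simp: theta_lens_def feas_def)
  have "even (r + b)" "b \<le> r" using b assms(1) by (auto simp: min_def)
  then obtain i where i: "r = b + 2 * i" using even_diffE by metis
  then have "l = m + 2 * i" using b(5) assms(3) by simp
  then show "l \<in> (\<lambda>i. m + 2 * i) ` {..r div 2}" using i by auto
next
  fix l assume "l \<in> (\<lambda>i. m + 2 * i) ` {..r div 2}"
  then obtain i where i: "l = m + 2 * i" "2 * i \<le> r" by auto
  have "feas P S 0 0 (r - 2 * i) 0" using assms(1,2) i(2) by (auto simp: feas_def min_def)
  moreover have "2 * l + (3 * 0 + 2 * (r - 2 * i) + 0) = 3 * P + 2 * 0 + S + 2 * y" using i assms(3) by simp
  ultimately show "l \<in> theta_lens P S 0 y" by (rule theta_lensI)
qed

text \<open>Parity forces a + c = 1. The triples (1, b, 0) and (0, b + 1, 1) have equal weight, so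
  the second kind contributes one new length at most, by (0, 0, 1) when \<open>S\<close> is odd.
  This explains the bound \<open>(S + 1) div 2\<close>.\<close>

lemma theta_lens_Q1_less:
  assumes "S < P" "even (P + S + 1)" "2 * m + (3 + 2 * S) = 3 * P + 2 + S + 2 * y"
  shows "theta_lens P S 1 y = (\<lambda>i. m + 2 * i) ` {..(S + 1) div 2}"
proof (intro set_eqI iffI)
  fix l assume "l \<in> theta_lens P S 1 y"
  then obtain a b c where f: "feas P S 1 a b c" "2 * l + (3 * a + 2 * b + c) = 3 * P + 2 * 1 + S + 2 * y"
    by (auto simp: theta_lens_def)
  have "a = 1 \<and> c = 0 \<or> a = 0 \<and> c = 1" using f(1) by (intro one_cases) (simp_all add: feas_def)
  then show "l \<in> (\<lambda>i. m + 2 * i) ` {..(S + 1) div 2}"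
  proof
    assume ac: "a = 1 \<and> c = 0"
    then have b: "b \<le> S" "even (S + b)" using f(1) by (auto simp: feas_def)
    then obtain i where i: "S = b + 2 * i" using even_diffE by metis
    then have "l = m + 2 * i" using ac f(2) assms(3) by simp
    then show ?thesis using i by (intro image_eqI[of _ _ i]) auto
  next
    assume ac: "a = 0 \<and> c = 1"
    then have b: "b + 1 \<le> S" "even (S + b + 1)" using f(1) by (auto simp: feas_def)
    then obtain i where i: "S = b + 1 + 2 * i" using even_diffE[of "b + 1" S] by (simp add: add.assoc) blast
    then have "l = m + 2 * (i + 1)" using ac f(2) assms(3) by simp
    then show ?thesis using i by (intro image_eqI[of _ _ "i + 1"]) auto
  qed
next
  fix l assume "l \<in> (\<lambda>i. m + 2 * i) ` {..(S + 1) div 2}"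
  then obtain i where i: "l = m + 2 * i" "2 * i \<le> S + 1" by auto
  show "l \<in> theta_lens P S 1 y"
  proof (cases "2 * i \<le> S")
    case True
    then have "feas P S 1 1 (S - 2 * i) 0" using assms(1,2) by (auto simp: feas_def)
    moreover have "2 * l + (3 * 1 + 2 * (S - 2 * i) + 0) = 3 * P + 2 * 1 + S + 2 * y" using i True assms(3) by simp
    ultimately show ?thesis by (rule theta_lensI)
  next
    case False
    then have S: "S = 2 * i - 1" "i \<ge> 1" using i by auto
    then have "feas P S 1 0 0 1" using assms(1,2) by (auto simp: feas_def)
    moreover have "2 * l + (3 * 0 + 2 * 0 + 1) = 3 * P + 2 * 1 + S + 2 * y" using i S assms(3) by simp
    ultimately show ?thesis by (rule theta_lensI)
  qed
qed

text \<open>Now (0, b + 1, 1) is feasible whenever (1, b, 0) is, so the triples with c = 1 give all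
  lengths.\<close>

lemma theta_lens_Q1_greater:
  assumes "P < S" "even (P + S + 1)" "2 * m + (1 + 2 * P) = 3 * P + 2 + S + 2 * y"
  shows "theta_lens P S 1 y = (\<lambda>i. m + 2 * i) ` {..P div 2}"
proof (intro set_eqI iffI)
  fix l assume "l \<in> theta_lens P S 1 y"
  then obtain a b c where f: "feas P S 1 a b c" "2 * l + (3 * a + 2 * b + c) = 3 * P + 2 * 1 + S + 2 * y"
    by (auto simp: theta_lens_def)
  have "a = 1 \<and> c = 0 \<or> a = 0 \<and> c = 1" using f(1) by (intro one_cases) (simp_all add: feas_def)
  then show "l \<in> (\<lambda>i. m + 2 * i) ` {..P div 2}"
  proof
    assume ac: "a = 1 \<and> c = 0"
    then have b: "b + 1 \<le> P" "even (P + b + 1)" using f(1) by (auto simp: feas_def)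
    then obtain i where i: "P = b + 1 + 2 * i" using even_diffE[of "b + 1" P] by (simp add: add.assoc) blast
    then have "l = m + 2 * i" using ac f(2) assms(3) by simp
    then show ?thesis using i by (intro image_eqI[of _ _ i]) auto
  next
    assume ac: "a = 0 \<and> c = 1"
    then have b: "b \<le> P" "even (P + b)" using f(1) by (auto simp: feas_def)
    then obtain i where i: "P = b + 2 * i" using even_diffE by metis
    then have "l = m + 2 * i" using ac f(2) assms(3) by simp
    then show ?thesis using i by (intro image_eqI[of _ _ i]) auto
  qed
next
  fix l assume "l \<in> (\<lambda>i. m + 2 * i) ` {..P div 2}"
  then obtain i where i: "l = m + 2 * i" "2 * i \<le> P" by auto
  then have "feas P S 1 0 (P - 2 * i) 1" using assms(1,2) by (auto simp: feas_def)
  moreover have "2 * l + (3 * 0 + 2 * (P - 2 * i) + 1) = 3 * P + 2 * 1 + S + 2 * y" using i assms(3) by simp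
  ultimately show "l \<in> theta_lens P S 1 y" by (rule theta_lensI)
qed

text \<open>Parity forces b + c = 1. With c = 1 the value of a runs down from \<open>P\<close>, with
  b = 1 from \<open>P - 1\<close>, in steps of two; the weights 3P + 1 and 3(P - 1) + 2 differ by 2,
  which offsets the second progression by 1.\<close>

lemma theta_lens_S1_less:
  assumes "P < Q" "odd (P + Q)" "m = Q + y"
  shows "theta_lens P 1 Q y = {l. \<exists>i. 2 * i \<le> P \<and> l = m + 3 * i \<or> 2 * i + 1 \<le> P \<and> l = m + 1 + 3 * i}"
proof (intro set_eqI iffI)
  fix l assume "l \<in> theta_lens P 1 Q y"
  then obtain a b c where f: "feas P 1 Q a b c" "2 * l + (3 * a + 2 * b + c) = 3 * P + 2 * Q + 1 + 2 * y"
    by (auto simp: theta_lens_def)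
  have "b = 1 \<and> c = 0 \<or> b = 0 \<and> c = 1" using f(1) by (intro one_cases) (simp_all add: feas_def)
  then have "\<exists>i. 2 * i \<le> P \<and> l = m + 3 * i \<or> 2 * i + 1 \<le> P \<and> l = m + 1 + 3 * i"
  proof
    assume bc: "b = 1 \<and> c = 0"
    then have a: "a + 1 \<le> P" "even (P + a + 1)" using f(1) by (auto simp: feas_def)
    then obtain i where "P = a + 1 + 2 * i" using even_diffE[of "a + 1" P] by (simp add: add.assoc) blast
    then show ?thesis using bc f(2) assms(3) by (intro exI[of _ i]) simp
  next
    assume bc: "b = 0 \<and> c = 1"
    then have a: "a \<le> P" "even (P + a)" using f(1) by (auto simp: feas_def)
    then obtain i where "P = a + 2 * i" using even_diffE by metis
    then show ?thesis using bc f(2) assms(3) by (intro exI[of _ i]) simp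
  qed
  then show "l \<in> {l. \<exists>i. 2 * i \<le> P \<and> l = m + 3 * i \<or> 2 * i + 1 \<le> P \<and> l = m + 1 + 3 * i}" by simp
next
  fix l assume "l \<in> {l. \<exists>i. 2 * i \<le> P \<and> l = m + 3 * i \<or> 2 * i + 1 \<le> P \<and> l = m + 1 + 3 * i}"
  then obtain i where "2 * i \<le> P \<and> l = m + 3 * i \<or> 2 * i + 1 \<le> P \<and> l = m + 1 + 3 * i" by blast
  then show "l \<in> theta_lens P 1 Q y"
  proof
    assume i: "2 * i \<le> P \<and> l = m + 3 * i"
    then have "feas P 1 Q (P - 2 * i) 0 1" using assms(1,2) by (auto simp: feas_def)
    then show ?thesis by (rule theta_lensI) (use i[THEN conjunct1] i[THEN conjunct2] assms in simp)
  next
    assume i: "2 * i + 1 \<le> P \<and> l = m + 1 + 3 * i"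
    then have "feas P 1 Q (P - 1 - 2 * i) 1 0" using assms(1,2) by (auto simp: feas_def)
    then show ?thesis by (rule theta_lensI) (use i[THEN conjunct1] i[THEN conjunct2] assms in simp)
  qed
qed

text \<open>Here b = 1 allows a = \<open>Q\<close>, whereas c = 1 allows only a =
  \<open>Q - 1\<close>. The weights 3Q + 2 and 3(Q - 1) + 1 differ by 4, hence the offset 2.\<close>

lemma theta_lens_S1_greater:
  assumes "P = Q + 1 + 2 * e" "m = Q + 1 + 3 * e + y"
  shows "theta_lens P 1 Q y = {l. \<exists>i. 2 * i \<le> Q \<and> l = m + 3 * i \<or> 2 * i + 1 \<le> Q \<and> l = m + 2 + 3 * i}"
proof (intro set_eqI iffI)
  fix l assume "l \<in> theta_lens P 1 Q y"
  then obtain a b c where f: "feas P 1 Q a b c" "2 * l + (3 * a + 2 * b + c) = 3 * P + 2 * Q + 1 + 2 * y"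
    by (auto simp: theta_lens_def)
  have "b = 1 \<and> c = 0 \<or> b = 0 \<and> c = 1" using f(1) by (intro one_cases) (simp_all add: feas_def)
  then have "\<exists>i. 2 * i \<le> Q \<and> l = m + 3 * i \<or> 2 * i + 1 \<le> Q \<and> l = m + 2 + 3 * i"
  proof
    assume bc: "b = 1 \<and> c = 0"
    then have a: "a \<le> Q" "even (Q + a)" using f(1) by (auto simp: feas_def)
    then obtain i where "Q = a + 2 * i" using even_diffE by metis
    then show ?thesis using bc f(2) assms by (intro exI[of _ i]) simp
  next
    assume bc: "b = 0 \<and> c = 1"
    then have a: "a + 1 \<le> Q" "even (Q + a + 1)" using f(1) by (auto simp: feas_def)
    then obtain i where "Q = a + 1 + 2 * i" using even_diffE[of "a + 1" Q] by (simp add: add.assoc) blast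
    then show ?thesis using bc f(2) assms by (intro exI[of _ i]) simp
  qed
  then show "l \<in> {l. \<exists>i. 2 * i \<le> Q \<and> l = m + 3 * i \<or> 2 * i + 1 \<le> Q \<and> l = m + 2 + 3 * i}" by simp
next
  fix l assume "l \<in> {l. \<exists>i. 2 * i \<le> Q \<and> l = m + 3 * i \<or> 2 * i + 1 \<le> Q \<and> l = m + 2 + 3 * i}"
  then obtain i where "2 * i \<le> Q \<and> l = m + 3 * i \<or> 2 * i + 1 \<le> Q \<and> l = m + 2 + 3 * i" by blast
  then show "l \<in> theta_lens P 1 Q y"
  proof
    assume i: "2 * i \<le> Q \<and> l = m + 3 * i"
    then have "feas P 1 Q (Q - 2 * i) 1 0" using assms(1) by (auto simp: feas_def)
    then show ?thesis by (rule theta_lensI) (use i[THEN conjunct1] i[THEN conjunct2] assms in simp)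
  next
    assume i: "2 * i + 1 \<le> Q \<and> l = m + 2 + 3 * i"
    then have "feas P 1 Q (Q - 1 - 2 * i) 0 1" using assms(1) by (auto simp: feas_def)
    then show ?thesis by (rule theta_lensI) (use i[THEN conjunct1] i[THEN conjunct2] assms in simp)
  qed
qed

text \<open>Lowering the weight by 2 raises the length by 1. Four local moves do so: c - 2; (a - 1,
  b + 1, c - 1); (b - 2, c + 2); (a - 2, b + 2). In addition (1, 1, 0) may become (0, 0, 3). The
  corner (Q, S, 0) is the one triple above the least weight where all of them can fail.\<close>

lemma feas_step:
  assumes f: "feas P S Q a b c" and "2 \<le> S" "2 \<le> Q" and ne: "\<not> (a = Q \<and> b = S \<and> c = 0)"
    and f': "feas P S Q a' b' c'" and less: "3 * a' + 2 * b' + c' < 3 * a + 2 * b + c"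
  shows "\<exists>a' b' c'. feas P S Q a' b' c' \<and> 3 * a' + 2 * b' + c' + 2 = 3 * a + 2 * b + c"
proof -
  have le: "a + b \<le> P" "b + c \<le> S" "a + c \<le> Q" and ev: "even (P + a + b)" "even (S + b + c)" "even (Q + a + c)"
    using f by (auto simp: feas_def)
  \<comment> \<open>The first five alternatives are the moves, the last five the triples of least
    weight for their parities.\<close>
  have cs: thesis if "2 \<le> c \<Longrightarrow> thesis" "1 \<le> a \<Longrightarrow> 1 \<le> c \<Longrightarrow> thesis"
    "2 \<le> b \<Longrightarrow> a + c + 2 \<le> Q \<Longrightarrow> thesis" "2 \<le> a \<Longrightarrow> b + c + 2 \<le> S \<Longrightarrow> thesis"
    "a = 1 \<Longrightarrow> b = 1 \<Longrightarrow> c = 0 \<Longrightarrow> 3 \<le> S \<Longrightarrow> 3 \<le> Q \<Longrightarrow> thesis"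
    "c = 0 \<Longrightarrow> a = 0 \<Longrightarrow> b = 0 \<Longrightarrow> thesis" "c = 0 \<Longrightarrow> a = 0 \<Longrightarrow> b = 1 \<Longrightarrow> thesis"
    "c = 0 \<Longrightarrow> a = 1 \<Longrightarrow> b = 0 \<Longrightarrow> thesis" "c = 1 \<Longrightarrow> a = 0 \<Longrightarrow> b = 0 \<Longrightarrow> thesis"
    "c = 1 \<Longrightarrow> a = 0 \<Longrightarrow> b = 1 \<Longrightarrow> thesis" for thesis
  proof (cases "2 \<le> c")
    case True then show thesis by (rule that(1))
  next
    case False
    then consider "c = 0" | "c = 1" by linarith
    then show thesis
    proof cases
      case 1
      have aQ: "a + 2 \<le> Q \<or> a = Q" using le(3) ev(3) 1 by presburger
      have bS: "b + 2 \<le> S \<or> b = S" using le(2) ev(2) 1 by presburger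
      show thesis
      proof (cases "2 \<le> a")
        case True
        show thesis
        proof (cases "b = S")
          case True
          then show thesis using aQ ne 1 assms(2) that(3) by auto
        next
          case False
          then show thesis using bS \<open>2 \<le> a\<close> 1 that(4) by auto
        qed
      next
        case False
        then have aQ: "a + 2 \<le> Q" using aQ assms(3) by auto
        show thesis
        proof (cases "2 \<le> b")
          case True then show thesis using aQ 1 that(3) by auto
        next
          case b: False
          consider "a = 0" "b = 0" | "a = 0" "b = 1" | "a = 1" "b = 0" | "a = 1" "b = 1"
            using False b by linarith
          then show thesis
          proof cases
            case 4
            have "3 \<le> S" "3 \<le> Q" using 4 1 assms(2,3) ev by presburger+
            then show thesis using 4 1 that(5) by blast
          qed (use 1 that in blast)+
        qed
      qed
    next
      case 2
      show thesis
      proof (cases "1 \<le> a")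
        case True then show thesis using 2 that(2) by simp
      next
        case False
        then have "a = 0" by simp
        then have "3 \<le> Q" using 2 assms(3) ev(3) by presburger
        consider "b = 0" | "b = 1" | "2 \<le> b" by linarith
        then show thesis
        proof cases
          case 3 then show thesis using 2 \<open>a = 0\<close> \<open>3 \<le> Q\<close> that(3) by simp
        qed (use 2 \<open>a = 0\<close> that in blast)+
      qed
    qed
  qed
  have par: "even (a + b) \<longleftrightarrow> even (a' + b')" "even (b + c) \<longleftrightarrow> even (b' + c')" "even (a + c) \<longleftrightarrow> even (a' + c')"
    using ev f' by (auto simp: feas_def)
  show ?thesis
  proof (rule cs, goal_cases)
    case 1 show ?thesis by (rule exI[of _ a], rule exI[of _ b], rule exI[of _ "c - 2"]) (use 1 le ev in \<open>auto simp: feas_def\<close>)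
  next
    case 2 show ?thesis by (rule exI[of _ "a - 1"], rule exI[of _ "b + 1"], rule exI[of _ "c - 1"]) (use 2 le ev in \<open>auto simp: feas_def\<close>)
  next
    case 3 show ?thesis by (rule exI[of _ a], rule exI[of _ "b - 2"], rule exI[of _ "c + 2"]) (use 3 le ev in \<open>auto simp: feas_def\<close>)
  next
    case 4 show ?thesis by (rule exI[of _ "a - 2"], rule exI[of _ "b + 2"], rule exI[of _ c]) (use 4 le ev in \<open>auto simp: feas_def\<close>)
  next
    case 5 show ?thesis by (rule exI[of _ 0], rule exI[of _ 0], rule exI[of _ 3]) (use 5 le ev in \<open>auto simp: feas_def\<close>)
  next
    case 6 then show ?thesis using less by simp
  next
    case 7 then have False using less par by presburger
    then show ?thesis ..
  next
    case 8 then have False using less par by presburger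
    then show ?thesis ..
  next
    case 9 then have False using less par by presburger
    then show ?thesis ..
  next
    case 10 then have False using less par by presburger
    then show ?thesis ..
  qed
qed


section \<open>The eight families in normal form\<close>

lemma nat_ceiling_third: "nat \<lceil>real k / 3\<rceil> = (k + 2) div 3"
proof -
  have "k \<le> 3 * ((k + 2) div 3)" "3 * ((k + 2) div 3) \<le> k + 2" by presburger+
  then have "real k \<le> real (3 * ((k + 2) div 3))" "real (3 * ((k + 2) div 3)) \<le> real (k + 2)"
    by (simp_all only: of_nat_le_iff)
  then have "\<lceil>real k / 3\<rceil> = int ((k + 2) div 3)"
    by (intro ceiling_unique) (simp_all add: field_simps)
  then show ?thesis by simp
qed

lemma nat_ceiling_two_thirds: "nat \<lceil>2 * real k / 3\<rceil> = (2 * k + 2) div 3"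
  using nat_ceiling_third[of "2 * k"] by simp

lemma mem_shift: "(x :: nat) \<in> a +o B \<longleftrightarrow> a \<le> x \<and> x - a \<in> B"
  by (force simp: elt_set_plus_def)

lemma mem_dilation: "(x :: nat) \<in> n *o {0..k} \<longleftrightarrow> (\<exists>i\<le>k. x = n * i)"
  by (auto simp: elt_set_times_def)

lemma mem_triple: "(x :: nat) \<in> {0, a, b} + B \<longleftrightarrow> (\<exists>t\<in>B. x = t \<or> x = a + t \<or> x = b + t)"
  by (auto simp: set_plus_def)

lemma progression_eq: "(\<lambda>i. m + d * i) ` {..k} = (m :: nat) +o (d *o {0..k})"
proof (intro set_eqI iffI)
  fix x assume "x \<in> m +o (d *o {0..k})"
  then obtain i where "i \<le> k" "m \<le> x" "x - m = d * i" by (auto simp: mem_shift mem_dilation)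
  moreover from this have "x = m + d * i" by simp
  ultimately show "x \<in> (\<lambda>i. m + d * i) ` {..k}" by auto
qed (auto simp: mem_shift mem_dilation)

text \<open>Absorbs the translation parameter of a family into a lower bound for the minimum of its
  members.\<close>

lemma ex_shift: "(\<exists>y :: nat. R (y + c)) \<longleftrightarrow> (\<exists>m. c \<le> m \<and> R m)"
  by (metis le_add2 le_add_diff_inverse2)

lemma L2_iff: "X \<in> L2 \<longleftrightarrow> (\<exists>m k. 2 * k \<le> m \<and> X = (\<lambda>i. m + 3 * i) ` {..k})"
proof -
  have "X \<in> L2 \<longleftrightarrow> (\<exists>k y. X = (\<lambda>i. y + 2 * k + 3 * i) ` {..k})"
    unfolding L2_def progression_eq by blast
  then show ?thesis using ex_shift[of "\<lambda>m. X = (\<lambda>i. m + 3 * i) ` {..k}" "2 * k" for k] by metis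
qed

lemma L4_iff: "X \<in> L4 \<longleftrightarrow> (\<exists>m k. 2 * k \<le> m \<and> X = (\<lambda>i. m + 2 * i) ` {..k})"
proof -
  have "X \<in> L4 \<longleftrightarrow> (\<exists>k y. X = (\<lambda>i. y + 2 * k + 2 * i) ` {..k})"
    unfolding L4_def progression_eq by blast
  then show ?thesis using ex_shift[of "\<lambda>m. X = (\<lambda>i. m + 2 * i) ` {..k}" "2 * k" for k] by metis
qed

lemma L5_iff: "X \<in> L5 \<longleftrightarrow> (\<exists>m k. 1 \<le> k \<and> k + 2 \<le> m \<and> X = {m..m + k} \<union> {m + k + 2})"
proof -
  have "m +o ({0..k} \<union> {k + 2}) = {m..m + k} \<union> {m + k + 2}" for m k :: nat
    by (rule set_eqI) (auto simp: mem_shift)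
  then have "X \<in> L5 \<longleftrightarrow> (\<exists>k. 1 \<le> k \<and> (\<exists>y. X = {y + (k + 2)..y + (k + 2) + k} \<union> {y + (k + 2) + k + 2}))"
    unfolding L5_def by (simp only: add.assoc mem_Collect_eq) blast
  then show ?thesis using ex_shift[of "\<lambda>m. X = {m..m + k} \<union> {m + k + 2}" "k + 2" for k] by metis
qed

lemma L6_iff: "X \<in> L6 \<longleftrightarrow>
  (\<exists>m k. (k = 3 \<or> 5 \<le> k) \<and> 2 * ((k + 2) div 3) + 2 \<le> m \<and> X = {m} \<union> {m + 2..m + k + 2})"
proof -
  have "m +o ({0} \<union> {2..k + 2}) = {m} \<union> {m + 2..m + k + 2}" for m k :: nat
    by (rule set_eqI) (auto simp: mem_shift)
  then have "X \<in> L6 \<longleftrightarrow> (\<exists>k. (k = 3 \<or> 5 \<le> k) \<and> (\<exists>y. X = {y + (2 * ((k + 2) div 3) + 2)}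
      \<union> {y + (2 * ((k + 2) div 3) + 2) + 2..y + (2 * ((k + 2) div 3) + 2) + k + 2}))"
    unfolding L6_def nat_ceiling_third by (simp only: add.assoc mem_Collect_eq) blast
  then show ?thesis
    using ex_shift[of "\<lambda>m. X = {m} \<union> {m + 2..m + k + 2}" "2 * ((k + 2) div 3) + 2" for k] by metis
qed

text \<open>The first r + 1 terms of m, m + c, m + 3, m + c + 3, and so on. For c = 1 and c = 2 this
  merges the two halves of \<open>L7\<close> and of \<open>L8\<close>, which correspond to even and
  odd \<open>r\<close>.\<close>

definition alternating :: "nat \<Rightarrow> nat \<Rightarrow> nat \<Rightarrow> nat set" where
  "alternating c m r = {l. \<exists>i. 2 * i \<le> r \<and> l = m + 3 * i \<or> 2 * i + 1 \<le> r \<and> l = m + c + 3 * i}"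

lemma mem_block: "x \<in> m +o ({0, c, 3} + 3 *o {0..k}) \<longleftrightarrow>
  (\<exists>i\<le>k. x = m + 3 * i \<or> x = m + c + 3 * i \<or> x = m + 3 * Suc i)"
proof
  assume "x \<in> m +o ({0, c, 3} + 3 *o {0..k})"
  then obtain i where "m \<le> x" "i \<le> k" "x - m = 3 * i \<or> x - m = c + 3 * i \<or> x - m = 3 + 3 * i"
    by (auto simp: mem_shift mem_triple mem_dilation)
  then have "i \<le> k \<and> (x = m + 3 * i \<or> x = m + c + 3 * i \<or> x = m + 3 * Suc i)" by auto
  then show "\<exists>i\<le>k. x = m + 3 * i \<or> x = m + c + 3 * i \<or> x = m + 3 * Suc i" by blast
qed (fastforce simp: mem_shift mem_triple mem_dilation)

lemma alternating_even: "alternating c m (2 * k + 2) = m +o ({0, c, 3} + 3 *o {0..k})"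
proof (intro set_eqI iffI)
  fix x assume "x \<in> alternating c m (2 * k + 2)"
  then obtain i where i: "2 * i \<le> 2 * k + 2 \<and> x = m + 3 * i \<or> 2 * i + 1 \<le> 2 * k + 2 \<and> x = m + c + 3 * i"
    unfolding alternating_def by blast
  show "x \<in> m +o ({0, c, 3} + 3 *o {0..k})"
  proof (cases "i \<le> k")
    case True then show ?thesis using i unfolding mem_block by blast
  next
    case False
    then have "x = m + 3 * Suc k" using i by auto
    then show ?thesis unfolding mem_block by blast
  qed
next
  fix x assume "x \<in> m +o ({0, c, 3} + 3 *o {0..k})"
  then obtain i where i: "i \<le> k" "x = m + 3 * i \<or> x = m + c + 3 * i \<or> x = m + 3 * Suc i" unfolding mem_block by blast
  then have "2 * i \<le> 2 * k + 2" "2 * i + 1 \<le> 2 * k + 2" "2 * Suc i \<le> 2 * k + 2" by auto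
  then show "x \<in> alternating c m (2 * k + 2)" unfolding alternating_def using i(2) by blast
qed

lemma alternating_Suc: "alternating c m (2 * k + 3) = alternating c m (2 * k + 2) \<union> {m + 3 * k + c + 3}"
proof (intro set_eqI iffI)
  fix x assume "x \<in> alternating c m (2 * k + 3)"
  then obtain i where i: "2 * i \<le> 2 * k + 3 \<and> x = m + 3 * i \<or> 2 * i + 1 \<le> 2 * k + 3 \<and> x = m + c + 3 * i"
    unfolding alternating_def by blast
  show "x \<in> alternating c m (2 * k + 2) \<union> {m + 3 * k + c + 3}"
  proof (cases "x = m + 3 * k + c + 3")
    case False
    then have "2 * i \<le> 2 * k + 2 \<and> x = m + 3 * i \<or> 2 * i + 1 \<le> 2 * k + 2 \<and> x = m + c + 3 * i"
      using i by (cases "i = k + 1") auto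
    then show ?thesis unfolding alternating_def by blast
  qed simp
next
  fix x assume "x \<in> alternating c m (2 * k + 2) \<union> {m + 3 * k + c + 3}"
  then show "x \<in> alternating c m (2 * k + 3)"
  proof
    assume "x \<in> alternating c m (2 * k + 2)"
    then obtain i where "2 * i \<le> 2 * k + 2 \<and> x = m + 3 * i \<or> 2 * i + 1 \<le> 2 * k + 2 \<and> x = m + c + 3 * i"
      unfolding alternating_def by blast
    then have "2 * i \<le> 2 * k + 3 \<and> x = m + 3 * i \<or> 2 * i + 1 \<le> 2 * k + 3 \<and> x = m + c + 3 * i" by auto
    then show ?thesis unfolding alternating_def by blast
  next
    assume "x \<in> {m + 3 * k + c + 3}"
    then show ?thesis unfolding alternating_def by (intro CollectI exI[of _ "k + 1"]) simp
  qed
qed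

lemma obtain_even: "2 \<le> n \<Longrightarrow> even n \<Longrightarrow> \<exists>k. n = 2 * k + (2 :: nat)"
  by presburger

lemma obtain_odd: "2 \<le> n \<Longrightarrow> odd n \<Longrightarrow> \<exists>k. n = 2 * k + (3 :: nat)"
  by presburger

text \<open>The extra last element in the second half is the term following the blocks: with m = y +
  2k + 4 it is m + 3k + c + 3 = y + 5k + c + 7. Both offsets 2k + 3 and 2k + 4 equal r + 1, so the
  bound is r < m in either half.\<close>

lemma block_family_iff:
  assumes "t = c + 7"
  shows "X \<in> {(y + 2 * k + 3) +o ({0, c, 3} + 3 *o {0..k}) | y k. True}
      \<union> {((y + 2 * k + 4) +o ({0, c, 3} + 3 *o {0..k})) \<union> {y + 5 * k + t} | y k. True} \<longleftrightarrow>
    (\<exists>m r. 2 \<le> r \<and> r < m \<and> X = alternating c m r)" (is "X \<in> ?F \<longleftrightarrow> _")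
proof
  assume "X \<in> ?F"
  then consider y k where "X = alternating c (y + 2 * k + 3) (2 * k + 2)"
    | y k where "X = alternating c (y + 2 * k + 4) (2 * k + 2) \<union> {y + 5 * k + t}"
    unfolding alternating_even by blast
  then show "\<exists>m r. 2 \<le> r \<and> r < m \<and> X = alternating c m r"
  proof cases
    case 1 then show ?thesis by (intro exI[of _ "y + 2 * k + 3"] exI[of _ "2 * k + 2"]) simp
  next
    case 2
    have "y + 5 * k + t = y + 2 * k + 4 + 3 * k + c + 3" using assms by simp
    then have "X = alternating c (y + 2 * k + 4) (2 * k + 3)" unfolding alternating_Suc 2 by (simp only:)
    then show ?thesis by (intro exI[of _ "y + 2 * k + 4"] exI[of _ "2 * k + 3"]) simp
  qed
next
  assume "\<exists>m r. 2 \<le> r \<and> r < m \<and> X = alternating c m r"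
  then obtain m r where mr: "2 \<le> r" "r < m" "X = alternating c m r" by blast
  show "X \<in> ?F"
  proof (cases "even r")
    case True
    then obtain k where k: "r = 2 * k + 2" using obtain_even[OF mr(1)] by blast
    define y where "y = m - (2 * k + 3)"
    have "m = y + 2 * k + 3" using mr(2) k by (simp add: y_def)
    then have "X = (y + 2 * k + 3) +o ({0, c, 3} + 3 *o {0..k})" using mr(3) k by (simp only: alternating_even)
    then show ?thesis by blast
  next
    case False
    then obtain k where k: "r = 2 * k + 3" using obtain_odd[OF mr(1)] by blast
    define y where "y = m - (2 * k + 4)"
    have m: "m = y + 2 * k + 4" "m + 3 * k + c + 3 = y + 5 * k + t" using mr(2) k assms by (simp_all add: y_def)
    have "X = ((y + 2 * k + 4) +o ({0, c, 3} + 3 *o {0..k})) \<union> {y + 5 * k + t}"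
      unfolding mr(3) k alternating_Suc m(2) alternating_even using m(1) by (simp only:)
    then show ?thesis by blast
  qed
qed

lemma L7_iff: "X \<in> L7 \<longleftrightarrow> (\<exists>m r. 2 \<le> r \<and> r < m \<and> X = alternating 1 m r)"
  unfolding L7_def by (rule block_family_iff) simp

lemma L8_iff: "X \<in> L8 \<longleftrightarrow> (\<exists>m r. 2 \<le> r \<and> r < m \<and> X = alternating 2 m r)"
  unfolding L8_def by (rule block_family_iff) simp

section \<open>The two descriptions of the interval family\<close>

lemma plus_interval: "m +o ({a..b} :: nat set) = {m + a..m + b}"
  by (rule set_eqI) (auto simp: mem_shift)

text \<open>The inequality is max \<le> 5/2 min. The conditions for \<open>k = 1\<close> and
  \<open>k = 3\<close> remove just the intervals [1,2] and [2,5], later excluded by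
  \<open>lens_one\<close> and \<open>lens_two_five\<close>.\<close>

lemma L3_alt_iff: "X \<in> L3_alt \<longleftrightarrow> (\<exists>m k. X = {m..m + k} \<and> 1 \<le> k \<and> 2 * k \<le> 3 * m \<and> (k = 1 \<longrightarrow> 2 \<le> m) \<and> (k = 3 \<longrightarrow> 3 \<le> m))"
    (is "_ \<longleftrightarrow> ?R")
proof
  assume "X \<in> L3_alt"
  then consider y k where "1 \<le> k" "k \<noteq> 1" "k \<noteq> 3" "X = {y + (2 * k + 2) div 3..y + (2 * k + 2) div 3 + k}"
    | y where "X = {y + 3..y + 3 + 3}" | y where "X = {y + 2..y + 2 + 1}"
    unfolding L3_alt_def nat_ceiling_two_thirds plus_interval by auto
  then show ?R
  proof cases
    case 1
    have "2 * k \<le> 3 * (y + (2 * k + 2) div 3)" by presburger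
    then show ?thesis using 1 by blast
  next
    case 2 then show ?thesis by (intro exI[of _ "y + 3"] exI[of _ 3]) simp
  next
    case 3 then show ?thesis by (intro exI[of _ "y + 2"] exI[of _ 1]) simp
  qed
next
  assume ?R
  then obtain m k where mk: "X = {m..m + k}" "1 \<le> k" "2 * k \<le> 3 * m" "k = 1 \<longrightarrow> 2 \<le> m" "k = 3 \<longrightarrow> 3 \<le> m" by blast
  consider "k = 1" | "k = 3" | "k \<notin> {1, 3}" by blast
  then show "X \<in> L3_alt"
  proof cases
    case 1
    then have "X = {(m - 2) + 2..(m - 2) + 2 + 1}" using mk by auto
    then show ?thesis unfolding L3_alt_def plus_interval by auto
  next
    case 2
    then have "X = {(m - 3) + 3..(m - 3) + 3 + 3}" using mk by auto
    then show ?thesis unfolding L3_alt_def plus_interval by auto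
  next
    case 3
    have "(2 * k + 2) div 3 \<le> m" using mk(3) by presburger
    then have "X = {(m - (2 * k + 2) div 3) + (2 * k + 2) div 3..(m - (2 * k + 2) div 3) + (2 * k + 2) div 3 + k}"
      using mk(1) by simp
    then show ?thesis using 3 mk(2) unfolding L3_alt_def nat_ceiling_two_thirds plus_interval by auto
  qed
qed

lemma L3_minimum: "k \<ge> 1 \<Longrightarrow> (LEAST m'. m' \<ge> 1 \<and> real (m' + k) \<le> 5 * real m' / 2) = (2 * k + 2) div 3"
proof (rule Least_equality)
  have *: "real (m + k) \<le> 5 * real m / 2 \<longleftrightarrow> 2 * k \<le> 3 * m" for m
  proof -
    have "real (m + k) \<le> 5 * real m / 2 \<longleftrightarrow> real (2 * k) \<le> real (3 * m)" by (simp add: field_simps)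
    then show ?thesis by (simp only: of_nat_le_iff)
  qed
  assume "k \<ge> 1"
  then have "1 \<le> (2 * k + 2) div 3" "2 * k \<le> 3 * ((2 * k + 2) div 3)" by presburger+
  then show "(2 * k + 2) div 3 \<ge> 1 \<and> real ((2 * k + 2) div 3 + k) \<le> 5 * real ((2 * k + 2) div 3) / 2"
    unfolding * by simp
  show "(2 * k + 2) div 3 \<le> m" if "m \<ge> 1 \<and> real (m + k) \<le> 5 * real m / 2" for m
    using that unfolding * by presburger
qed

lemma L3_eq_L3_alt: "L3 = L3_alt"
proof
  have big: "{y +o {m..m + k} | y k m. k \<ge> 6 \<and> m = (LEAST m'. m' \<ge> 1 \<and> real (m' + k) \<le> 5 * real m' / 2)}
      = {{y + (2 * k + 2) div 3..y + (2 * k + 2) div 3 + k} | y k. k \<ge> 6}"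
  proof -
    have "k \<ge> 6 \<and> m = (LEAST m'. m' \<ge> 1 \<and> real (m' + k) \<le> 5 * real m' / 2) \<longleftrightarrow> k \<ge> 6 \<and> m = (2 * k + 2) div 3" for k m
    proof (cases "k \<ge> 6")
      case True
      then have "k \<ge> 1" by simp
      from L3_minimum[OF this] show ?thesis by (simp only:)
    qed simp
    then show ?thesis unfolding plus_interval add.assoc by (simp only:) blast
  qed
  show "L3 \<subseteq> L3_alt"
  proof
    fix X assume XL: "X \<in> L3"
    consider y where "X = {y + 2..y + 2 + 1}" | y where "X = {y + 2..y + 2 + 2}" | y where "X = {y + 3..y + 3 + 3}"
      | y where "X = {y + 3..y + 3 + 4}" | y where "X = {y + 4..y + 4 + 5}"
      | y k where "k \<ge> 6" "X = {y + (2 * k + 2) div 3..y + (2 * k + 2) div 3 + k}"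
      using XL unfolding L3_def big unfolding plus_interval by auto
    then show "X \<in> L3_alt"
    proof cases
      case 6
      have "2 * k \<le> 3 * (y + (2 * k + 2) div 3)" by presburger
      then show ?thesis unfolding L3_alt_iff using 6
        by (intro exI[of _ "y + (2 * k + 2) div 3"] exI[of _ k]) simp
    next
      case (1 y) then show ?thesis unfolding L3_alt_iff by (intro exI[of _ "y + 2"] exI[of _ 1]) simp
    next
      case (2 y) then show ?thesis unfolding L3_alt_iff by (intro exI[of _ "y + 2"] exI[of _ 2]) simp
    next
      case (3 y) then show ?thesis unfolding L3_alt_iff by (intro exI[of _ "y + 3"] exI[of _ 3]) simp
    next
      case (4 y) then show ?thesis unfolding L3_alt_iff by (intro exI[of _ "y + 3"] exI[of _ 4]) simp
    next
      case (5 y) then show ?thesis unfolding L3_alt_iff by (intro exI[of _ "y + 4"] exI[of _ 5]) simp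
    qed
  qed
  show "L3_alt \<subseteq> L3"
  proof
    fix X assume "X \<in> L3_alt"
    then obtain m k where mk: "X = {m..m + k}" "1 \<le> k" "2 * k \<le> 3 * m" "k = 1 \<longrightarrow> 2 \<le> m" "k = 3 \<longrightarrow> 3 \<le> m"
      unfolding L3_alt_iff by blast
    have iv: "X = {(m - c) + c..(m - c) + (c + k)}" if "c \<le> m" for c using mk(1) that by simp
    consider "k = 1" | "k = 2" | "k = 3" | "k = 4" | "k = 5" | "k \<ge> 6" using mk(2) by linarith
    then show "X \<in> L3"
    proof cases
      case 1
      have "2 \<le> m" "{(m - 2) + 2..(m - 2) + (2 + k)} = {(m - 2) + 2..(m - 2) + 3}" using mk 1 by auto
      then have "\<exists>y. X = {y + 2..y + 3}" using iv[of 2] by metis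
      then show ?thesis unfolding L3_def plus_interval by blast
    next
      case 2
      have "2 \<le> m" "{(m - 2) + 2..(m - 2) + (2 + k)} = {(m - 2) + 2..(m - 2) + 4}" using mk 2 by auto
      then have "\<exists>y. X = {y + 2..y + 4}" using iv[of 2] by metis
      then show ?thesis unfolding L3_def plus_interval by blast
    next
      case 3
      have "3 \<le> m" "{(m - 3) + 3..(m - 3) + (3 + k)} = {(m - 3) + 3..(m - 3) + 6}" using mk 3 by auto
      then have "\<exists>y. X = {y + 3..y + 6}" using iv[of 3] by metis
      then show ?thesis unfolding L3_def plus_interval by blast
    next
      case 4
      have "3 \<le> m" "{(m - 3) + 3..(m - 3) + (3 + k)} = {(m - 3) + 3..(m - 3) + 7}" using mk 4 by auto
      then have "\<exists>y. X = {y + 3..y + 7}" using iv[of 3] by metis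
      then show ?thesis unfolding L3_def plus_interval by blast
    next
      case 5
      have "4 \<le> m" "{(m - 4) + 4..(m - 4) + (4 + k)} = {(m - 4) + 4..(m - 4) + 9}" using mk 5 by auto
      then have "\<exists>y. X = {y + 4..y + 9}" using iv[of 4] by metis
      then show ?thesis unfolding L3_def plus_interval by blast
    next
      case 6
      have "(2 * k + 2) div 3 \<le> m" using mk(3) by presburger
      from iv[OF this] have "X = {m - (2 * k + 2) div 3 + (2 * k + 2) div 3..m - (2 * k + 2) div 3 + (2 * k + 2) div 3 + k}"
        by (simp only: add.assoc)
      then show ?thesis unfolding L3_def big using 6 by blast
    qed
  qed
qed


section \<open>Every set of lengths lies in one of the families\<close>

definition stepwise :: "nat set \<Rightarrow> bool" where
  "stepwise L \<longleftrightarrow> (\<forall>l\<in>L. \<forall>k\<in>L. l < k \<longrightarrow> Suc l \<in> L)"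

lemma stepwise_upto:
  assumes "\<And>l. l \<in> L \<Longrightarrow> a \<le> l \<Longrightarrow> l < b \<Longrightarrow> Suc l \<in> L" "a \<in> L" "a \<le> x" "x \<le> b"
  shows "x \<in> L"
  using assms(3,4)
proof (induction x rule: dec_induct)
  case base show ?case by (rule assms(2))
next
  case (step n) then show ?case using assms(1)[of n] by simp
qed

lemma stepwise_interval:
  assumes "finite L" "L \<noteq> {}" "stepwise L"
  shows "L = {Min L..Max L}" "Min L \<le> Max L"
proof -
  have mem: "Min L \<in> L" "Max L \<in> L" using assms by auto
  have "x \<in> L" if "Min L \<le> x" "x \<le> Max L" for x
    by (rule stepwise_upto[of L "Min L" "Max L"]) (use assms(3) mem that in \<open>auto simp: stepwise_def\<close>)
  moreover have "Min L \<le> x \<and> x \<le> Max L" if "x \<in> L" for x using assms that by simp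
  ultimately show "L = {Min L..Max L}" unfolding set_eq_iff atLeastAtMost_iff by blast
  show "Min L \<le> Max L" using assms mem by simp
qed

text \<open>The least 3a + 2b + c for prescribed parities of a + c and b + c, attained at (0, 0, 1),
  (1, 0, 0), (0, 1, 0), (0, 0, 0) respectively.\<close>

definition least_weight :: "nat \<Rightarrow> nat \<Rightarrow> nat" where
  "least_weight Q S = (if odd Q \<and> odd S then 1 else if odd Q then 3 else if odd S then 2 else 0)"

text \<open>A long path \<open>P\<close> makes the corner (Q, S, 0) feasible, which gives the
  minimum \<open>m\<close>. Writing Q = a + c + 2u and S = b + c + 2v, the length is m + 2c + 3u +
  2v, never m + 1. The value m + 2 occurs, and from there \<open>feas_step\<close> climbs to the
  least weight.\<close>

lemma theta_lens_bottom_gap_eq: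
  assumes "2 \<le> S" "2 \<le> Q" "P = Q + S + 2 * e"
    and d: "3 * Q + 2 * S = least_weight Q S + 2 * d" and m_def: "m = Q + S + 3 * e + y"
  shows "theta_lens P S Q y = {m} \<union> {m + 2..m + d}"
proof -
  let ?L = "theta_lens P S Q y"
  let ?w = "least_weight Q S"
  have sum: "3 * P + 2 * Q + S + 2 * y = 2 * m + (3 * Q + 2 * S)" using assms(3) by (simp add: m_def)
  have par: "?w \<le> 3 * a + 2 * b + c" if "feas P S Q a b c" for a b c
  proof -
    have "even (S + b + c)" "even (Q + a + c)" using that by (simp_all add: feas_def)
    then show ?thesis unfolding least_weight_def by presburger
  qed
  have bounds: "m \<le> l" "l \<le> m + d" "l \<noteq> Suc m" if lL: "l \<in> ?L" for l
  proof -
    obtain a b c where f: "feas P S Q a b c" "2 * l + (3 * a + 2 * b + c) = 2 * m + (3 * Q + 2 * S)"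
      using lL unfolding theta_lens_def sum by blast
    have le: "b + c \<le> S" "a + c \<le> Q" and ev: "even (S + (b + c))" "even (Q + (a + c))"
      using f(1) by (simp_all add: feas_def add.assoc)
    show "m \<le> l" using f(2) le by linarith
    show "l \<le> m + d" using f(2) par[OF f(1)] d by linarith
    obtain u v where uv: "Q = a + c + 2 * u" "S = b + c + 2 * v"
      using even_diffE[OF le(2) ev(2)] even_diffE[OF le(1) ev(1)] by metis
    show "l \<noteq> Suc m"
    proof
      assume "l = Suc m"
      then have "2 * c + 3 * u + 2 * v = 1" using f(2) uv by simp
      then show False by presburger
    qed
  qed
  have top: "m + d \<in> ?L"
  proof -
    have "\<exists>a b c. feas P S Q a b c \<and> 3 * a + 2 * b + c = ?w"
    proof -
      consider "odd Q" "odd S" | "odd Q" "even S" | "even Q" "odd S" | "even Q" "even S" by blast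
      then show ?thesis
      proof cases
        case 1 show ?thesis by (rule exI[of _ 0], rule exI[of _ 0], rule exI[of _ 1]) (use 1 assms in \<open>simp add: feas_def least_weight_def\<close>)
      next
        case 2 show ?thesis by (rule exI[of _ 1], rule exI[of _ 0], rule exI[of _ 0]) (use 2 assms in \<open>simp add: feas_def least_weight_def\<close>)
      next
        case 3 show ?thesis by (rule exI[of _ 0], rule exI[of _ 1], rule exI[of _ 0]) (use 3 assms in \<open>simp add: feas_def least_weight_def\<close>)
      next
        case 4 show ?thesis by (rule exI[of _ 0], rule exI[of _ 0], rule exI[of _ 0]) (use 4 assms in \<open>simp add: feas_def least_weight_def\<close>)
      qed
    qed
    then obtain a b c where "feas P S Q a b c" "3 * a + 2 * b + c = ?w" by blast
    then show ?thesis using sum d by (intro theta_lensI[of P S Q a b c]) simp_all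
  qed
  have bot: "m \<in> ?L" using sum assms(3) by (intro theta_lensI[of P S Q Q S 0]) (simp_all add: feas_def)
  have bot2: "m + 2 \<in> ?L" using sum assms by (intro theta_lensI[of P S Q Q "S - 2" 0]) (simp_all add: feas_def)
  have step: "Suc l \<in> ?L" if l: "l \<in> ?L" "m + 2 \<le> l" "l < m + d" for l
  proof -
    obtain a b c where f: "feas P S Q a b c" "2 * l + (3 * a + 2 * b + c) = 2 * m + (3 * Q + 2 * S)"
      using l(1) unfolding theta_lens_def sum by blast
    obtain a' b' c' where f': "feas P S Q a' b' c'" "2 * (m + d) + (3 * a' + 2 * b' + c') = 2 * m + (3 * Q + 2 * S)"
      using top unfolding theta_lens_def sum by blast
    have "\<not> (a = Q \<and> b = S \<and> c = 0)" using f(2) l(2) by auto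
    moreover have "2 * l + (3 * a + 2 * b + c) = 2 * (m + d) + (3 * a' + 2 * b' + c')"
      unfolding f(2) f'(2) ..
    then have "3 * a' + 2 * b' + c' < 3 * a + 2 * b + c" using l(3) by simp
    ultimately obtain a1 b1 c1 where "feas P S Q a1 b1 c1" "3 * a1 + 2 * b1 + c1 + 2 = 3 * a + 2 * b + c"
      using feas_step[OF f(1) assms(1,2) _ f'(1) \<open>3 * a' + 2 * b' + c' < 3 * a + 2 * b + c\<close>] by blast
    then show ?thesis using f(2) sum by (intro theta_lensI[of P S Q a1 b1 c1]) simp_all
  qed
  show ?thesis
  proof (intro set_eqI iffI)
    fix l assume "l \<in> ?L"
    then show "l \<in> {m} \<union> {m + 2..m + d}" using bounds[of l] by auto
  next
    fix l assume "l \<in> {m} \<union> {m + 2..m + d}"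
    then consider "l = m" | "m + 2 \<le> l" "l \<le> m + d" by auto
    then show "l \<in> ?L"
    proof cases
      case 1 then show ?thesis using bot by simp
    next
      case 2 show ?thesis by (rule stepwise_upto[of ?L "m + 2" "m + d", OF step bot2 2])
    qed
  qed
qed

text \<open>The parameter of \<open>L6\<close> is k = d - 2, for which the ceiling of k/3 is
  \<open>d div 3\<close>. With q and s the halves of \<open>Q\<close> and \<open>S\<close> rounded
  down, both at least 1, d is 3q + 2s, or 3q + 2s + 2 if both are odd; this is never 6, so k = 4
  does not occur.\<close>

lemma theta_lens_bottom_gap:
  assumes "2 \<le> S" "2 \<le> Q" "P = Q + S + 2 * e"
  shows "theta_lens P S Q y \<in> L6"
proof -
  define m where "m = Q + S + 3 * e + y"
  have "even (3 * Q + 2 * S - least_weight Q S)" "least_weight Q S \<le> 3 * Q + 2 * S"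
    using assms by (auto simp: least_weight_def)
  then obtain d where d: "3 * Q + 2 * S = least_weight Q S + 2 * d" by (metis dvdE le_add_diff_inverse)
  have d5: "d \<ge> 5" "d \<noteq> 6" "2 * (d div 3) + 2 \<le> m"
  proof -
    have "d \<ge> 5 \<and> d \<noteq> 6 \<and> 2 * (d div 3) + 2 \<le> Q + S"
    proof -
      have t: "3 * (d div 3) \<le> d" by simp
      consider q s where "Q = 2 * q + 1" "S = 2 * s + 1" "1 \<le> q" "1 \<le> s" | q s where "Q = 2 * q + 1" "S = 2 * s" "1 \<le> q" "1 \<le> s"
        | q s where "Q = 2 * q" "S = 2 * s + 1" "1 \<le> q" "1 \<le> s" | q s where "Q = 2 * q" "S = 2 * s" "1 \<le> q" "1 \<le> s"
        using assms(1,2) by (cases "odd Q"; cases "odd S") (auto elim!: oddE evenE)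
      then show ?thesis
      proof cases
        case 1
        then have d': "d = 3 * q + 2 * s + 2" using d by (simp add: least_weight_def)
        have "d div 3 \<le> q + s" using t d' by linarith
        moreover have "5 \<le> d" "d \<noteq> 6" using d' 1(3,4) by linarith+
        ultimately show ?thesis using 1(1,2) by simp
      next
        case 2
        then have d': "d = 3 * q + 2 * s" using d by (simp add: least_weight_def)
        have "d div 3 + 1 \<le> q + s" using t d' 2(3,4) by linarith
        moreover have "5 \<le> d" using d' 2(3,4) by linarith
        moreover have "d \<noteq> 6" using d' 2(3,4) by presburger
        ultimately show ?thesis using 2(1,2) by simp
      next
        case 3
        then have d': "d = 3 * q + 2 * s" using d by (simp add: least_weight_def)
        have "d div 3 + 1 \<le> q + s" using t d' 3(3,4) by linarith
        moreover have "5 \<le> d" using d' 3(3,4) by linarith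
        moreover have "d \<noteq> 6" using d' 3(3,4) by presburger
        ultimately show ?thesis using 3(1,2) by simp
      next
        case 4
        then have d': "d = 3 * q + 2 * s" using d by (simp add: least_weight_def)
        have "d div 3 + 1 \<le> q + s" using t d' 4(3,4) by linarith
        moreover have "5 \<le> d" using d' 4(3,4) by linarith
        moreover have "d \<noteq> 6" using d' 4(3,4) by presburger
        ultimately show ?thesis using 4(1,2) by simp
      qed
    qed
    then show "d \<ge> 5" "d \<noteq> 6" "2 * (d div 3) + 2 \<le> m" by (auto simp: m_def)
  qed
  have L: "theta_lens P S Q y = {m} \<union> {m + 2..m + (d - 2) + 2}"
  proof -
    have "m + (d - 2) + 2 = m + d" using d5(1) by simp
    then show ?thesis using theta_lens_bottom_gap_eq[OF assms d m_def] by (simp only:)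
  qed
  have k: "d - 2 = 3 \<or> 5 \<le> d - 2" using d5 by linarith
  have "d - 2 + 2 = d" using d5 by linarith
  then have m: "2 * ((d - 2 + 2) div 3) + 2 \<le> m" using d5(3) by (simp only:)
  show ?thesis
    by (rule L6_iff[THEN iffD2], rule exI[of _ m], rule exI[of _ "d - 2"]) (rule conjI[OF k conjI[OF m L]])
qed

text \<open>The corner exempted in \<open>feas_step\<close> has a + b = Q + S > P and is
  infeasible.\<close>

lemma theta_lens_step:
  assumes "2 \<le> S" "2 \<le> Q" "P < Q + S"
  shows "stepwise (theta_lens P S Q y)"
  unfolding stepwise_def
proof (intro ballI impI)
  fix l k assume l: "l \<in> theta_lens P S Q y" and k: "k \<in> theta_lens P S Q y" and "l < k"
  obtain a b c where f: "feas P S Q a b c" "2 * l + (3 * a + 2 * b + c) = 3 * P + 2 * Q + S + 2 * y"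
    using l by (auto simp: theta_lens_def)
  obtain a' b' c' where f': "feas P S Q a' b' c'" "2 * k + (3 * a' + 2 * b' + c') = 3 * P + 2 * Q + S + 2 * y"
    using k by (auto simp: theta_lens_def)
  have "\<not> (a = Q \<and> b = S \<and> c = 0)" using f(1) assms(3) by (auto simp: feas_def)
  moreover have "3 * a' + 2 * b' + c' < 3 * a + 2 * b + c" using f(2) f'(2) \<open>l < k\<close> by linarith
  ultimately obtain a1 b1 c1 where "feas P S Q a1 b1 c1" "3 * a1 + 2 * b1 + c1 + 2 = 3 * a + 2 * b + c"
    using feas_step[OF f(1) assms(1,2) _ f'(1)] by blast
  then show "Suc l \<in> theta_lens P S Q y" using f(2) by (intro theta_lensI[of P S Q a1 b1 c1]) simp_all
qed

lemma theta_lens_S1_L7: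
  assumes "P < Q" "odd (P + Q)" "2 \<le> P"
  shows "theta_lens P 1 Q y \<in> L7"
  unfolding theta_lens_S1_less[OF assms(1,2) refl] alternating_def[symmetric] L7_iff
  by (intro exI[of _ "Q + y"] exI[of _ P]) (use assms in simp)

lemma theta_lens_S1_L8:
  assumes "P = Q + 1 + 2 * e" "2 \<le> Q"
  shows "theta_lens P 1 Q y \<in> L8"
  unfolding theta_lens_S1_greater[OF assms(1) refl] alternating_def[symmetric] L8_iff
  by (intro exI[of _ "Q + 1 + 3 * e + y"] exI[of _ Q]) (use assms in simp)


text \<open>The two shorter paths decide: Q \<le> 1 leads to \<open>L4\<close>, S = 0 to
  \<open>L2\<close>, S = 1 to \<open>L7\<close> or \<open>L8\<close> according to whether
  \<open>P\<close> or \<open>Q\<close> is smaller, and S, Q \<ge> 2 to no gap or to the gap at the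
  bottom in \<open>L6\<close>.\<close>

lemma theta_lens_class:
  assumes ev: "even (P + S + Q)"
  shows "stepwise (theta_lens P S Q y) \<or> theta_lens P S Q y \<in> L2 \<union> L4 \<union> L6 \<union> L7 \<union> L8"
proof -
  consider "Q = 0" | "Q = 1" | "2 \<le> Q" "S = 0" | "2 \<le> Q" "S = 1" | "2 \<le> Q" "2 \<le> S" by linarith
  then show ?thesis
  proof cases
    case 1
    define r where "r = min P S"
    have "2 * r \<le> 3 * P + S + 2 * y" "even (3 * P + S + 2 * y - 2 * r)" using ev 1 by (auto simp: r_def)
    then obtain m where m: "2 * m + 2 * r = 3 * P + S + 2 * y" by (metis dvdE le_add_diff_inverse2)
    have "theta_lens P S 0 y = (\<lambda>i. m + 2 * i) ` {..r div 2}"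
      using ev 1 by (intro theta_lens_Q0[OF r_def _ m]) simp
    moreover have "2 * (r div 2) \<le> m" using m unfolding r_def by linarith
    ultimately have "theta_lens P S 0 y \<in> L4" unfolding L4_iff by blast
    then show ?thesis using 1 by simp
  next
    case 2
    have "P \<noteq> S" using ev 2 by auto
    then consider "S < P" | "P < S" by linarith
    then show ?thesis
    proof cases
      case 1
      then have "3 + 2 * S \<le> 3 * P + 2 + S + 2 * y" "even (3 * P + 2 + S + 2 * y - (3 + 2 * S))"
        using ev 2 by auto
      then obtain m where m: "2 * m + (3 + 2 * S) = 3 * P + 2 + S + 2 * y" by (metis dvdE le_add_diff_inverse2)
      have "theta_lens P S 1 y = (\<lambda>i. m + 2 * i) ` {..(S + 1) div 2}"
        using ev 2 by (intro theta_lens_Q1_less[OF 1 _ m]) simp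
      moreover have "2 * ((S + 1) div 2) \<le> m" using m 1 by linarith
      ultimately have "theta_lens P S 1 y \<in> L4" unfolding L4_iff by blast
      then show ?thesis using 2 by simp
    next
      case less: 2
      then have "1 + 2 * P \<le> 3 * P + 2 + S + 2 * y" "even (3 * P + 2 + S + 2 * y - (1 + 2 * P))"
        using ev 2 by auto
      then obtain m where m: "2 * m + (1 + 2 * P) = 3 * P + 2 + S + 2 * y" by (metis dvdE le_add_diff_inverse2)
      have "theta_lens P S 1 y = (\<lambda>i. m + 2 * i) ` {..P div 2}"
        using ev 2 by (intro theta_lens_Q1_greater[OF less _ m]) simp
      moreover have "2 * (P div 2) \<le> m" using m less by linarith
      ultimately have "theta_lens P S 1 y \<in> L4" unfolding L4_iff by blast
      then show ?thesis using 2 by simp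
    qed
  next
    case 3
    define r where "r = min P Q"
    have "3 * r \<le> 3 * P + 2 * Q + 2 * y" "even (3 * P + 2 * Q + 2 * y - 3 * r)" using ev 3 by (auto simp: r_def min_def)
    then obtain m where m: "2 * m + 3 * r = 3 * P + 2 * Q + 2 * y" by (metis dvdE le_add_diff_inverse2)
    have "theta_lens P 0 Q y = (\<lambda>i. m + 3 * i) ` {..r div 2}"
      using ev 3 by (intro theta_lens_S0[OF r_def _ m]) simp
    moreover have "2 * (r div 2) \<le> m" using m unfolding r_def by linarith
    ultimately have "theta_lens P 0 Q y \<in> L2" unfolding L2_iff by blast
    then show ?thesis using 3 by simp
  next
    case 4
    have "P \<noteq> Q" using ev 4 by auto
    then consider "P < Q" | "Q < P" by linarith
    then show ?thesis
    proof cases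
      case 1
      have od: "odd (P + Q)" using ev 4 by auto
      note eq = theta_lens_S1_less[OF 1 od refl, of y]
      consider "P = 0" | "P = 1" | "2 \<le> P" by linarith
      then show ?thesis
      proof cases
        case 1
        then have "theta_lens P 1 Q y = {Q + y}" unfolding eq by auto
        then show ?thesis using 4 by (simp add: stepwise_def)
      next
        case 2
        then have "theta_lens P 1 Q y = {Q + y, Suc (Q + y)}" unfolding eq by auto
        then show ?thesis using 4 by (simp add: stepwise_def)
      next
        case 3
        then show ?thesis using theta_lens_S1_L7[OF 1 od 3] 4 by simp
      qed
    next
      case 2
      have "even (P + (Q + 1))" "Q + 1 \<le> P" using ev 4 2 by auto
      then obtain e where e: "P = Q + 1 + 2 * e" using even_diffE by blast
      then have "theta_lens P 1 Q y \<in> L8" using 4 by (intro theta_lens_S1_L8)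
      then show ?thesis using 4 by simp
    qed
  next
    case 5
    show ?thesis
    proof (cases "P < Q + S")
      case True then show ?thesis using theta_lens_step 5 by blast
    next
      case False
      then have "Q + S \<le> P" "even (P + (Q + S))" using ev by auto
      then obtain e where "P = Q + S + 2 * e" using even_diffE by blast
      then show ?thesis using theta_lens_bottom_gap 5 by blast
    qed
  qed
qed

lemma shift_L2: "X \<in> L2 \<Longrightarrow> (+) j ` X \<in> L2"
proof -
  assume "X \<in> L2"
  then obtain m k where "2 * k \<le> m" "X = (\<lambda>i. m + 3 * i) ` {..k}" unfolding L2_iff by blast
  then have "2 * k \<le> m + j" "(+) j ` X = (\<lambda>i. m + j + 3 * i) ` {..k}" by (auto simp: image_image ac_simps)
  then show ?thesis unfolding L2_iff by blast
qed

lemma shift_L4: "X \<in> L4 \<Longrightarrow> (+) j ` X \<in> L4"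
proof -
  assume "X \<in> L4"
  then obtain m k where "2 * k \<le> m" "X = (\<lambda>i. m + 2 * i) ` {..k}" unfolding L4_iff by blast
  then have "2 * k \<le> m + j" "(+) j ` X = (\<lambda>i. m + j + 2 * i) ` {..k}" by (auto simp: image_image ac_simps)
  then show ?thesis unfolding L4_iff by blast
qed

lemma shift_L5: "X \<in> L5 \<Longrightarrow> (+) j ` X \<in> L5"
proof -
  assume "X \<in> L5"
  then obtain m k where mk: "1 \<le> k" "k + 2 \<le> m" "X = {m..m + k} \<union> {m + k + 2}" unfolding L5_iff by blast
  have "(+) j ` X = {m + j..m + j + k} \<union> {m + j + k + 2}"
    unfolding mk(3) image_Un image_add_atLeastAtMost by (simp add: ac_simps)
  moreover have "k + 2 \<le> m + j" using mk by simp
  ultimately show ?thesis unfolding L5_iff using mk(1) by blast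
qed

lemma shift_L6: "X \<in> L6 \<Longrightarrow> (+) j ` X \<in> L6"
proof -
  assume "X \<in> L6"
  then obtain m k where mk: "k = 3 \<or> 5 \<le> k" "2 * ((k + 2) div 3) + 2 \<le> m" "X = {m} \<union> {m + 2..m + k + 2}"
    unfolding L6_iff by blast
  have "(+) j ` X = {m + j} \<union> {m + j + 2..m + j + k + 2}"
    unfolding mk(3) image_Un image_add_atLeastAtMost by (simp add: ac_simps)
  moreover have "2 * ((k + 2) div 3) + 2 \<le> m + j" using mk(2) by simp
  ultimately show ?thesis unfolding L6_iff using mk(1) by blast
qed

lemma shift_alternating: "(+) j ` alternating c m r = alternating c (m + j) r"
proof (intro set_eqI iffI)
  fix x assume "x \<in> alternating c (m + j) r"
  then obtain i where "2 * i \<le> r \<and> x = j + (m + 3 * i) \<or> 2 * i + 1 \<le> r \<and> x = j + (m + c + 3 * i)"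
    unfolding alternating_def by (auto simp: ac_simps)
  then show "x \<in> (+) j ` alternating c m r" unfolding alternating_def by blast
qed (auto simp: alternating_def ac_simps)

lemma shift_L7: "X \<in> L7 \<Longrightarrow> (+) j ` X \<in> L7"
  unfolding L7_iff using shift_alternating trans_less_add1 by blast

lemma shift_L8: "X \<in> L8 \<Longrightarrow> (+) j ` X \<in> L8"
  unfolding L8_iff using shift_alternating trans_less_add1 by blast

section \<open>Intervals as sets of lengths\<close>

lemma lens_one:
  assumes "1 \<in> lens A" "n \<in> lens A" "0 \<notin># A" shows "n = 1"
proof -
  obtain F where F: "factorizes A F" "size F = 1" using assms(1) unfolding lens_def by fastforce
  obtain U where "F = {#U#}" using F(2) by (blast dest: size_1_singleton_mset)
  with F have U: "zero_sum_atom A" by (auto simp: factorizes_def)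
  obtain G where G: "factorizes A G" "size G = n" using assms(2) by (auto simp: lens_def)
  have "G \<noteq> {#}" using G U by (auto simp: zero_sum_atom_def)
  then obtain V G' where G': "G = add_mset V G'" by (meson multiset_cases)
  have V: "zero_sum_atom V" "A = V + \<Sum>\<^sub># G'" "factorizes (\<Sum>\<^sub># G') G'" using G(1) G' by (auto simp: factorizes_def)
  have "V \<subseteq># A" using V(2) by simp
  moreover have "V \<noteq> {#}" "\<Sum>\<^sub># V = 0" using V(1) unfolding zero_sum_atom_iff by blast+
  ultimately have "V = A" using U unfolding zero_sum_atom_iff by blast
  then have "\<Sum>\<^sub># G' = {#}" using V(2) by simp
  then have "size (\<Sum>\<^sub># G') = 0" by simp
  then have "size G' = 0" using factorizes_size(1)[OF V(3)] by (simp add: \<open>\<Sum>\<^sub># G' = {#}\<close>)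
  then show ?thesis using G(2) G' by simp
qed

text \<open>Both size bounds are attained, so \<open>A\<close> has ten elements and is a product of
  five squares as well as of two 5-circuits. All multiplicities being even, the circuits coincide,
  and U^2 has no lengths but 2 and 5.\<close>

lemma lens_two_five:
  assumes A: "0 \<notin># A" and "2 \<in> lens A" "5 \<in> lens A" shows "3 \<notin> lens A"
proof
  assume 3: "3 \<in> lens A"
  have sz: "size A = 10" using lens_bounded[OF A assms(2)] lens_bounded[OF A assms(3)] by linarith
  obtain F where F: "factorizes A F" "size F = 5" using assms(3) by (auto simp: lens_def)
  have "\<exists>g. Y = {#g, g#}" if Y: "Y \<in># F" for Y
  proof -
    obtain F' where F': "F = add_mset Y F'" using Y by (meson multi_member_split)
    have "factorizes (\<Sum>\<^sub># F') F'" "A = Y + \<Sum>\<^sub># F'" using F(1) F' by (auto simp: factorizes_def)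
    then have "2 * 4 \<le> size (\<Sum>\<^sub># F')" using factorizes_size(1)[of "\<Sum>\<^sub># F'" F'] A F(2) F' by auto
    then have "size Y \<le> 2" using sz \<open>A = Y + \<Sum>\<^sub># F'\<close> by simp
    have "zero_sum_atom Y" "0 \<notin># Y" using F(1) Y A by (auto simp: factorizes_def)
    then show ?thesis
    proof (cases rule: atom_size_cases)
      case (set C) then show ?thesis using \<open>size Y \<le> 2\<close> by simp
    qed auto
  qed
  then obtain D where D: "A = D + D" using double_of_squares[of F] F(1) by (auto simp: factorizes_def)
  obtain G where G: "factorizes A G" "size G = Suc 1" using assms(2) by (auto simp: lens_def numeral_2_eq_2)
  obtain Y G' where Y: "G = add_mset Y G'" using size_eq_Suc_imp_eq_union[OF G(2)] by blast
  then have "size G' = 1" using G(2) by simp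
  then obtain Z where Z: "G' = {#Z#}" by (blast dest: size_1_singleton_mset)
  have at: "zero_sum_atom Y" "zero_sum_atom Z" "A = Y + Z" using G(1) Y Z by (auto simp: factorizes_def)
  have n0: "0 \<notin># Y" "0 \<notin># Z" using at(3) A by auto
  have s5: "size Y = 5" "size Z = 5" using atom_size[OF at(1) n0(1)] atom_size[OF at(2) n0(2)] sz at(3) by simp_all
  obtain U where U: "zset U" "Y = MS U" using at(1) n0(1) by (cases rule: atom_size_cases) (use s5 in auto)
  obtain V where V: "zset V" "Z = MS V" using at(2) n0(2) by (cases rule: atom_size_cases) (use s5 in auto)
  have "U = V"
  proof (intro set_eqI)
    fix x
    have "count (MS U + MS V) x = count (D + D) x" using D at(3) U V by simp
    then have "even (count (MS U) x + count (MS V) x)" by simp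
    then show "x \<in> U \<longleftrightarrow> x \<in> V" by (auto simp: count_mset_set' split: if_splits)
  qed
  obtain X where X: "theta X U" using theta_exists[OF U(1)] s5(1) U(2) by auto
  note t = X[unfolded theta_def] and tt = theta_third[OF X]
  have "X \<inter> U \<noteq> {}" "X - U \<noteq> {}" "U - X \<noteq> {}"
    using t tt(3,4) by (metis card.empty zero_neq_numeral zero_neq_one)+
  then obtain p s q where "p \<in> X \<inter> U" "s \<in> X - U" "q \<in> U - X" by blast
  \<comment> \<open>U^2 has multiplicity 2 on the two paths that make up \<open>U\<close> and 0 on
    the third.\<close>
  then have "lens (theta_mset X U 2 0 2 + ({#} + {#})) = theta_lens 2 0 2 (size ({#} :: c2_4 multiset))"
    by (intro theta_lens_formula[OF X]) auto
  moreover have "theta_mset X U 2 0 2 + ({#} + {#}) = A"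
    unfolding at(3) U V \<open>U = V\<close> by (rule multiset_eqI) (auto simp: theta_mset_def count_mset_set')
  ultimately have "3 \<in> theta_lens 2 0 2 0" using 3 by simp
  then obtain a b c where "feas 2 0 2 a b c" "2 * 3 + (3 * a + 2 * b + c) = (3 * 2 + 2 * 2 + 0 + 2 * 0 :: nat)"
    unfolding theta_lens_def by blast
  then have "3 * a = 4" by (auto simp: feas_def)
  then show False by presburger
qed

lemma interval_system:
  assumes A: "0 \<notin># A" and L: "lens A = {m..M}" "m \<le> M"
  shows "(+) j ` lens A \<in> L1 \<union> L3"
proof (cases "m = M")
  case True
  then show ?thesis using L by (auto simp: L1_def)
next
  case False
  then obtain k where k: "M = m + k" "1 \<le> k" using L(2) by (metis le_Suc_ex add_cancel_left_right less_one not_le)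
  have mem: "m \<in> lens A" "M \<in> lens A" using L by auto
  have "2 * k \<le> 3 * m" using lens_bounded[OF A mem(1)] lens_bounded[OF A mem(2)] k by linarith
  have "m \<noteq> 1" using lens_one[OF _ mem(2) A] mem(1) k by auto
  then have m2: "2 \<le> m" using \<open>2 * k \<le> 3 * m\<close> k(2) by linarith
  have "3 \<le> m" if "k = 3"
  proof (rule ccontr)
    assume "\<not> 3 \<le> m"
    then have "m = 2" using m2 by simp
    then have "lens A = {2..5}" using L(1) k(1) that by simp
    then show False using lens_two_five[OF A] by simp
  qed
  moreover have "(+) j ` lens A = {j + m..j + m + k}" unfolding L(1) k(1) image_add_atLeastAtMost by (simp add: ac_simps)
  ultimately have "(+) j ` lens A \<in> L3_alt" unfolding L3_alt_iff using m2 k(2) \<open>2 * k \<le> 3 * m\<close>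
    by (intro exI[of _ "j + m"] exI[of _ k]) auto
  then show ?thesis by (simp add: L3_eq_L3_alt)
qed

section \<open>Supports in a nontrivial coset\<close>

text \<open>Modulo \<open>N\<close> every element of \<open>C\<close> equals \<open>a\<close>, and
  two copies of \<open>a\<close> cancel.\<close>

lemma coset_sum:
  assumes "0 \<in> N" "\<forall>x\<in>N. \<forall>y\<in>N. x + y \<in> N" "\<forall>x\<in>C. a + x \<in> N"
  shows "if even (card C) then \<Sum>C \<in> N else a + \<Sum>C \<in> (N :: c2_4 set)"
  using finite[of C] assms(3)
proof (induction C rule: finite_induct)
  case empty then show ?case using assms(1) by simp
next
  case (insert x C)
  have ax: "a + x \<in> N" using insert by simp
  show ?case
  proof (cases "even (card C)")
    case True
    then have "(a + x) + \<Sum>C \<in> N" using insert ax assms(2) by simp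
    then show ?thesis using True insert by (simp add: ac_simps)
  next
    case False
    then have "a + \<Sum>C \<in> N" using insert by simp
    then have "(a + x) + (a + \<Sum>C) \<in> N" using ax assms(2) by blast
    moreover have "(a + x) + (a + \<Sum>C) = a + (a + (x + \<Sum>C))" by (simp only: ac_simps)
    then have "(a + x) + (a + \<Sum>C) = x + \<Sum>C" by (simp only: add_self_left)
    ultimately have "x + \<Sum>C \<in> N" by (simp only:)
    then show ?thesis using False insert by simp
  qed
qed

lemma affine_even:
  assumes "affine_supp A" "zset C" "C \<subseteq> set_mset A" shows "even (card C)"
proof (rule ccontr)
  assume "odd (card C)"
  obtain N a where N: "0 \<in> N" "\<forall>x\<in>N. \<forall>y\<in>N. x + y \<in> N" "a \<notin> N" "\<forall>x\<in>#A. a + x \<in> N"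
    using assms(1) unfolding affine_supp_def by blast
  have "\<forall>x\<in>C. a + x \<in> N" using N(4) assms(3) by blast
  from coset_sum[OF N(1,2) this] have "a + \<Sum>C \<in> N" using \<open>odd (card C)\<close> by simp
  then show False using N(3) assms(2) by (simp add: zset_def)
qed

text \<open>Circuits in the support have even cardinality, so none has five elements.\<close>

lemma affine_size:
  assumes "affine_supp A" "0 \<notin># A" "factorizes A F" shows "size A \<le> 4 * size F"
proof -
  have "size Y \<le> 4" if Y: "Y \<in># F" for Y
  proof -
    have sub: "set_mset Y \<subseteq> set_mset A" using supp_factorizes[OF assms(3)] Y by blast
    have "zero_sum_atom Y" "0 \<notin># Y" using assms(2,3) Y by (auto simp: factorizes_def)
    then show ?thesis
    proof (cases rule: atom_size_cases)
      case (set C)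
      then have "even (card C)" using affine_even[OF assms(1) set(1)] sub by simp
      then have "card C \<noteq> 5" by auto
      then show ?thesis using set by simp
    qed simp
  qed
  then have "size (\<Sum>\<^sub># F) \<le> 4 * size F" by (induction F) fastforce+
  moreover have "A = \<Sum>\<^sub># F" using assms(3) by (simp add: factorizes_def)
  ultimately show ?thesis by (simp only:)
qed

text \<open>Any gap is located two below \<open>size D\<close> by \<open>gap_theorem\<close>, so
  none lies below \<open>n\<close>. The bound on \<open>m\<close> is |A| = 2(n + 2) \<le> 4m, by
  \<open>affine_size\<close>.\<close>

lemma affine_gap:
  assumes A: "0 \<notin># A" "affine_supp A" "\<not> theta_supp A" and D: "A = D + D" 
    and gap: "n + 2 = size D" "n \<in> lens A" "Suc n \<notin> lens A"
  obtains m where "m \<le> n" "n + 2 \<le> 2 * m" "lens A = {m..n} \<union> {n + 2}"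
proof -
  have fin: "finite (lens A)"
    by (rule finite_subset[of _ "{..size A}"]) (auto dest!: lens_bounded[OF A(1)])
  define m where "m = Min (lens A)"
  have m: "m \<in> lens A" "\<And>l. l \<in> lens A \<Longrightarrow> m \<le> l" using fin gap(2) by (auto simp: m_def intro!: Min_in)
  have top: "n + 2 \<in> lens A" using lens_double[of D] D gap(1) A(1) by auto
  have max: "l \<le> n + 2" if "l \<in> lens A" for l using lens_bounded[OF A(1) that] D gap(1) by simp
  have step: "Suc l \<in> lens A" if l: "l \<in> lens A" "m \<le> l" "l < n" for l
  proof (rule ccontr)
    assume "Suc l \<notin> lens A"
    from gap_theorem[OF A(1) l(1) this top] l(3) A(3) obtain D' where "A = D' + D'" "size D' = l + 2"
      by (auto simp: gap_conclusion_def)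
    then have "size (D + D) = size (D' + D')" using D by simp
    then have "size D = l + 2" using \<open>size D' = l + 2\<close> by simp
    then show False using gap(1) l(3) by simp
  qed
  have "lens A = {m..n} \<union> {n + 2}"
  proof (intro set_eqI iffI)
    fix l assume l: "l \<in> lens A"
    then have "l \<noteq> Suc n" using gap(3) by blast
    then show "l \<in> {m..n} \<union> {n + 2}" using max[OF l] m(2)[OF l] by auto
  next
    fix l assume "l \<in> {m..n} \<union> {n + 2}"
    then show "l \<in> lens A" using top stepwise_upto[of "lens A" m n, OF step m(1)] by auto
  qed
  moreover obtain F where F: "factorizes A F" "size F = m" using m(1) by (auto simp: lens_def)
  then have "n + 2 \<le> 2 * m" using affine_size[OF A(2,1) F(1)] D gap(1) by simp
  ultimately show thesis using that m(2)[OF gap(2)] by blast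
qed

lemma lens_in_system:
  assumes A: "0 \<notin># A" "\<Sum>\<^sub># A = 0"
  shows "(+) j ` lens A \<in> L1 \<union> L2 \<union> L3 \<union> L4 \<union> L5 \<union> L6 \<union> L7 \<union> L8"
proof -
  have fin: "finite (lens A)"
    by (rule finite_subset[of _ "{..size A}"]) (auto dest!: lens_bounded[OF A(1)])
  have ne: "lens A \<noteq> {}" using ex_factorizes[OF A(2)] by (auto simp: lens_def)
  show ?thesis
  proof (cases "stepwise (lens A)")
    case True
    from interval_system[OF A(1) stepwise_interval[OF fin ne True]] show ?thesis by blast
  next
    case False
    then obtain n k where nk: "n \<in> lens A" "k \<in> lens A" "n < k" "Suc n \<notin> lens A" by (auto simp: stepwise_def)
    have gc: "gap_conclusion A n" by (rule gap_theorem[OF A(1) nk(1,4,2,3)])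
    show ?thesis
    proof (cases "theta_supp A")
      case True
      then obtain P S Q y where eq: "lens A = theta_lens P S Q y"
        unfolding theta_supp_def using theta_representation A(2) by blast
      obtain a b c where "feas P S Q a b c" using ne unfolding eq theta_lens_def by blast
      then have "even (P + S + Q)" unfolding feas_def by presburger
      from theta_lens_class[OF this, of y] have "lens A \<in> L2 \<union> L4 \<union> L6 \<union> L7 \<union> L8"
        using False eq by simp
      then show ?thesis using shift_L2 shift_L4 shift_L6 shift_L7 shift_L8 by blast
    next
      case nt: False
      then obtain D where D: "affine_supp A" "A = D + D" "size D = n + 2" using gc by (auto simp: gap_conclusion_def)
      obtain m where m: "m \<le> n" "n + 2 \<le> 2 * m" "lens A = {m..n} \<union> {n + 2}"
        using affine_gap[OF A(1) D(1) nt D(2) D(3)[symmetric] nk(1,4)] by blast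
      show ?thesis
      proof (cases "m = n")
        case True
        \<comment> \<open>The value k = 0, which \<open>L5\<close> does not admit, gives the
          two-element set {m, m + 2} of \<open>L4\<close>.\<close>
        have "lens A = (\<lambda>i. m + 2 * i) ` {..1}" using m(3) True by (auto simp: atMost_Suc)
        moreover have "2 * 1 \<le> m" using m(2) True by simp
        ultimately have "lens A \<in> L4" unfolding L4_iff by blast
        then show ?thesis using shift_L4 by blast
      next
        case False
        then obtain k where k: "n = m + k" "1 \<le> k" using m(1) by (metis le_Suc_ex add_cancel_left_right less_one not_le)
        have "lens A = {m..m + k} \<union> {m + k + 2}" using m(3) k by simp
        moreover have "k + 2 \<le> m" using m(2) k by simp
        ultimately have "lens A \<in> L5" unfolding L5_iff using k(2) by blast
        then show ?thesis using shift_L5 by blast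
      qed
    qed
  qed
qed


section \<open>Every member of the families is a set of lengths\<close>

definition realized :: "nat set \<Rightarrow> bool" where
  "realized L \<longleftrightarrow> (\<exists>A :: c2_4 multiset. \<Sum>\<^sub># A = 0 \<and> lens A = L)"

lemma realized_shift: "realized L \<Longrightarrow> realized ((+) j ` L)"
proof -
  assume "realized L"
  then obtain A :: "c2_4 multiset" where A: "\<Sum>\<^sub># A = 0" "lens A = L" by (auto simp: realized_def)
  have "\<Sum>\<^sub># (replicate_mset j 0 + A) = 0" using A(1) by (induction j) simp_all
  then show ?thesis unfolding realized_def using lens_replicate_zero[of j A] A(2) by blast
qed

section \<open>Explicit circuits over a basis\<close>

lemma ex_notin: "card S < 16 \<Longrightarrow> \<exists>x. x \<notin> (S :: c2_4 set)"
proof (rule ccontr)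
  assume "card S < 16" "\<nexists>x. x \<notin> S"
  then have "S = UNIV" by auto
  then show False using \<open>card S < 16\<close> card_c2_4 by (metis less_irrefl)
qed

text \<open>All 15 nonempty sums are listed, bracketed to the right as the simplifier normalizes
  them; their being nonzero makes a, b, c, d a basis.\<close>

definition independent4 :: "c2_4 \<Rightarrow> c2_4 \<Rightarrow> c2_4 \<Rightarrow> c2_4 \<Rightarrow> bool" where
  "independent4 a b c d \<longleftrightarrow> 0 \<notin> {a, b, c, d, a + b, a + c, a + d, b + c, b + d, c + d,
     a + (b + c), a + (b + d), a + (c + d), b + (c + d), a + (b + (c + d))}"

lemma ex_independent4: "\<exists>a b c d. independent4 a b c d"
proof -
  obtain a :: c2_4 where a: "a \<notin> {0}" using ex_notin[of "{0}"] by auto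
  have le: "card (set xs) \<le> length xs" for xs :: "c2_4 list" by (rule card_length)
  obtain b where b: "b \<notin> {0, a}" using ex_notin[of "{0, a}"] le[of "[0, a]"] by auto
  obtain c where c: "c \<notin> {0, a, b, a + b}" using ex_notin[of "{0, a, b, a + b}"] le[of "[0, a, b, a + b]"] by auto
  have "card {0, a, b, a + b, c, a + c, b + c, a + (b + c)} < 16"
    using le[of "[0, a, b, a + b, c, a + c, b + c, a + (b + c)]"] by simp
  then obtain d where d: "d \<notin> {0, a, b, a + b, c, a + c, b + c, a + (b + c)}" using ex_notin by blast
  have z: "x + y = 0 \<longleftrightarrow> y = x" for x y :: c2_4 by (metis eq_iff_add_zero)
  have "independent4 a b c d" unfolding independent4_def
    using a b c d z[of a b] z[of a c] z[of a d] z[of b c] z[of b d] z[of c d]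
      z[of "a + b" c] z[of "a + b" d] z[of "a + c" d] z[of "b + c" d] z[of "a + (b + c)" d]
    by (simp add: add.assoc)
  then show ?thesis by blast
qed

lemma independent4_ne: "independent4 a b c d \<Longrightarrow> x + y \<in> {a, b, c, d, a + b, a + c, a + d, b + c, b + d, c + d,
     a + (b + c), a + (b + d), a + (c + d), b + (c + d), a + (b + (c + d))} \<Longrightarrow> x \<noteq> y"
  unfolding independent4_def by (metis add_self)

text \<open>Coordinates are used here once and for all. \<open>U\<close> is a basis together with
  its total sum. \<open>X\<close> and \<open>Z\<close> consist of sums of oddly many basis elements,
  and the subgroup in the coset condition consists of the sums of evenly many.\<close>

lemma circuits_exist:
  obtains U V Y X Z where "zset U" "card U = 5" "zset V" "card V = 5" "card (U \<inter> V) = 3"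
    "zset Y" "card Y = 4" "card (U \<inter> Y) = 2" "zset X" "card X = 4" "zset Z" "card Z = 4" "card (X \<inter> Z) = 2"
    "\<exists>N a. 0 \<in> N \<and> (\<forall>x\<in>N. \<forall>y\<in>N. x + y \<in> N) \<and> a \<notin> N \<and> (\<forall>x\<in>X \<union> Z. a + x \<in> N)"
    "\<exists>W. zset W \<and> card W = 5 \<and> card (U \<inter> W) = 2"
proof -
  obtain a b c d :: c2_4 where i: "independent4 a b c d" using ex_independent4 by blast
  let ?e = "a + (b + (c + d))"
  have D1: "distinct [0, a, b, c, d, a + b, a + c, a + d, b + c, b + d, c + d, a + (b + c), a + (b + d), a + (c + d), b + (c + d), ?e]"
    unfolding distinct.simps list.set insert_iff empty_iff de_Morgan_disj simp_thms
    by (intro conjI; rule independent4_ne[OF i]; simp add: ac_simps)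
  \<comment> \<open>The reversed list supplies every inequality in the opposite orientation.\<close>
  have D2: "distinct [?e, b + (c + d), a + (c + d), a + (b + d), a + (b + c), c + d, b + d, b + c, a + d, a + c, a + b, d, c, b, a, 0]"
    unfolding distinct.simps list.set insert_iff empty_iff de_Morgan_disj simp_thms
    by (intro conjI; rule independent4_ne[OF i]; simp add: ac_simps)
  note D = D1[unfolded distinct.simps list.set insert_iff empty_iff de_Morgan_disj simp_thms]
    D2[unfolded distinct.simps list.set insert_iff empty_iff de_Morgan_disj simp_thms]
  show thesis
  proof (rule that[of "{a, b, c, d, ?e}" "{a, b, c, a + d, b + (c + d)}" "{a, b, a + c, b + c}"
        "{a, b, c, a + (b + c)}" "{a, b, d, a + (b + d)}"])
    show "zset {a, b, c, d, ?e}" "card {a, b, c, d, ?e} = 5" by (simp_all add: zset_def ac_simps D)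
    show "zset {a, b, c, a + d, b + (c + d)}" "card {a, b, c, a + d, b + (c + d)} = 5" by (simp_all add: zset_def ac_simps D)
    have "{a, b, c, d, ?e} \<inter> {a, b, c, a + d, b + (c + d)} = {a, b, c}" by (auto simp: D)
    then show "card ({a, b, c, d, ?e} \<inter> {a, b, c, a + d, b + (c + d)}) = 3" by (simp add: D)
    show "zset {a, b, a + c, b + c}" "card {a, b, a + c, b + c} = 4" by (simp_all add: zset_def ac_simps D)
    have "{a, b, c, d, ?e} \<inter> {a, b, a + c, b + c} = {a, b}" by (auto simp: D)
    then show "card ({a, b, c, d, ?e} \<inter> {a, b, a + c, b + c}) = 2" by (simp add: D)
    show "zset {a, b, c, a + (b + c)}" "card {a, b, c, a + (b + c)} = 4" by (simp_all add: zset_def ac_simps D)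
    show "zset {a, b, d, a + (b + d)}" "card {a, b, d, a + (b + d)} = 4" by (simp_all add: zset_def ac_simps D)
    have "{a, b, c, a + (b + c)} \<inter> {a, b, d, a + (b + d)} = {a, b}" by (auto simp: D)
    then show "card ({a, b, c, a + (b + c)} \<inter> {a, b, d, a + (b + d)}) = 2" by (simp add: D)
    define N where "N = {0, a + b, a + c, a + d, b + c, b + d, c + d, ?e}"
    have "x + y \<in> N" if "x \<in> N" "y \<in> N" for x y
      using that unfolding N_def by (elim insertE emptyE; simp add: ac_simps)
    moreover have "a \<notin> N" by (simp add: N_def D)
    moreover have "a + x \<in> N" if "x \<in> {a, b, c, a + (b + c)} \<union> {a, b, d, a + (b + d)}" for x
      using that by (auto simp: N_def)
    moreover have "0 \<in> N" by (simp add: N_def)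
    ultimately show "\<exists>N a'. 0 \<in> N \<and> (\<forall>x\<in>N. \<forall>y\<in>N. x + y \<in> N) \<and> a' \<notin> N \<and>
        (\<forall>x\<in>{a, b, c, a + (b + c)} \<union> {a, b, d, a + (b + d)}. a' + x \<in> N)" by blast
    have W: "zset {a, b, a + c, b + d, c + d}" "card {a, b, a + c, b + d, c + d} = 5"
      by (simp_all add: zset_def ac_simps D)
    have "{a, b, c, d, ?e} \<inter> {a, b, a + c, b + d, c + d} = {a, b}" by (auto simp: D)
    then have "card ({a, b, c, d, ?e} \<inter> {a, b, a + c, b + d, c + d}) = 2" by (simp add: D)
    with W show "\<exists>W. zset W \<and> card W = 5 \<and> card ({a, b, c, d, ?e} \<inter> W) = 2" by blast
  qed
qed

text \<open>The three paths of a theta have the same sum, so with constant multiplicities along them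
  the total is zero exactly when an even number of these multiplicities is odd.\<close>

lemma realized_theta_lens: "even (P + S + Q) \<Longrightarrow> realized (theta_lens P S Q y)"
proof -
  assume ev: "even (P + S + Q)"
  have "\<exists>U. zset U \<and> card U = 5" by (rule circuits_exist) (rule exI, rule conjI, assumption+)
  then obtain U where "zset U" "card U = 5" by blast
  then obtain X where X: "theta X U" using theta_exists by blast
  note t = X[unfolded theta_def] and tt = theta_third[OF X]
  obtain p p' where p: "p \<in> X \<inter> U" "p' \<in> X \<inter> U" "p' \<noteq> p"
  proof -
    have "card (X \<inter> U) = 3" using t by simp
    then obtain u v w where "X \<inter> U = {u, v, w}" "u \<noteq> v" by (auto simp: card_3_iff)
    then show thesis using that[of u v] by auto
  qed
  have "X - U \<noteq> {}" "U - X \<noteq> {}" using tt(3,4) by (metis card.empty zero_neq_numeral zero_neq_one)+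
  then obtain s q where sq: "s \<in> X - U" "q \<in> U - X" by blast
  \<comment> \<open>The extra pairs are put on a second element of the path with three elements, so
    that \<open>p\<close> stays free of them.\<close>
  define E where "E = replicate_mset y p'"
  have E: "set_mset E \<subseteq> {p'}" "size E = y" by (auto simp: E_def)
  have "lens (theta_mset X U P S Q + (E + E)) = theta_lens P S Q (size E)"
    by (rule theta_lens_formula[OF X p(1) _ sq(1) _ sq(2)]) (use E p sq in auto)
  moreover have "\<Sum>\<^sub># (theta_mset X U P S Q + (E + E)) = 0"
  proof -
    have "\<Sum>(X - U) = \<Sum>(X \<inter> U)" "\<Sum>(U - X) = \<Sum>(X \<inter> U)"
      using sum_Diff_c2_4[of "X \<inter> U" X] sum_Diff_c2_4[of "X \<inter> U" U] t by (simp_all add: zset_def Diff_Int)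
    then have "\<Sum>\<^sub># (theta_mset X U P S Q + (E + E)) = (if even P then 0 else \<Sum>(X \<inter> U))
        + (if even S then 0 else \<Sum>(X \<inter> U)) + (if even Q then 0 else \<Sum>(X \<inter> U))"
      unfolding theta_mset_def sum_mset.union sum_mset_repeat by simp
    moreover consider "even P" "even S" "even Q" | "even P" "odd S" "odd Q" | "odd P" "even S" "odd Q" | "odd P" "odd S" "even Q"
      using ev by auto
    then have "(if even P then 0 else \<Sum>(X \<inter> U)) + (if even S then 0 else \<Sum>(X \<inter> U))
        + (if even Q then 0 else \<Sum>(X \<inter> U)) = 0"
      by cases (simp_all only: if_True if_False add_0_left add_0_right add_self not_True_eq_False not_False_eq_True)
    ultimately show ?thesis by (simp only:)
  qed
  ultimately show ?thesis unfolding realized_def E(2) by blast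
qed

lemma realized_L2: "X \<in> L2 \<Longrightarrow> realized X"
proof -
  assume "X \<in> L2"
  then obtain m k where mk: "2 * k \<le> m" "X = (\<lambda>i. m + 3 * i) ` {..k}" unfolding L2_iff by blast
  \<comment> \<open>U^(2k) with \<open>m - 2 * k\<close> further squares.\<close>
  have "theta_lens (2 * k) 0 (2 * k) (m - 2 * k) = (\<lambda>i. m + 3 * i) ` {..2 * k div 2}"
    by (rule theta_lens_S0) (use mk(1) in simp_all)
  then show ?thesis using realized_theta_lens[of "2 * k" 0 "2 * k" "m - 2 * k"] mk(2) by simp
qed

lemma realized_L4: "X \<in> L4 \<Longrightarrow> realized X"
proof -
  assume "X \<in> L4"
  then obtain m k where mk: "2 * k \<le> m" "X = (\<lambda>i. m + 2 * i) ` {..k}" unfolding L4_iff by blast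
  \<comment> \<open>The same with X^(2k) for the 4-circuit \<open>X\<close>.\<close>
  have "theta_lens (2 * k) (2 * k) 0 (m - 2 * k) = (\<lambda>i. m + 2 * i) ` {..2 * k div 2}"
    by (rule theta_lens_Q0) (use mk(1) in simp_all)
  then show ?thesis using realized_theta_lens[of "2 * k" "2 * k" 0 "m - 2 * k"] mk(2) by simp
qed

lemma realized_L6: "X \<in> L6 \<Longrightarrow> realized X"
proof -
  assume "X \<in> L6"
  then obtain m k where k: "k = 3 \<or> 5 \<le> k" and m: "2 * ((k + 2) div 3) + 2 \<le> m" and X: "X = {m} \<union> {m + 2..m + k + 2}"
    unfolding L6_iff by blast
  define t where "t = (k + 2) div 3"
  have "k + 2 = 3 * t \<or> k + 2 = 3 * t + 1 \<or> k + 2 = 3 * t + 2" unfolding t_def by presburger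
  then consider (zero) "k + 2 = 3 * t" | (one) "k + 2 = 3 * t + 1" | (two) "k + 2 = 3 * t + 2" by blast
  \<comment> \<open>The multiplicities will be 2q and 2s on the two shorter paths and their sum on
    the long one. The maximum requires 3q + 2s = k + 2, and the least admissible minimum requires q
    + s = t + 1. The residue of k + 2 modulo 3 makes s equal to 3, 2 or 1; the remaining q is
    positive since k is not 1, 2 or 4.\<close>
  then obtain q s where qs: "1 \<le> q" "1 \<le> s" "k + 2 = 3 * q + 2 * s" "q + s = t + 1"
  proof cases
    case zero
    then have "3 \<le> t" using k by presburger
    then show thesis using zero by (intro that[of "t - 2" 3]) auto
  next
    case one
    then have "2 \<le> t" using k by presburger
    then show thesis using one by (intro that[of "t - 1" 2]) auto
  next
    case two
    then have "1 \<le> t" using k by presburger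
    then show thesis using two by (intro that[of t 1]) auto
  qed
  have "2 * q + 2 * s \<le> m" using m qs(4) by (simp add: t_def)
  then have "theta_lens (2 * q + 2 * s + 2 * 0) (2 * s) (2 * q) (m - (2 * q + 2 * s)) = {m} \<union> {m + 2..m + (k + 2)}"
    using qs by (intro theta_lens_bottom_gap_eq) (simp_all add: least_weight_def)
  then show ?thesis
    using realized_theta_lens[of "2 * q + 2 * s + 2 * 0" "2 * s" "2 * q" "m - (2 * q + 2 * s)"] X by (simp add: add.assoc)
qed

lemma realized_L7: "X \<in> L7 \<Longrightarrow> realized X"
proof -
  assume "X \<in> L7"
  then obtain m r where mr: "r < m" "X = alternating 1 m r" unfolding L7_iff by blast
  have "theta_lens r 1 (r + 1) (m - (r + 1)) = alternating 1 m r"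
    unfolding alternating_def by (rule theta_lens_S1_less) (use mr(1) in simp_all)
  then show ?thesis using realized_theta_lens[of r 1 "r + 1" "m - (r + 1)"] mr(2) by simp
qed

lemma realized_L8: "X \<in> L8 \<Longrightarrow> realized X"
proof -
  assume "X \<in> L8"
  then obtain m r where mr: "r < m" "X = alternating 2 m r" unfolding L8_iff by blast
  have "theta_lens (r + 1) 1 r (m - (r + 1)) = alternating 2 m r"
    unfolding alternating_def by (rule theta_lens_S1_greater[of _ _ 0]) (use mr(1) in simp_all)
  then show ?thesis using realized_theta_lens[of "r + 1" 1 r "m - (r + 1)"] mr(2) by simp
qed


section \<open>Realizing intervals with extremal endpoints\<close>

text \<open>Writes a square as a product of three circuits when the three sets are circuits, and so
  provides squares D + D made of an odd number of circuits.\<close>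

lemma MS_pair_union: "MS A + MS B + MS (A - B \<union> (B - A)) = MS (A \<union> B) + MS (A \<union> B)"
  by (rule multiset_eqI) (auto simp: count_mset_set')

text \<open>Neither outcome of \<open>gap_theorem\<close> is possible: a theta has only six
  elements, and a 5-circuit does not fit into a nontrivial coset. The bound on \<open>m\<close> says
  that it is |A|/5 rounded up, the least conceivable length, and \<open>size D\<close> is the
  greatest one.\<close>

lemma lens_interval:
  assumes A: "0 \<notin># A" "A = D + D" and U: "zset U" "card U = 5" "U \<subseteq> set_mset A" and "7 \<le> card (set_mset A)"
    and m: "m \<in> lens A" "5 * m < 2 * size D + 5"
  shows "lens A = {m..size D}"
proof -
  have fin: "finite (lens A)"
    by (rule finite_subset[of _ "{..size A}"]) (auto dest!: lens_bounded[OF A(1)])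
  have top: "size D \<in> lens A" using lens_double[of D] A by auto
  have nt: "\<not> theta_supp A"
  proof
    assume "theta_supp A"
    then obtain X V where X: "theta X V" "set_mset A \<subseteq> X \<union> V" unfolding theta_supp_def by blast
    have "card (X \<union> V) + card (X \<inter> V) = card X + card V" using card_Un_Int[of X V] by simp
    then have "card (X \<union> V) = 6" using X(1) by (simp add: theta_def)
    then show False using card_mono[OF _ X(2)] assms(6) by simp
  qed
  have na: "\<not> affine_supp A" using affine_even[OF _ U(1,3)] U(2) by auto
  have "stepwise (lens A)"
    unfolding stepwise_def
  proof (intro ballI impI, rule ccontr)
    fix l k assume "l \<in> lens A" "k \<in> lens A" "l < k" "Suc l \<notin> lens A"
    from gap_theorem[OF A(1) this(1,4,2,3)] show False using nt na by (simp add: gap_conclusion_def)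
  qed
  then have iv: "lens A = {Min (lens A)..Max (lens A)}" using stepwise_interval(1)[OF fin] m(1) by blast
  have "l \<le> size D" if "l \<in> lens A" for l using lens_bounded[OF A(1) that] A(2) by simp
  then have "Max (lens A) = size D" by (intro Max_eqI[OF fin _ top])
  moreover have "Min (lens A) = m"
  proof (rule Min_eqI[OF fin _ m(1)])
    fix l assume l: "l \<in> lens A"
    have "size A \<le> 5 * l" using lens_bounded[OF A(1) l] by simp
    then have "2 * size D \<le> 5 * l" using A(2) by simp
    then show "m \<le> l" using m(2) by linarith
  qed
  ultimately show ?thesis using iv by simp
qed

lemma lens_MS_one: "zset C \<Longrightarrow> C \<noteq> {} \<Longrightarrow> card C \<le> 5 \<Longrightarrow> 1 \<in> lens (MS C)"
  by (intro lens_atom atom_MS)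

lemma zero_sum_double: "\<Sum>\<^sub># (D + D) = (0 :: c2_4)"
  unfolding sum_mset.union by (rule add_self)

text \<open>The first three are squares of U^(j-1) times \<open>U \<union> V\<close>, of U^j Y and
  of U^j V. Each square is a product of as few circuits as its size permits, and its support has
  seven elements.\<close>

lemma realized_intervals:
  assumes "1 \<le> j"
  shows "realized {2 * j + 1..5 * j + 2}" "realized {2 * j + 2..5 * j + 4}" "realized {2 * j + 2..5 * j + 5}" "realized {2..4}"
proof -
  obtain U V Y W :: "c2_4 set" where U: "zset U" "card U = 5" and V: "zset V" "card V = 5" "card (U \<inter> V) = 3"
    and Y: "zset Y" "card Y = 4" "card (U \<inter> Y) = 2" and W: "zset W" "card W = 5" "card (U \<inter> W) = 2"
    by (rule circuits_exist) blast
  let ?Z = "U - V \<union> (V - U)"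
  have Z: "zset ?Z" "card ?Z = 4" using zset_symdiff[OF U(1) V(1)] card_symdiff[of U V] U V by simp_all
  have ne: "U \<noteq> {}" "V \<noteq> {}" "Y \<noteq> {}" "?Z \<noteq> {}" "W \<noteq> {}" using U(2) V(2) Y(2) Z(2) W(2) by (metis card.empty zero_neq_numeral)+
  have one: "1 \<in> lens (MS U)" "1 \<in> lens (MS V)" "1 \<in> lens (MS Y)" "1 \<in> lens (MS ?Z)" "1 \<in> lens (MS W)"
    using U V Y Z W ne by (auto intro!: lens_MS_one[unfolded One_nat_def])
  have cUV: "card (U \<union> V) = 7" using card_Un_Int[of U V] U V by simp
  have cUY: "card (U \<union> Y) = 7" using card_Un_Int[of U Y] U Y by simp
  have n0: "0 \<notin> U" "0 \<notin> V" "0 \<notin> Y" using U V Y by simp_all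
  have R: "repeat_mset (n + n) B = repeat_mset n B + repeat_mset n B" for n and B :: "c2_4 multiset"
    by (rule multiset_eqI) (simp add: algebra_simps)
  have sub: "set_mset (repeat_mset n B) \<subseteq> set_mset B" for n and B :: "c2_4 multiset"
    by (auto simp flip: count_greater_zero_iff)
  let ?r = "repeat_mset (j - 1) (MS U)"
  have rep: "k * 1 \<in> lens (repeat_mset k (MS U))" for k by (rule lens_repeat[OF one(1)])
  have j2: "j - 1 + (j - 1) = 2 * j - 2" by simp
  show "realized {2 * j + 1..5 * j + 2}"
  proof -
    define D where "D = ?r + MS (U \<union> V)"
    have A: "D + D = repeat_mset (2 * j - 2) (MS U) + (MS U + (MS V + MS ?Z))"
      unfolding D_def j2[symmetric] R using MS_pair_union[of U V] by (simp add: ac_simps)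
    have sz: "size D = 5 * j + 2" using assms cUV U by (simp add: D_def algebra_simps)
    have set: "set_mset (D + D) = U \<union> V" using sub[of "j - 1" "MS U"] by (auto simp: D_def)
    have "(2 * j - 2) * 1 + (1 + (1 + 1)) \<in> lens (D + D)"
      unfolding A by (intro lens_plus rep one)
    moreover have "(2 * j - 2) * 1 + (1 + (1 + 1)) = 2 * j + 1" using assms by simp
    ultimately have mem: "2 * j + 1 \<in> lens (D + D)" by (simp only:)
    have "lens (D + D) = {2 * j + 1..size D}"
      by (rule lens_interval[OF _ refl U]) (use n0 set cUV mem sz in auto)
    then show ?thesis unfolding realized_def sz using zero_sum_double by blast
  qed
  show "realized {2 * j + 2..5 * j + 4}"
  proof -
    define D where "D = repeat_mset j (MS U) + MS Y"
    have A: "D + D = repeat_mset (j + j) (MS U) + (MS Y + MS Y)"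
      unfolding D_def R by (simp add: ac_simps)
    have sz: "size D = 5 * j + 4" using Y U by (simp add: D_def)
    have "0 < j" using assms by simp
    then have set: "set_mset (D + D) = U \<union> Y" using sub[of j "MS U"] by (auto simp: D_def simp flip: count_greater_zero_iff)
    have "(j + j) * 1 + (1 + 1) \<in> lens (D + D)"
      unfolding A by (intro lens_plus rep one)
    then have mem: "2 * j + 2 \<in> lens (D + D)" by (simp add: mult_2)
    have "lens (D + D) = {2 * j + 2..size D}"
      by (rule lens_interval[OF _ refl U]) (use n0 set cUY mem sz in auto)
    then show ?thesis unfolding realized_def sz using zero_sum_double by blast
  qed
  show "realized {2 * j + 2..5 * j + 5}"
  proof -
    define D where "D = repeat_mset j (MS U) + MS V"
    have A: "D + D = repeat_mset (j + j) (MS U) + (MS V + MS V)"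
      unfolding D_def R by (simp add: ac_simps)
    have sz: "size D = 5 * j + 5" using V U by (simp add: D_def)
    have "0 < j" using assms by simp
    then have set: "set_mset (D + D) = U \<union> V" using sub[of j "MS U"] by (auto simp: D_def simp flip: count_greater_zero_iff)
    have "(j + j) * 1 + (1 + 1) \<in> lens (D + D)"
      unfolding A by (intro lens_plus rep one)
    then have mem: "2 * j + 2 \<in> lens (D + D)" by (simp add: mult_2)
    have "lens (D + D) = {2 * j + 2..size D}"
      by (rule lens_interval[OF _ refl U]) (use n0 set cUV mem sz in auto)
    then show ?thesis unfolding realized_def sz using zero_sum_double by blast
  qed
  show "realized {2..4}"
  proof -
    \<comment> \<open>Two common elements leave six, which split into two circuits; this gives
      length 4 besides 2 and 3. Length 5 is excluded because it cannot occur together with 2 and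
      3.\<close>
    let ?A = "MS U + MS W"
    have A0: "0 \<notin># ?A" and UW: "U \<noteq> W" using U W by auto
    have "1 + 1 \<in> lens ?A" by (intro lens_plus one)
    then have 2: "2 \<in> lens ?A" by (simp add: numeral_2_eq_2)
    have 3: "3 \<in> lens ?A" using pair_55[OF U W(1,2) UW] .
    have 4: "4 \<in> lens ?A" using U W UW by (intro lens_MS_add(2)) (simp_all add: zset_def)
    have "5 \<notin> lens ?A" using lens_two_five[OF A0 2] 3 by blast
    moreover have "size ?A = 10" using U W by simp
    ultimately have "2 \<le> l \<and> l \<le> 4" if "l \<in> lens ?A" for l
      using lens_bounded[OF A0 that] that by (cases "l = 5") auto
    then have "lens ?A = {2..4}"
    proof (intro set_eqI iffI)
      fix l :: nat assume "l \<in> {2..4}"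
      then consider "l = 2" | "l = 3" | "l = 4" by fastforce
      then show "l \<in> lens ?A" using 2 3 4 by cases simp_all
    qed simp
    moreover have "\<Sum>\<^sub># ?A = 0" using U W by (simp add: zset_def)
    ultimately show ?thesis unfolding realized_def by blast
  qed
qed

text \<open>The squares of a 3-circuit and of the six-element union of a theta. They serve the two
  exceptional values of \<open>k\<close>, for which the least minimum exceeds 2k/3 rounded
  up.\<close>

lemma realized_small_intervals: "realized {2..3}" "realized {3..6}"
proof -
  have "theta_lens 0 2 2 0 = {2..3}"
  proof (intro set_eqI iffI)
    fix l assume "l \<in> theta_lens 0 2 2 0"
    then obtain a b c where "feas 0 2 2 a b c" "2 * l + (3 * a + 2 * b + c) = (6 :: nat)"
      unfolding theta_lens_def by auto
    then have "2 * l + c = 6" "c \<le> 2" by (auto simp: feas_def)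
    then show "l \<in> {2..3}" by auto
  next
    fix l :: nat assume "l \<in> {2..3}"
    then have "l = 2 \<or> l = 3" by auto
    then show "l \<in> theta_lens 0 2 2 0"
      using theta_lensI[of 0 2 2 0 0 2 2 0] theta_lensI[of 0 2 2 0 0 0 3 0] by (auto simp: feas_def)
  qed
  then show "realized {2..3}" using realized_theta_lens[of 0 2 2 0] by simp
  have "theta_lens 2 2 2 0 = {3..6}"
  proof (intro set_eqI iffI)
    fix l assume "l \<in> theta_lens 2 2 2 0"
    then obtain a b c where f: "feas 2 2 2 a b c" "2 * l + (3 * a + 2 * b + c) = (12 :: nat)"
      unfolding theta_lens_def by auto
    then have "a + b \<le> 2" "b + c \<le> 2" "a + c \<le> 2" by (simp_all add: feas_def)
    then show "l \<in> {3..6}" using f(2) by simp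
  next
    fix l :: nat assume "l \<in> {3..6}"
    then have "l = 3 \<or> l = 4 \<or> l = 5 \<or> l = 6" by auto
    then show "l \<in> theta_lens 2 2 2 0"
      using theta_lensI[of 2 2 2 2 0 0 3 0] theta_lensI[of 2 2 2 0 2 0 4 0]
        theta_lensI[of 2 2 2 0 0 2 5 0] theta_lensI[of 2 2 2 0 0 0 6 0] by (auto simp: feas_def)
  qed
  then show "realized {3..6}" using realized_theta_lens[of 2 2 2 0] by simp
qed

lemma realized_L3: "X \<in> L3 \<Longrightarrow> realized X"
proof -
  assume "X \<in> L3"
  then obtain m k where mk: "X = {m..m + k}" "1 \<le> k" "2 * k \<le> 3 * m" "k = 1 \<longrightarrow> 2 \<le> m" "k = 3 \<longrightarrow> 3 \<le> m"
    unfolding L3_eq_L3_alt L3_alt_iff by blast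
  have "\<exists>m'. m' \<le> m \<and> realized {m'..m' + k}"
  proof -
    consider "k = 1" | "k = 2" | "k = 3" | "4 \<le> k" using mk(2) by linarith
    then show ?thesis
    proof cases
      case 1 then show ?thesis using mk realized_small_intervals(1) by (intro exI[of _ 2]) simp
    next
      case 2 then show ?thesis using mk realized_intervals(4)[OF order_refl] by (intro exI[of _ 2]) simp
    next
      case 3 then show ?thesis using mk realized_small_intervals(2) by (intro exI[of _ 3]) simp
    next
      case 4
      \<comment> \<open>So k is 3j + 1, 3j + 2 or 3j + 3, and 2k/3 rounded up is 2j + 1, 2j + 2 or
        2j + 2.\<close>
      define j where "j = (k - 1) div 3"
      have "1 \<le> j" using 4 by (simp add: j_def)
      have "k = 3 * j + 1 \<or> k = 3 * j + 2 \<or> k = 3 * j + 3" using 4 unfolding j_def by presburger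
      then show ?thesis
      proof (elim disjE)
        assume k: "k = 3 * j + 1"
        then have "2 * j + 1 \<le> m" "2 * j + 1 + k = 5 * j + 2" using mk(3) by linarith+
        then show ?thesis using realized_intervals(1)[OF \<open>1 \<le> j\<close>] by metis
      next
        assume k: "k = 3 * j + 2"
        then have "2 * j + 2 \<le> m" "2 * j + 2 + k = 5 * j + 4" using mk(3) by linarith+
        then show ?thesis using realized_intervals(2)[OF \<open>1 \<le> j\<close>] by metis
      next
        assume k: "k = 3 * j + 3"
        then have "2 * j + 2 \<le> m" "2 * j + 2 + k = 5 * j + 5" using mk(3) by linarith+
        then show ?thesis using realized_intervals(3)[OF \<open>1 \<le> j\<close>] by metis
      qed
    qed
  qed
  then obtain m' where m': "m' \<le> m" "realized {m'..m' + k}" by blast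
  have "(+) (m - m') ` {m'..m' + k} = X" unfolding image_add_atLeastAtMost mk(1) using m'(1) by simp
  then show ?thesis using realized_shift[OF m'(2), of "m - m'"] by simp
qed

section \<open>Squares supported in a nontrivial coset\<close>

text \<open>All atoms have two or four elements. At one below \<open>size D\<close>, counting
  elements allows exactly one 4-circuit besides squares, and its elements would have odd
  multiplicity in \<open>D + D\<close>.\<close>

lemma affine_double_missing_length:
  assumes A: "0 \<notin># A" "affine_supp A" "A = D + D" shows "size D - 1 \<notin> lens A \<or> size D = 0"
proof (rule ccontr)
  assume "\<not> ?thesis"
  then have "size D - 1 \<in> lens A" and "size D \<noteq> 0" by auto
  then obtain F where "factorizes A F" "size F = size D - 1" by (auto simp: lens_def)
  moreover from this have "size D = Suc (size F)" using \<open>size D \<noteq> 0\<close> by linarith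
  ultimately have F: "factorizes A F" "size D = Suc (size F)" by blast+
  have at: "zero_sum_atom Y" "0 \<notin># Y" "set_mset Y \<subseteq> set_mset A" if "Y \<in># F" for Y
    using F(1) that A(1) supp_factorizes[OF F(1)] by (auto simp: factorizes_def)
  have AF: "A = \<Sum>\<^sub># F" using F(1) by (simp add: factorizes_def)
  have "\<exists>Y. Y \<in># F \<and> (\<nexists>g. Y = {#g, g#})"
  proof (rule ccontr)
    assume "\<not> ?thesis"
    then obtain E where "\<Sum>\<^sub># F = E + E" "size E = size F" using double_of_squares[of F] by auto
    then have "size (D + D) = size (E + E)" using AF A(3) by simp
    then show False using F(2) \<open>size E = size F\<close> by simp
  qed
  then obtain Y F' where Y: "F = add_mset Y F'" "\<nexists>g. Y = {#g, g#}" by (meson multi_member_split)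
  have "Y \<in># F" using Y by simp
  obtain C where C: "zset C" "3 \<le> card C" "card C \<le> 5" "Y = MS C"
    using at(1,2)[OF \<open>Y \<in># F\<close>] by (cases rule: atom_size_cases) (use Y(2) in auto)
  have "even (card C)" using affine_even[OF A(2) C(1)] at(3)[OF \<open>Y \<in># F\<close>] C(4) by simp
  then have c4: "card C = 4" using C(2,3) by presburger
  have B: "factorizes (\<Sum>\<^sub># F') F'" "A = MS C + \<Sum>\<^sub># F'" using F(1) Y C by (auto simp: factorizes_def)
  \<comment> \<open>The 4-circuit uses up the whole surplus of \<open>size A\<close> over
    \<open>2 * size F\<close>, so the atoms of \<open>F'\<close> have two elements on average and
    hence exactly.\<close>
  have "size A = 2 * Suc (Suc (size F'))" using A(3) F(2) Y by simp
  then have szF': "size (\<Sum>\<^sub># F') = 2 * size F'" using B(2) c4 by simp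
  have "\<exists>g. Z = {#g, g#}" if Z: "Z \<in># F'" for Z
  proof -
    obtain F'' where F'': "F' = add_mset Z F''" using Z by (meson multi_member_split)
    have f: "factorizes (\<Sum>\<^sub># F'') F''" using B(1) F'' by (simp add: factorizes_def)
    have "0 \<notin># \<Sum>\<^sub># F''" using A(1) B(2) F'' by auto
    from factorizes_size(1)[OF f this] have "size Z \<le> 2" using szF' F'' by simp
    have "zero_sum_atom Z" "0 \<notin># Z" using at Z Y(1) by simp_all
    then show ?thesis
    proof (cases rule: atom_size_cases)
      case (set C) then show ?thesis using \<open>size Z \<le> 2\<close> by simp
    qed auto
  qed
  then obtain E where E: "\<Sum>\<^sub># F' = E + E" using double_of_squares[of F'] by blast
  have "C \<noteq> {}" using c4 by auto
  then obtain x where "x \<in> C" by blast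
  have "count (D + D) x = count (MS C + (E + E)) x" using A(3) B(2) E by simp
  then have "2 * count D x = 1 + 2 * count E x" using \<open>x \<in> C\<close> by simp
  then show False by presburger
qed

text \<open>A theta containing six support elements would be the whole support, including its
  3-circuit, against \<open>affine_even\<close>. Length 2m - 1 is missing by parity, 2m - 2 comes
  from C^2 R^2, and \<open>affine_gap\<close> forces the minimum to be at least m.\<close>

lemma lens_affine_double:
  assumes A: "0 \<notin># A" "affine_supp A" "A = D + D" and c: "6 \<le> card (set_mset A)"
    and m: "m \<in> lens A" "size D = 2 * m" "2 \<le> m" and Q: "zset C" "card C = 4" "A = MS C + MS C + (R + R)"
  shows "lens A = {m..2 * m - 2} \<union> {2 * m}"
proof -
  have nt: "\<not> theta_supp A"
  proof
    assume "theta_supp A"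
    then obtain X V where X: "theta X V" "set_mset A \<subseteq> X \<union> V" unfolding theta_supp_def by blast
    have "card (X \<union> V) + card (X \<inter> V) = card X + card V" using card_Un_Int[of X V] by simp
    then have "card (X \<union> V) = 6" using X(1) by (simp add: theta_def)
    then have "set_mset A = X \<union> V" using c X(2) \<open>card (X \<union> V) = 6\<close> by (metis card_seteq finite)
    then have "X - V \<union> (V - X) \<subseteq> set_mset A" by auto
    then have "even (card (X - V \<union> (V - X)))" using affine_even[OF A(2) theta_third(1)[OF X(1)]] by blast
    then show False using theta_third(2)[OF X(1)] by simp
  qed
  have ne: "C \<noteq> {}" using Q(2) by auto
  have R0: "0 \<notin># R" using A(1) Q(3) by auto
  have "size A = 4 + 4 + (size R + size R)" using Q(2,3) by simp
  then have sR: "size R + 4 = 2 * m" using A(3) m(2) by simp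
  have "1 + 1 + size R \<in> lens A" unfolding Q(3)
    using Q(1,2) ne R0 by (intro lens_plus lens_double lens_MS_one) auto
  moreover have "1 + 1 + size R = 2 * m - 2" using sR by linarith
  ultimately have n: "2 * m - 2 \<in> lens A" by (simp only:)
  have g: "2 * m - 2 + 2 = size D" using m(2,3) by simp
  have nS: "Suc (2 * m - 2) \<notin> lens A"
    using affine_double_missing_length[OF A] m(2,3) by (auto simp: Suc_diff_Suc numeral_2_eq_2)
  obtain m' where m': "m' \<le> 2 * m - 2" "2 * m - 2 + 2 \<le> 2 * m'" "lens A = {m'..2 * m - 2} \<union> {2 * m - 2 + 2}"
    by (rule affine_gap[OF A(1,2) nt A(3) g n nS])
  have "m' \<le> m" using m(1,3) m'(3) by auto
  then have "m' = m" using m'(2) m(3) by linarith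
  moreover have "2 * m - 2 + 2 = 2 * m" using m(3) by simp
  ultimately show ?thesis using m'(3) by (simp only:)
qed

lemma realized_L5: "X \<in> L5 \<Longrightarrow> realized X"
proof -
  assume "X \<in> L5"
  then obtain m0 k where mk: "1 \<le> k" "k + 2 \<le> m0" "X = {m0..m0 + k} \<union> {m0 + k + 2}" unfolding L5_iff by blast
  obtain C Y :: "c2_4 set" where C: "zset C" "card C = 4" and Y: "zset Y" "card Y = 4" "card (C \<inter> Y) = 2"
    and aff: "\<exists>N a. 0 \<in> N \<and> (\<forall>x\<in>N. \<forall>y\<in>N. x + y \<in> N) \<and> a \<notin> N \<and> (\<forall>x\<in>C \<union> Y. a + x \<in> N)"
    by (rule circuits_exist) blast
  let ?Z = "C - Y \<union> (Y - C)"
  have Z: "zset ?Z" "card ?Z = 4" using zset_symdiff[OF C(1) Y(1)] card_symdiff[of C Y] C Y by simp_all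
  have ne: "C \<noteq> {}" "Y \<noteq> {}" "?Z \<noteq> {}" using C(2) Y(2) Z(2) by (metis card.empty zero_neq_numeral)+
  have one: "1 \<in> lens (MS C)" "1 \<in> lens (MS Y)" "1 \<in> lens (MS ?Z)"
    using C Y Z ne by (auto intro!: lens_MS_one[unfolded One_nat_def])
  have cCY: "card (C \<union> Y) = 6" using card_Un_Int[of C Y] C Y by simp
  have n0: "0 \<notin> C \<union> Y" using C Y by simp
  have R: "repeat_mset (n + n) B = repeat_mset n B + repeat_mset n B" for n and B :: "c2_4 multiset"
    by (rule multiset_eqI) (simp add: algebra_simps)
  have sub: "set_mset (repeat_mset n B) \<subseteq> set_mset B" for n and B :: "c2_4 multiset"
    by (auto simp flip: count_greater_zero_iff)
  have R1: "repeat_mset (Suc n) B = B + repeat_mset n B" for n and B :: "c2_4 multiset"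
    by (rule multiset_eqI) simp
  have rep: "i * 1 \<in> lens (repeat_mset i (MS C))" for i by (rule lens_repeat[OF one(1)])
  have "\<exists>D K S. set_mset (D + D) = C \<union> Y \<and> size D = 2 * (k + 2) \<and> k + 2 \<in> lens (D + D)
      \<and> zset K \<and> card K = 4 \<and> D + D = MS K + MS K + (S + S)"
  proof (cases "even k")
    case True
    then obtain i where i: "k = 2 * i" by (elim evenE)
    then obtain h where h: "i = Suc h" using mk(1) by (cases i) auto
    \<comment> \<open>For k = 2i take D = C^i Y, whose square is a product of 2i + 2
      circuits.\<close>
    define S where "S = repeat_mset h (MS C) + MS Y"
    define D where "D = MS C + S"
    have A: "D + D = repeat_mset (i + i) (MS C) + (MS Y + MS Y)"
      unfolding D_def S_def R h R1 by (simp add: ac_simps)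
    have "(i + i) * 1 + (1 + 1) \<in> lens (D + D)" unfolding A by (intro lens_plus rep one)
    then have "k + 2 \<in> lens (D + D)" using i by (simp add: mult_2)
    moreover have "set_mset (D + D) = C \<union> Y" using sub[of h "MS C"] by (auto simp: D_def S_def)
    moreover have "size D = 2 * (k + 2)" using C Y i h by (simp add: D_def S_def)
    moreover have "D + D = MS C + MS C + (S + S)" by (simp add: D_def ac_simps)
    ultimately show ?thesis using C by blast
  next
    case False
    then obtain i where i: "k = 2 * i + 1" by (elim oddE)
    \<comment> \<open>For k = 2i + 1 take D = C^i times \<open>C \<union> Y\<close>, whose square is
      C^(2i+1) Y Z. The 4-circuit split off from \<open>D\<close> is \<open>?Z\<close>, since
      \<open>C \<union> Y\<close> is the disjoint union of \<open>?Z\<close> and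
      \<open>C \<inter> Y\<close>.\<close>
    define S where "S = repeat_mset i (MS C) + MS (C \<inter> Y)"
    define D where "D = repeat_mset i (MS C) + MS (C \<union> Y)"
    have DS: "D = MS ?Z + S"
      unfolding D_def S_def by (rule multiset_eqI) (auto simp: count_mset_set')
    have A: "D + D = repeat_mset (i + i) (MS C) + (MS C + (MS Y + MS ?Z))"
      unfolding D_def R using MS_pair_union[of C Y] by (simp add: ac_simps)
    have "(i + i) * 1 + (1 + (1 + 1)) \<in> lens (D + D)" unfolding A by (intro lens_plus rep one)
    then have "k + 2 \<in> lens (D + D)" using i by (simp add: mult_2)
    moreover have "set_mset (D + D) = C \<union> Y" using sub[of i "MS C"] by (auto simp: D_def)
    moreover have "size D = 2 * (k + 2)" using C cCY i by (simp add: D_def)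
    moreover have "D + D = MS ?Z + MS ?Z + (S + S)" by (simp add: DS ac_simps)
    ultimately show ?thesis using Z by blast
  qed
  then obtain D K S where D: "set_mset (D + D) = C \<union> Y" "size D = 2 * (k + 2)" "k + 2 \<in> lens (D + D)"
    and K: "zset K" "card K = 4" "D + D = MS K + MS K + (S + S)" by blast
  have "affine_supp (D + D)" using aff unfolding affine_supp_def D(1) .
  from lens_affine_double[OF _ this refl _ D(3,2) _ K] have "lens (D + D) = {k + 2..2 * (k + 2) - 2} \<union> {2 * (k + 2)}"
    using n0 cCY D(1) by simp
  then have real: "realized ({k + 2..2 * (k + 2) - 2} \<union> {2 * (k + 2)})"
    unfolding realized_def using zero_sum_double by blast
  define d where "d = m0 - (k + 2)"
  have e: "k + 2 + d = m0" using mk(2) by (simp add: d_def)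
  then have e': "2 * (k + 2) - 2 + d = m0 + k" "d + 2 * (k + 2) = m0 + k + 2" by auto
  have "(+) d ` ({k + 2..2 * (k + 2) - 2} \<union> {2 * (k + 2)}) = X"
    unfolding image_Un image_add_atLeastAtMost mk(3) image_insert image_empty by (simp only: e e')
  then show ?thesis using realized_shift[OF real, of d] by simp
qed

lemma L1_subset_L2: "L1 \<subseteq> L2"
proof
  fix X assume "X \<in> L1"
  then obtain y where "X = {y}" by (auto simp: L1_def)
  then have "2 * 0 \<le> y" "X = (\<lambda>i. y + 3 * i) ` {..0}" by simp_all
  then show "X \<in> L2" unfolding L2_iff by blast
qed

lemma system_eq_realized: "system_of_sets_of_lengths TYPE(c2_4) = Collect realized"
  unfolding system_of_sets_of_lengths_def zero_sum_sequences_def realized_def set_of_lengths_eq_lens by blast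

lemma split_zeros: "\<exists>j B. A = replicate_mset j (0 :: c2_4) + B \<and> 0 \<notin># B"
proof -
  have "A = replicate_mset (count A 0) 0 + filter_mset (\<lambda>x. x \<noteq> 0) A"
    by (rule multiset_eqI) simp
  then show ?thesis by (metis (mono_tags, lifting) filter_mset_eq_conv mem_Collect_eq set_mset_filter)
qed

theorem theorem4p8:
  "system_of_sets_of_lengths TYPE(c2_4) = L1 \<union> L2 \<union> L3 \<union> L4 \<union> L5 \<union> L6 \<union> L7 \<union> L8
   \<and> L3 = L3_alt"
proof
  show "system_of_sets_of_lengths TYPE(c2_4) = L1 \<union> L2 \<union> L3 \<union> L4 \<union> L5 \<union> L6 \<union> L7 \<union> L8"
    unfolding system_eq_realized
  proof (intro set_eqI iffI)
    fix X assume "X \<in> Collect realized"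
    then obtain A :: "c2_4 multiset" where A: "\<Sum>\<^sub># A = 0" "lens A = X" by (auto simp: realized_def)
    obtain j B where B: "A = replicate_mset j 0 + B" "0 \<notin># B" using split_zeros by blast
    have "\<Sum>\<^sub># (replicate_mset j (0 :: c2_4)) = 0" by (induction j) simp_all
    then have "\<Sum>\<^sub># B = 0" using A(1) B(1) by simp
    from lens_in_system[OF B(2) this, of j] show "X \<in> L1 \<union> L2 \<union> L3 \<union> L4 \<union> L5 \<union> L6 \<union> L7 \<union> L8"
      using A(2) B(1) lens_replicate_zero[of j B] by simp
  next
    fix X assume "X \<in> L1 \<union> L2 \<union> L3 \<union> L4 \<union> L5 \<union> L6 \<union> L7 \<union> L8"
    then show "X \<in> Collect realized"
      using L1_subset_L2 realized_L2 realized_L3 realized_L4 realized_L5 realized_L6 realized_L7 realized_L8 by blast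
  qed
  show "L3 = L3_alt" by (rule L3_eq_L3_alt)
qed

end
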